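(* Let $h:\mathbb{R}\to(0,\infty)$ be a twice continuously differentiable probability density such that $h'/h$ is Lipschitz continuous, $\int [h'(x)/h(x)]^8\,h(x)\,dx<\infty$ and $\int [h''(x)/h(x)]^4\,h(x)\,dx<\infty$. Let $\ell>0$ be fixed. For each integer $d\ge 2$ let $\pi_d(\mathbf{x})=\prod_{i=1}^d h(x_i)$ on $\mathbb{R}^d$, and let $Z^{(d)}=\{Z^{(d)}_n\}_{n=0}^\infty$ be the Random-Walk Metropolis algorithm on $\mathbb{R}^d$ with target density $\pi_d$ and proposal variance $\sigma_d^2=\ell^2/(d-1)$. Then for every $\epsilon>0$ there are $D<\infty$ and $T<\infty$ such that $$\mathbf{E}_{Z^{(d)}_0\sim\pi_d}\,\bigl\|\mathcal{L}_{Z^{(d)}_0}\bigl(Z^{(d)}_{\lfloor dt\rfloor,1}\bigr)-h\bigr\|_{KR}<\epsilon\qquad\text{for all } t\ge T\text{ and all } d\ge D.$$ Hence the RWM algorithm takes $O(d)$ iterations to converge to within $\epsilon$ of stationarity in any one coordinate (in this averaged $KR$ distance): for every $\epsilon>0$ there are $D,T<\infty$ such that for all $d\ge D$ and all integers $n\ge dT$, and for each coordinate $i\in\{1,\dots,d\}$, $\mathbf{E}_{Z^{(d)}_0\sim\pi_d}\|\mathcal{L}_{Z^{(d)}_0}(Z^{(d)}_{n,i})-h\|_{KR}<\epsilon$.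
   Context: Random-Walk Metropolis (RWM) algorithm with target density $\pi_d$: a Markov chain on $\mathbb{R}^d$ which, given $Z^{(d)}_n$, draws a proposal $Y^{(d)}_{n+1}\sim N(Z^{(d)}_n,\sigma_d^2 I_d)$; with probability $\min[1,\pi_d(Y^{(d)}_{n+1})/\pi_d(Z^{(d)}_n)]$ it sets $Z^{(d)}_{n+1}=Y^{(d)}_{n+1}$, and otherwise $Z^{(d)}_{n+1}=Z^{(d)}_n$. The chain has stationary density $\pi_d$. $Z^{(d)}_{n,i}$ is the $i$-th coordinate of $Z^{(d)}_n$. $\mathcal{L}_z(Z^{(d)}_{n,i})$ is the law of $Z^{(d)}_{n,i}$ conditional on $Z^{(d)}_0=z$. In the $KR$ distance, $h$ stands for the probability measure $h(x)\,dx$ on $\mathbb{R}$. For a signed measure $\mu$ on $\mathbb{R}$ (with the usual metric), $\|\mu\|_{KR}=\sup_f\int f\,d\mu$, the supremum being over all $f:\mathbb{R}\to\mathbb{R}$ with $|f(x)-f(y)|\le|x-y|$ for all $x,y$ and $|f|\le 1$. $\mathbf{E}_{Z^{(d)}_0\sim\pi_d}$ denotes the average over starting states $z$ distributed according to the probability density $\pi_d$, i.e. $\int_{\mathbb{R}^d}\pi_d(z)\,\|\mathcal{L}_z(Z^{(d)}_{n,i})-h\|_{KR}\,dz$. *)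

theory Defs
  imports "HOL-Probability.Probability"
begin

text \<open>
  Points of \<open>\<real>\<^sup>d\<close> are functions in the carrier of the product of the spaces \<open>borel\<close> over the
  indices \<open>1, \<dots>, d\<close>, since the dimension is quantified over.
\<close>

definition euclid :: "nat \<Rightarrow> (nat \<Rightarrow> real) measure" where
  "euclid d = (\<Pi>\<^sub>M i\<in>{1..d}. borel)"

definition prod_density :: "(real \<Rightarrow> real) \<Rightarrow> nat \<Rightarrow> (nat \<Rightarrow> real) \<Rightarrow> real" where
  "prod_density h d x = (\<Prod>i\<in>{1..d}. h (x i))"

text \<open>
  The normal distribution \<open>N(z, v I\<^sub>d)\<close>, where \<open>v\<close> is the variance (the library's
  \<^const>\<open>normal_density\<close> takes the standard deviation).
\<close>

definition normal_proposal :: "nat \<Rightarrow> real \<Rightarrow> (nat \<Rightarrow> real) \<Rightarrow> (nat \<Rightarrow> real) measure" where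
  "normal_proposal d v z = (\<Pi>\<^sub>M i\<in>{1..d}. density lborel (normal_density (z i) (sqrt v)))"

text \<open>
  One step of random-walk Metropolis from the state \<open>z\<close>, for the target density \<open>p\<close> and the
  proposal variance \<open>v\<close>.
\<close>

definition rwm_kernel ::
    "nat \<Rightarrow> ((nat \<Rightarrow> real) \<Rightarrow> real) \<Rightarrow> real \<Rightarrow> (nat \<Rightarrow> real) \<Rightarrow> (nat \<Rightarrow> real) measure" where
  "rwm_kernel d p v z =
     normal_proposal d v z \<bind> (\<lambda>y.
       measure_pmf (bernoulli_pmf (min 1 (p y / p z))) \<bind> (\<lambda>accept.
         return (euclid d) (if accept then y else z)))"

text \<open>The law of the state of the chain after \<open>n\<close> steps, when it is started at \<open>z\<close>.\<close>

primrec rwm_law ::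
    "nat \<Rightarrow> ((nat \<Rightarrow> real) \<Rightarrow> real) \<Rightarrow> real \<Rightarrow> nat \<Rightarrow> (nat \<Rightarrow> real) \<Rightarrow> (nat \<Rightarrow> real) measure" where
  "rwm_law d p v 0 z = return (euclid d) z"
| "rwm_law d p v (Suc n) z = rwm_law d p v n z \<bind> rwm_kernel d p v"

definition rwm_coord_law ::
    "nat \<Rightarrow> ((nat \<Rightarrow> real) \<Rightarrow> real) \<Rightarrow> real \<Rightarrow> nat \<Rightarrow> nat \<Rightarrow> (nat \<Rightarrow> real) \<Rightarrow> real measure" where
  "rwm_coord_law d p v n i z = distr (rwm_law d p v n z) borel (\<lambda>x. x i)"

text \<open>
  The Kantorovich--Rubinstein norm of the signed measure \<open>\<mu> - \<nu>\<close>, for finite Borel measures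
  \<open>\<mu>\<close> and \<open>\<nu>\<close>; the supremum is then over a bounded set that contains \<open>0\<close>.
\<close>

definition KR_dist :: "real measure \<Rightarrow> real measure \<Rightarrow> real" where
  "KR_dist \<mu> \<nu> =
     (SUP f\<in>{f :: real \<Rightarrow> real. (\<forall>x y. \<bar>f x - f y\<bar> \<le> \<bar>x - y\<bar>) \<and> (\<forall>x. \<bar>f x\<bar> \<le> 1)}.
        (\<integral>x. f x \<partial>\<mu>) - (\<integral>x. f x \<partial>\<nu>))"

text \<open>
  The average of the distance of the law of \<open>Z\<^bsub>n,i\<^esub>\<close> to \<open>h(x) dx\<close> over starting states that are
  distributed according to the target density. The nonnegative integral is used because the
  Bochner integral of a function that is not integrable is \<open>0\<close> by convention.
\<close>

definition rwm_mean_KR :: "(real \<Rightarrow> real) \<Rightarrow> real \<Rightarrow> nat \<Rightarrow> nat \<Rightarrow> nat \<Rightarrow> ennreal" where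
  "rwm_mean_KR h v d n i =
     (\<integral>\<^sup>+ z. ennreal (prod_density h d z *
               KR_dist (rwm_coord_law d (prod_density h d) v n i z) (density lborel h))
        \<partial>(\<Pi>\<^sub>M i\<in>{1..d}. lborel))"

end

theory Submission
  imports Defs
begin

text \<open>
  The limiting diffusion is never constructed; its generator suffices. Let \<open>P\<close> be the Metropolis
  kernel in dimension \<open>d\<close> and \<open>k = d - 1\<close>. For a test function \<open>\<phi>\<close> of one coordinate,
  \<open>k (P \<phi> - \<phi>)\<close> tends in \<open>L\<^sup>1\<close> of the target to \<open>c (\<phi>'' + (ln h)' \<phi>')\<close> with \<open>c > 0\<close>. In one dimension
  every Lipschitz \<open>f\<close> of mean zero and compact support equals \<open>c (\<phi>'' + (ln h)' \<phi>')\<close> for such a \<open>\<phi>\<close>, with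
  \<open>c \<phi>' = (\<integral> f h) / h\<close>. Hence \<open>P\<^sup>n f\<close> is close to \<open>k P\<^sup>n (P \<phi> - \<phi>)\<close>, which has norm
  \<open>O(k / n)\<close> because \<open>P\<close> is self-adjoint; no spectral gap is needed.

  For the generator, the mean acceptance probability given the other coordinates is a concave
  function of the density ratio \<open>r\<close> of the moving coordinate. By the law of large numbers it
  converges for each fixed \<open>r\<close> to an explicit Gaussian integral, and concavity upgrades this to
  convergence of the slope at \<open>r = 1\<close>, which produces the drift.
\<close>

subsection \<open>Reversible kernels\<close>

text \<open>Two uniformities shape the argument. The supremum over test functions stands inside the
  average over starting points, so it has to be replaced by finitely many functions chosen before
  \<open>d\<close>; a grid of hat functions does this, because one large interval carries most of
  the mass of \<open>h\<close> for every \<open>d\<close>. And \<open>T\<close> may not depend on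
  \<open>d\<close>: with \<open>k = d - 1\<close> and \<open>n \<ge> d T\<close> a bound
  \<open>O(k / n)\<close> is \<open>O(1 / T)\<close>, so an algebraic rate in the number of steps is
  enough. All errors are measured in L^1 of the target, where \<open>P\<close> contracts; an error
  made once is never amplified by the \<open>n\<close> steps. Given the current state, the linear
  part of the log density ratio is exactly Gaussian, so no central limit theorem enters. Its
  variance settles at \<open>\<tau>^2 = l^2 * Fisher\<close>, and the quadratic part at
  \<open>- \<tau>^2 / 2\<close>, since the mean of \<open>(ln h)''\<close> is minus the Fisher
  information. The constant \<open>c\<close> is \<open>l^2 / 2\<close> times the limiting acceptance
  probability. The score \<open>(ln h)'\<close> may be unbounded; a compactly supported
  \<open>\<phi>'\<close> keeps the drift bounded.\<close>

definition bounded_measurable :: "'a measure \<Rightarrow> ('a \<Rightarrow> real) \<Rightarrow> bool" where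
  "bounded_measurable M f \<longleftrightarrow> f \<in> borel_measurable M \<and> (\<exists>C. \<forall>x\<in>space M. \<bar>f x\<bar> \<le> C)"

lemma bounded_measurableI:
  "f \<in> borel_measurable M \<Longrightarrow> (\<And>x. x \<in> space M \<Longrightarrow> \<bar>f x\<bar> \<le> C) \<Longrightarrow> bounded_measurable M f"
  by (auto simp: bounded_measurable_def)

lemma bounded_measurableD[measurable_dest]:
  "bounded_measurable M f \<Longrightarrow> f \<in> borel_measurable M"
  by (auto simp: bounded_measurable_def)

lemma bounded_measurable_const[simp]: "bounded_measurable M (\<lambda>_. c)"
  by (auto intro: bounded_measurableI[where C="\<bar>c\<bar>"])

lemma bounded_measurable_add:
  assumes "bounded_measurable M f" "bounded_measurable M g"
  shows "bounded_measurable M (\<lambda>x. f x + g x)"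
proof -
  obtain C D where "\<forall>x\<in>space M. \<bar>f x\<bar> \<le> C" "\<forall>x\<in>space M. \<bar>g x\<bar> \<le> D"
    using assms by (auto simp: bounded_measurable_def)
  then show ?thesis
    using assms by (intro bounded_measurableI[where C="C + D"]) (auto dest: bounded_measurableD intro: order_trans[OF abs_triangle_ineq] add_mono)
qed

lemma bounded_measurable_mult:
  assumes "bounded_measurable M f" "bounded_measurable M g"
  shows "bounded_measurable M (\<lambda>x. f x * g x)"
proof -
  obtain C D where "\<forall>x\<in>space M. \<bar>f x\<bar> \<le> C" "\<forall>x\<in>space M. \<bar>g x\<bar> \<le> D"
    using assms by (auto simp: bounded_measurable_def)
  then have "\<bar>f x * g x\<bar> \<le> C * D" if "x \<in> space M" for x
    unfolding abs_mult using that abs_ge_zero order_trans by (intro mult_mono) blast+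
  then show ?thesis
    using assms by (intro bounded_measurableI[where C="C * D"]) (auto dest: bounded_measurableD)
qed

lemma bounded_measurable_diff:
  assumes "bounded_measurable M f" "bounded_measurable M g"
  shows "bounded_measurable M (\<lambda>x. f x - g x)"
  using bounded_measurable_add[OF assms(1) bounded_measurable_mult[OF bounded_measurable_const[of M "-1"] assms(2)]]
  by simp

lemma bounded_measurable_abs:
  "bounded_measurable M f \<Longrightarrow> bounded_measurable M (\<lambda>x. \<bar>f x\<bar>)"
  by (auto simp: bounded_measurable_def)

lemma bounded_measurable_power2:
  "bounded_measurable M f \<Longrightarrow> bounded_measurable M (\<lambda>x. (f x)\<^sup>2)"
  unfolding power2_eq_square by (rule bounded_measurable_mult)

lemmas bounded_measurable_intros =
  bounded_measurable_const bounded_measurable_add bounded_measurable_diff bounded_measurable_mult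
  bounded_measurable_abs bounded_measurable_power2

lemma (in prob_space) integrable_bounded_measurable:
  "bounded_measurable M f \<Longrightarrow> integrable M f"
  by (auto simp: bounded_measurable_def intro!: integrable_const_bound AE_I2)

text \<open>Cauchy-Schwarz against the constant \<open>1\<close>, obtained from the nonnegative
  variance of the absolute value.\<close>

lemma (in prob_space) integral_abs_le_sqrt:
  fixes f :: "'a \<Rightarrow> real"
  assumes [measurable]: "f \<in> borel_measurable M" and f2: "integrable M (\<lambda>x. (f x)\<^sup>2)"
  shows "integrable M f" "(\<integral>x. \<bar>f x\<bar> \<partial>M) \<le> sqrt (\<integral>x. (f x)\<^sup>2 \<partial>M)"
proof -
  show f: "integrable M f"
    by (rule square_integrable_imp_integrable[OF _ f2]) auto
  have "0 \<le> variance (\<lambda>x. \<bar>f x\<bar>)"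
    by (rule variance_positive)
  also have "\<dots> = (\<integral>x. (f x)\<^sup>2 \<partial>M) - (\<integral>x. \<bar>f x\<bar> \<partial>M)\<^sup>2"
    using f f2 by (subst variance_eq) auto
  finally show "(\<integral>x. \<bar>f x\<bar> \<partial>M) \<le> sqrt (\<integral>x. (f x)\<^sup>2 \<partial>M)"
    by (intro real_le_rsqrt) auto
qed

text \<open>Detailed balance in weak form, tested on bounded functions only. Choosing one of the two
  constant yields stationarity of \<open>M\<close>.\<close>

locale reversible_kernel = prob_space M for M :: "'a measure" +
  fixes K :: "'a \<Rightarrow> 'a measure"
  assumes kernel: "K \<in> M \<rightarrow>\<^sub>M prob_algebra M"
    and reversible: "\<And>f g. bounded_measurable M f \<Longrightarrow> bounded_measurable M g \<Longrightarrow>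
          (\<integral>x. f x * (\<integral>y. g y \<partial>K x) \<partial>M) = (\<integral>x. g x * (\<integral>y. f y \<partial>K x) \<partial>M)"
begin

definition op :: "('a \<Rightarrow> real) \<Rightarrow> 'a \<Rightarrow> real" where
  "op f x = (\<integral>y. f y \<partial>K x)"

abbreviation bm :: "('a \<Rightarrow> real) \<Rightarrow> bool" where
  "bm \<equiv> bounded_measurable M"

lemma prob_space_K: "x \<in> space M \<Longrightarrow> prob_space (K x)"
  and sets_K: "x \<in> space M \<Longrightarrow> sets (K x) = sets M"
  using measurable_space[OF kernel] by (auto simp: space_prob_algebra)

lemma bm_K: "x \<in> space M \<Longrightarrow> bm f \<Longrightarrow> bounded_measurable (K x) f"
  using sets_K[of x] sets_eq_imp_space_eq[of "K x" M]
  by (auto simp: bounded_measurable_def cong: measurable_cong_sets)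

lemma integrable_K: "x \<in> space M \<Longrightarrow> bm f \<Longrightarrow> integrable (K x) f"
  by (intro prob_space.integrable_bounded_measurable prob_space_K bm_K)

lemma op_bm [intro]: assumes f: "bm f" shows "bm (op f)"
proof -
  obtain C where C: "\<And>x. x \<in> space M \<Longrightarrow> \<bar>f x\<bar> \<le> C" and [measurable]: "f \<in> borel_measurable M"
    using f by (auto simp: bounded_measurable_def)
  note [measurable] = measurable_prob_algebraD[OF kernel]
  show ?thesis
  proof (rule bounded_measurableI)
    show "op f \<in> borel_measurable M"
      unfolding op_def by measurable
    show "\<bar>op f x\<bar> \<le> C" if x: "x \<in> space M" for x
    proof -
      interpret Kx: prob_space "K x" by (rule prob_space_K[OF x])
      have "\<bar>op f x\<bar> \<le> (\<integral>y. C \<partial>K x)"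
        unfolding op_def using integrable_K[OF x f] C sets_eq_imp_space_eq[OF sets_K[OF x]]
        by (intro order_trans[OF integral_abs_bound] integral_mono) (auto)
      then show ?thesis by (simp add: Kx.prob_space)
    qed
  qed
qed

lemma op_power_bm [intro]: "bm f \<Longrightarrow> bm ((op ^^ n) f)"
  by (induction n) auto

lemma op_cong: "x \<in> space M \<Longrightarrow> (\<And>y. y \<in> space M \<Longrightarrow> f y = g y) \<Longrightarrow> op f x = op g x"
  unfolding op_def by (rule Bochner_Integration.integral_cong) (auto simp: sets_eq_imp_space_eq[OF sets_K])

lemma op_power_cong:
  "x \<in> space M \<Longrightarrow> (\<And>y. y \<in> space M \<Longrightarrow> f y = g y) \<Longrightarrow> (op ^^ n) f x = (op ^^ n) g x"
  by (induction n arbitrary: x) (auto intro: op_cong)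

lemma op_linear:
  assumes "x \<in> space M" "bm f" "bm g"
  shows op_add: "op (\<lambda>y. f y + g y) x = op f x + op g x"
    and op_diff: "op (\<lambda>y. f y - g y) x = op f x - op g x"
    and op_scale: "op (\<lambda>y. c * f y) x = c * op f x"
  unfolding op_def using assms by (auto intro!: integrable_K Bochner_Integration.integral_add Bochner_Integration.integral_diff)

lemma op_const: "x \<in> space M \<Longrightarrow> op (\<lambda>_. c) x = c"
  unfolding op_def using prob_space.prob_space[OF prob_space_K] by simp

lemma op_power_linear:
  assumes "x \<in> space M" "bm f" "bm g"
  shows op_power_add: "(op ^^ n) (\<lambda>y. f y + g y) x = (op ^^ n) f x + (op ^^ n) g x"
    and op_power_diff: "(op ^^ n) (\<lambda>y. f y - g y) x = (op ^^ n) f x - (op ^^ n) g x"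
    and op_power_scale: "(op ^^ n) (\<lambda>y. c * f y) x = c * (op ^^ n) f x"
proof -
  have "x \<in> space M \<Longrightarrow> (op ^^ n) (\<lambda>y. f y + g y) x = (op ^^ n) f x + (op ^^ n) g x" for x
  proof (induction n arbitrary: x)
    case (Suc n)
    have "op ((op ^^ n) (\<lambda>y. f y + g y)) x = op (\<lambda>y. (op ^^ n) f y + (op ^^ n) g y) x"
      using Suc by (intro op_cong) auto
    then show ?case using op_add[OF Suc.prems, of "(op^^n) f" "(op^^n) g"] assms by auto
  qed auto
  then show "(op ^^ n) (\<lambda>y. f y + g y) x = (op ^^ n) f x + (op ^^ n) g x" using assms(1) .
  have "x \<in> space M \<Longrightarrow> (op ^^ n) (\<lambda>y. f y - g y) x = (op ^^ n) f x - (op ^^ n) g x" for x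
  proof (induction n arbitrary: x)
    case (Suc n)
    have "op ((op ^^ n) (\<lambda>y. f y - g y)) x = op (\<lambda>y. (op ^^ n) f y - (op ^^ n) g y) x"
      using Suc by (intro op_cong) auto
    then show ?case using op_diff[OF Suc.prems, of "(op^^n) f" "(op^^n) g"] assms by auto
  qed auto
  then show "(op ^^ n) (\<lambda>y. f y - g y) x = (op ^^ n) f x - (op ^^ n) g x" using assms(1) .
  have "x \<in> space M \<Longrightarrow> (op ^^ n) (\<lambda>y. c * f y) x = c * (op ^^ n) f x" for x
  proof (induction n arbitrary: x)
    case (Suc n)
    have "op ((op ^^ n) (\<lambda>y. c * f y)) x = op (\<lambda>y. c * (op ^^ n) f y) x"
      using Suc by (intro op_cong) auto
    \<comment> \<open>\<open>op_scale\<close> shares its premises with \<open>op_add\<close> and so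
      asks for a second function; the same one is supplied twice.\<close>
    then show ?case using op_scale[OF Suc.prems, of "(op^^n) f" "(op^^n) f"] assms by auto
  qed auto
  then show "(op ^^ n) (\<lambda>y. c * f y) x = c * (op ^^ n) f x" using assms(1) .
qed

lemma op_power_const: "x \<in> space M \<Longrightarrow> (op ^^ n) (\<lambda>_. c) x = c"
proof (induction n arbitrary: x)
  case (Suc n)
  then have "op ((op ^^ n) (\<lambda>_. c)) x = op (\<lambda>_. c) x" by (intro op_cong) auto
  then show ?case using Suc.prems by (simp add: op_const)
qed simp

lemma op_self_adjoint:
  "bm f \<Longrightarrow> bm g \<Longrightarrow> (\<integral>x. f x * op g x \<partial>M) = (\<integral>x. op f x * g x \<partial>M)"
  unfolding op_def by (subst reversible) (auto simp: mult.commute)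

text \<open>Stationarity is self-adjointness tested against the constant \<open>1\<close>, which
  \<open>op\<close> fixes.\<close>

lemma integral_op: assumes "bm f" shows "(\<integral>x. op f x \<partial>M) = (\<integral>x. f x \<partial>M)"
proof -
  have "(\<integral>x. op f x \<partial>M) = (\<integral>x. op (\<lambda>_. 1) x * f x \<partial>M)"
    using op_self_adjoint[of "\<lambda>_. 1" f] assms by simp
  also have "\<dots> = (\<integral>x. f x \<partial>M)"
    by (intro Bochner_Integration.integral_cong) (auto simp: op_const)
  finally show ?thesis .
qed

text \<open>Pointwise \<open>|P f| \<le> P |f|\<close>, and then stationarity. This contraction lets
  an approximation error pass through any number of steps without growing.\<close>

lemma integral_abs_op_le: assumes f: "bm f" shows "(\<integral>x. \<bar>op f x\<bar> \<partial>M) \<le> (\<integral>x. \<bar>f x\<bar> \<partial>M)"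
proof -
  have "(\<integral>x. \<bar>op f x\<bar> \<partial>M) \<le> (\<integral>x. op (\<lambda>y. \<bar>f y\<bar>) x \<partial>M)"
    using f by (intro integral_mono integrable_bounded_measurable bounded_measurable_intros op_bm)
      (auto simp: op_def intro: integral_abs_bound)
  also have "\<dots> = (\<integral>x. \<bar>f x\<bar> \<partial>M)"
    using f by (intro integral_op bounded_measurable_intros)
  finally show ?thesis .
qed

lemma integral_abs_op_power_le:
  assumes f: "bm f" shows "(\<integral>x. \<bar>(op ^^ n) f x\<bar> \<partial>M) \<le> (\<integral>x. \<bar>f x\<bar> \<partial>M)"
  using f by (induction n) (auto intro: order_trans[OF integral_abs_op_le])

text \<open>Jensen's inequality under each \<open>K x\<close>, in the form of a nonnegative
  variance, followed by stationarity.\<close>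

lemma integral_square_op_le: assumes f: "bm f" shows "(\<integral>x. (op f x)\<^sup>2 \<partial>M) \<le> (\<integral>x. (f x)\<^sup>2 \<partial>M)"
proof -
  have *: "(op f x)\<^sup>2 \<le> op (\<lambda>y. (f y)\<^sup>2) x" if x: "x \<in> space M" for x
  proof -
    interpret Kx: prob_space "K x" by (rule prob_space_K[OF x])
    have "0 \<le> Kx.variance f" by (rule Kx.variance_positive)
    also have "\<dots> = op (\<lambda>y. (f y)\<^sup>2) x - (op f x)\<^sup>2"
      unfolding op_def using f by (intro Kx.variance_eq integrable_K x bounded_measurable_intros)
    finally show ?thesis by simp
  qed
  have "(\<integral>x. (op f x)\<^sup>2 \<partial>M) \<le> (\<integral>x. op (\<lambda>y. (f y)\<^sup>2) x \<partial>M)"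
    using f by (intro integral_mono integrable_bounded_measurable bounded_measurable_intros op_bm *)
  also have "\<dots> = (\<integral>x. (f x)\<^sup>2 \<partial>M)"
    using f by (intro integral_op bounded_measurable_intros)
  finally show ?thesis .
qed

text \<open>
  With \<open>a k = \<parallel>P\<^sup>k \<phi>\<parallel>\<^sup>2\<close>, self-adjointness turns \<open>\<parallel>P\<^sup>k (\<phi> - P\<^sup>2 \<phi>)\<parallel>\<^sup>2\<close> into the second difference of
  \<open>a\<close>. It is nonnegative and nonincreasing in \<open>k\<close>, and summing it twice recovers at most \<open>a 0\<close>.
\<close>

lemma norm_op_power_diff_le:
  assumes \<phi>: "bm \<phi>"
  shows "(real n)\<^sup>2 * (\<integral>x. ((op ^^ n) (\<lambda>y. \<phi> y - op (op \<phi>) y) x)\<^sup>2 \<partial>M) \<le> 4 * (\<integral>x. (\<phi> x)\<^sup>2 \<partial>M)"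
proof -
  define F where "F k = (op ^^ k) \<phi>" for k
  define a where "a k = (\<integral>x. (F k x)\<^sup>2 \<partial>M)" for k
  define g where "g = (\<lambda>y. \<phi> y - op (op \<phi>) y)"
  define c where "c k = (\<integral>x. ((op ^^ k) g x)\<^sup>2 \<partial>M)" for k
  define b where "b k = a k - a (Suc k)" for k
  have F[intro]: "bm (F k)" for k unfolding F_def using \<phi> by auto
  have g: "bm g" unfolding g_def using \<phi> by (intro bounded_measurable_intros op_bm)
  have c_eq: "c k = b k - b (Suc k)" for k
  proof -
    have gk: "(op ^^ k) g x = F k x - F (Suc (Suc k)) x" if "x \<in> space M" for x
    proof -
      have "(op ^^ k) g x = F k x - (op ^^ k) (op (op \<phi>)) x"
        unfolding g_def F_def using op_power_diff[OF that \<phi>] \<phi> by auto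
      also have "(op ^^ k) (op (op \<phi>)) = F (Suc (Suc k))"
        unfolding F_def by (simp add: funpow_swap1)
      finally show ?thesis .
    qed
    \<comment> \<open>Moving one factor \<open>P\<close> across the inner product of
      \<open>F k\<close> and \<open>F (k + 2)\<close> leaves the squared norm of
      \<open>F (k + 1)\<close>.\<close>
    have cross: "(\<integral>x. F k x * F (Suc (Suc k)) x \<partial>M) = a (Suc k)"
      using op_self_adjoint[OF F[of k] F[of "Suc k"]] by (simp add: a_def F_def power2_eq_square)
    have "c k = (\<integral>x. (F k x)\<^sup>2 - 2 * (F k x * F (Suc (Suc k)) x) + (F (Suc (Suc k)) x)\<^sup>2 \<partial>M)"
      unfolding c_def
      by (intro Bochner_Integration.integral_cong) (simp_all add: gk power2_diff algebra_simps)
    also have "\<dots> = a k - 2 * a (Suc k) + a (Suc (Suc k))"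
      unfolding a_def cross[unfolded a_def, symmetric]
      by (subst Bochner_Integration.integral_add Bochner_Integration.integral_diff
            | intro integrable_bounded_measurable bounded_measurable_intros F | simp)+
    finally show ?thesis by (simp add: b_def)
  qed
  have c_nonneg: "0 \<le> c k" for k unfolding c_def by (simp add: integral_nonneg_AE)
  have c_Suc: "c (Suc k) \<le> c k" for k
    unfolding c_def using integral_square_op_le[OF op_power_bm[OF g]] by simp
  have c_anti: "j \<le> k \<Longrightarrow> c k \<le> c j" for j k
    by (rule lift_Suc_antimono_le[of c, OF c_Suc]) 
  have b_nonneg: "0 \<le> b k" for k
    unfolding b_def a_def F_def using integral_square_op_le[OF op_power_bm[OF \<phi>]] by simp
  have b_anti: "j \<le> k \<Longrightarrow> b k \<le> b j" for j k
    by (rule lift_Suc_antimono_le[of b]) (use c_eq c_nonneg in \<open>smt (verit)\<close>)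
  \<comment> \<open>Cutting at \<open>n div 2\<close> leaves at least \<open>n / 2\<close> terms in
    each of two sums: averaging the \<open>b j\<close> up to \<open>m\<close> bounds
    \<open>b m\<close> by \<open>a 0\<close>, and averaging the \<open>c j\<close> from
    \<open>m\<close> to \<open>n\<close> bounds \<open>c n\<close> by \<open>b m\<close>. The
    product of the two factors \<open>2 / n\<close> gives the constant \<open>4\<close>.\<close>
  define m where "m = n div 2"
  have sum_b: "(\<Sum>j<k. b j) = a 0 - a k" for k
    unfolding b_def by (rule sum_lessThan_telescope')
  have "real (Suc m) * b m \<le> (\<Sum>j<Suc m. b j)"
    using sum_bounded_below[of "{..<Suc m}" "b m" b] b_anti by auto
  also have "\<dots> \<le> a 0" unfolding sum_b by (simp add: a_def integral_nonneg_AE)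
  finally have 1: "real (Suc m) * b m \<le> a 0" .
  have "(\<Sum>j=m..<Suc n. c j) = (\<Sum>j=m..<Suc n. (- b (Suc j)) - (- b j))"
    by (simp add: c_eq)
  also have "\<dots> = b m - b (Suc n)"
    using sum_Suc_diff'[of m "Suc n" "\<lambda>j. - b j"] by (simp add: m_def)
  finally have sum_c: "(\<Sum>j=m..<Suc n. c j) \<le> b m" using b_nonneg[of "Suc n"] by simp
  have "real (Suc n - m) * c n \<le> (\<Sum>j=m..<Suc n. c j)"
    using sum_bounded_below[of "{m..<Suc n}" "c n" c] c_anti by auto
  with sum_c have 2: "real (Suc n - m) * c n \<le> b m" by simp
  have h1: "real n / 2 \<le> real (Suc m)" and h2: "real n / 2 \<le> real (Suc n - m)"
    unfolding m_def by linarith+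
  have "(real n / 2) * ((real n / 2) * c n) \<le> real (Suc m) * (real (Suc n - m) * c n)"
    using h1 h2 c_nonneg by (intro mult_mono) auto
  also have "\<dots> \<le> real (Suc m) * b m" using 2 by (intro mult_left_mono) auto
  also have "\<dots> \<le> a 0" by (rule 1)
  finally show ?thesis unfolding c_def g_def a_def F_def by (simp add: power2_eq_square)
qed

text \<open>Only the part of \<open>f\<close> in the range of \<open>P^2 - 1\<close> is smoothed, at
  rate \<open>k / n\<close>. The defect \<open>r\<close> of the generator equation and the one-step
  change \<open>s\<close> of \<open>f\<close> are not smoothed, but the L^1 contraction bounds them
  by their initial size. The identity behind the split is
  \<open>2 f = k (P^2 \<phi> - \<phi>) - (r + P r + s)\<close>.\<close>

lemma integral_abs_op_power_le_generator:
  assumes f: "bm f" and \<phi>: "bm \<phi>" and \<phi>_le: "\<And>x. x \<in> space M \<Longrightarrow> \<bar>\<phi> x\<bar> \<le> C" and k: "0 \<le> k" and n: "n > 0"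
  shows "(\<integral>x. \<bar>(op ^^ n) f x\<bar> \<partial>M) \<le>
    k * C / real n + (\<integral>x. \<bar>k * (op \<phi> x - \<phi> x) - f x\<bar> \<partial>M) + (\<integral>x. \<bar>op f x - f x\<bar> \<partial>M)"
proof -
  define r where "r = (\<lambda>x. k * (op \<phi> x - \<phi> x) - f x)"
  define s where "s = (\<lambda>x. op f x - f x)"
  define g where "g = (\<lambda>x. \<phi> x - op (op \<phi>) x)"
  have bm: "bm r" "bm s" "bm g" "bm (op f)" "bm (op \<phi>)" "bm (op r)" "bm (op (op \<phi>))"
    unfolding r_def s_def g_def using f \<phi> by (auto intro!: bounded_measurable_intros op_bm)
  have op_r: "op r x = k * (op (op \<phi>) x - op \<phi> x) - op f x" if x: "x \<in> space M" for x
  proof -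
    have "op r x = op (\<lambda>y. k * (op \<phi> y - \<phi> y)) x - op f x"
      unfolding r_def using x f \<phi> bm by (intro op_diff bounded_measurable_intros)
    also have "op (\<lambda>y. k * (op \<phi> y - \<phi> y)) x = k * op (\<lambda>y. op \<phi> y - \<phi> y) x"
      using x \<phi> bm by (intro op_scale[where g=\<phi>] bounded_measurable_intros)
    also have "op (\<lambda>y. op \<phi> y - \<phi> y) x = op (op \<phi>) x - op \<phi> x"
      using x \<phi> bm by (intro op_diff)
    finally show ?thesis .
  qed
  \<comment> \<open>Doubling \<open>f\<close> brings in \<open>P\<^sup>2\<close>, which is nonnegative although \<open>P\<close> need not be.\<close>
  define w where "w = (\<lambda>x. (-k/2) * g x)"
  define v where "v = (\<lambda>x. (1/2) * (r x + op r x + s x))"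
  have bmwv: "bm w" "bm v"
    unfolding w_def v_def using bm
    by (safe intro!: bounded_measurable_mult bounded_measurable_add bounded_measurable_const)
  have decomp: "f x = w x - v x" if x: "x \<in> space M" for x
    unfolding w_def v_def g_def op_r[OF x] by (simp add: r_def s_def field_simps)
  have fwv: "\<bar>(op ^^ n) f x\<bar> \<le> \<bar>(op ^^ n) w x\<bar> + \<bar>(op ^^ n) v x\<bar>" if x: "x \<in> space M" for x
  proof -
    have "(op ^^ n) f x = (op ^^ n) (\<lambda>x. w x - v x) x" by (intro op_power_cong x decomp)
    then show ?thesis using op_power_diff[OF x bmwv] by simp
  qed
  have "(\<integral>x. \<bar>(op ^^ n) f x\<bar> \<partial>M) \<le> (\<integral>x. \<bar>(op ^^ n) w x\<bar> + \<bar>(op ^^ n) v x\<bar> \<partial>M)"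
    using bmwv f fwv
    by (intro integral_mono integrable_bounded_measurable bounded_measurable_intros op_power_bm) auto
  also have "\<dots> = (\<integral>x. \<bar>(op ^^ n) w x\<bar> \<partial>M) + (\<integral>x. \<bar>(op ^^ n) v x\<bar> \<partial>M)"
    using bmwv by (intro Bochner_Integration.integral_add integrable_bounded_measurable bounded_measurable_intros op_power_bm) auto
  finally have split: "(\<integral>x. \<bar>(op ^^ n) f x\<bar> \<partial>M) \<le> (\<integral>x. \<bar>(op ^^ n) w x\<bar> \<partial>M) + (\<integral>x. \<bar>(op ^^ n) v x\<bar> \<partial>M)" .
  have "(\<integral>x. \<bar>(op ^^ n) v x\<bar> \<partial>M) \<le> (\<integral>x. \<bar>v x\<bar> \<partial>M)"
    by (rule integral_abs_op_power_le) fact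
  also have "\<dots> \<le> (\<integral>x. (1/2) * (\<bar>r x\<bar> + \<bar>op r x\<bar> + \<bar>s x\<bar>) \<partial>M)"
    unfolding v_def using bm by (intro integral_mono integrable_bounded_measurable bounded_measurable_intros) auto
  also have "\<dots> = (1/2) * ((\<integral>x. \<bar>r x\<bar> \<partial>M) + (\<integral>x. \<bar>op r x\<bar> \<partial>M) + (\<integral>x. \<bar>s x\<bar> \<partial>M))"
    using bm by (simp add: Bochner_Integration.integral_add integrable_bounded_measurable bounded_measurable_intros)
  also have "\<dots> \<le> (\<integral>x. \<bar>r x\<bar> \<partial>M) + (\<integral>x. \<bar>s x\<bar> \<partial>M)"
  proof -
    have half: "(1/2) * (a + b + c) \<le> a + c" if "b \<le> a" "0 \<le> c" for a b c :: real
      using that by simp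
    show ?thesis by (rule half) (auto intro: integral_abs_op_le bm)
  qed
  finally have v_le: "(\<integral>x. \<bar>(op ^^ n) v x\<bar> \<partial>M) \<le> (\<integral>x. \<bar>r x\<bar> \<partial>M) + (\<integral>x. \<bar>s x\<bar> \<partial>M)" .
  \<comment> \<open>The decay is an estimate in L^2 while the remaining errors are in L^1;
    Cauchy-Schwarz joins the two.\<close>
  have "(\<integral>x. \<bar>(op ^^ n) g x\<bar> \<partial>M) \<le> sqrt (\<integral>x. ((op ^^ n) g x)\<^sup>2 \<partial>M)"
    using bm by (intro integral_abs_le_sqrt(2) integrable_bounded_measurable bounded_measurable_intros bounded_measurableD op_power_bm) auto
  also have "\<dots> \<le> 2 * C / real n"
  proof (rule real_le_lsqrt)
    have C0: "C \<ge> 0" using \<phi>_le not_empty by (metis abs_ge_zero equals0I order_trans)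
    then show "0 \<le> 2 * C / real n" by simp
    have "(real n)\<^sup>2 * (\<integral>x. ((op ^^ n) g x)\<^sup>2 \<partial>M) \<le> 4 * (\<integral>x. (\<phi> x)\<^sup>2 \<partial>M)"
      unfolding g_def by (rule norm_op_power_diff_le) fact
    also have "4 * (\<integral>x. (\<phi> x)\<^sup>2 \<partial>M) \<le> 4 * (\<integral>x. C\<^sup>2 \<partial>M)"
      using \<phi> \<phi>_le C0 by (intro mult_left_mono integral_mono integrable_bounded_measurable bounded_measurable_intros)
        (auto simp: abs_le_square_iff[symmetric])
    finally show "(\<integral>x. ((op ^^ n) g x)\<^sup>2 \<partial>M) \<le> (2 * C / real n)\<^sup>2"
      using n by (simp add: prob_space field_simps power2_eq_square)
  qed
  finally have g_le: "(\<integral>x. \<bar>(op ^^ n) g x\<bar> \<partial>M) \<le> 2 * C / real n" .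
  have "(\<integral>x. \<bar>(op ^^ n) w x\<bar> \<partial>M) = (\<integral>x. (k/2) * \<bar>(op ^^ n) g x\<bar> \<partial>M)"
  proof (intro Bochner_Integration.integral_cong refl)
    fix x assume x: "x \<in> space M"
    have "(op ^^ n) w x = (-k/2) * (op ^^ n) g x"
      unfolding w_def using op_power_scale[OF x bm(3) bm(3)] .
    then show "\<bar>(op ^^ n) w x\<bar> = (k/2) * \<bar>(op ^^ n) g x\<bar>" using k by (simp add: abs_mult)
  qed
  also have "\<dots> = (k/2) * (\<integral>x. \<bar>(op ^^ n) g x\<bar> \<partial>M)" by simp
  also have "\<dots> \<le> (k/2) * (2 * C / real n)" using g_le k by (intro mult_left_mono) auto
  finally show ?thesis
    using split v_le by (simp add: r_def s_def)
qed

end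

subsection \<open>Product measures and Gaussian sums\<close>

text \<open>A single noise law with the scale pulled out: proposals become
  \<open>z + \<sigma> * \<xi>\<close>, so that a limit in \<open>\<sigma>\<close> is a limit of
  integrands under one fixed measure.\<close>

definition std_normal :: "real measure" where
  "std_normal = density lborel std_normal_density"

lemma sets_std_normal[simp, measurable_cong]: "sets std_normal = sets borel"
  and space_std_normal[simp]: "space std_normal = UNIV"
  by (simp_all add: std_normal_def)

lemma prob_space_std_normal[simp, intro]: "prob_space std_normal"
  unfolding std_normal_def by (rule prob_space_normal_density) simp

lemma integrable_std_normal_iff:
  fixes f :: "real \<Rightarrow> real"
  shows "f \<in> borel_measurable borel \<Longrightarrow>
    integrable std_normal f \<longleftrightarrow> integrable lborel (\<lambda>x. std_normal_density x * f x)"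
  unfolding std_normal_def by (subst integrable_density) auto

lemma integral_std_normal_eq:
  fixes f :: "real \<Rightarrow> real"
  shows "f \<in> borel_measurable borel \<Longrightarrow>
    (\<integral>x. f x \<partial>std_normal) = (\<integral>x. std_normal_density x * f x \<partial>lborel)"
  unfolding std_normal_def by (subst integral_density) auto

lemma integrable_std_normal_power [simp, intro]:
  "integrable std_normal (\<lambda>x. x ^ k)" "integrable std_normal (\<lambda>x. \<bar>x\<bar> ^ k)"
  by (simp_all add: integrable_std_normal_iff integrable_std_normal_moment integrable_std_normal_moment_abs)

lemma integral_std_normal_moments:
  "(\<integral>x. x \<partial>std_normal) = 0" "(\<integral>x. x\<^sup>2 \<partial>std_normal) = 1" "(\<integral>x. x ^ 4 \<partial>std_normal) = 3"
  using integral_std_normal_moment_odd[of 0] integral_std_normal_moment_even[of 1] integral_std_normal_moment_even[of 2]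
  by (simp_all add: integral_std_normal_eq fact_numeral)

lemma normal_eq_distr_std_normal:
  assumes "\<sigma> > 0"
  shows "density lborel (normal_density x \<sigma>) = distr std_normal borel (\<lambda>y. x + \<sigma> * y)"
proof -
  interpret prob_space std_normal by simp
  have "distributed std_normal lborel (\<lambda>y. y) std_normal_density"
    by (auto simp: distributed_def std_normal_def distr_id2)
  then have "distributed std_normal lborel (\<lambda>y. x + \<sigma> * y) (normal_density (x + \<sigma> * 0) (\<bar>\<sigma>\<bar> * 1))"
    using assms by (intro normal_density_affine) auto
  then have "distr std_normal lborel (\<lambda>y. x + \<sigma> * y) = density lborel (normal_density x \<sigma>)"
    using assms by (auto simp: distributed_def)
  moreover have "distr std_normal lborel (\<lambda>y. x + \<sigma> * y) = distr std_normal borel (\<lambda>y. x + \<sigma> * y)"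
    by (rule distr_cong) auto
  ultimately show ?thesis by simp
qed

lemma integral_PiM_component:
  fixes f :: "'a \<Rightarrow> real"
  assumes "\<And>i. i \<in> I \<Longrightarrow> prob_space (M i)" "i \<in> I" "f \<in> borel_measurable (M i)"
  shows "(\<integral>x. f (x i) \<partial>PiM I M) = (\<integral>x. f x \<partial>M i)"
    and "integrable (PiM I M) (\<lambda>x. f (x i)) \<longleftrightarrow> integrable (M i) f"
proof -
  have *: "(\<lambda>x. x i) \<in> PiM I M \<rightarrow>\<^sub>M M i" using assms by measurable
  have "(\<integral>x. f x \<partial>M i) = (\<integral>x. f x \<partial>distr (PiM I M) (M i) (\<lambda>x. x i))"
    using assms by (subst distr_PiM_component) auto
  then show "(\<integral>x. f (x i) \<partial>PiM I M) = (\<integral>x. f x \<partial>M i)"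
    using assms * by (subst (asm) integral_distr) auto
  have "integrable (M i) f \<longleftrightarrow> integrable (distr (PiM I M) (M i) (\<lambda>x. x i)) f"
    using assms by (subst distr_PiM_component) auto
  then show "integrable (PiM I M) (\<lambda>x. f (x i)) \<longleftrightarrow> integrable (M i) f"
    using assms * by (subst (asm) integrable_distr_eq) auto
qed

lemma product_prob_space_const: "prob_space N \<Longrightarrow> product_prob_space (\<lambda>_. N)"
  by (rule product_prob_spaceI)

text \<open>Marginalisation. It is applied to \<open>acc_error J \<sigma>\<close>, which reads only
  the coordinates in \<open>J\<close>, so that its mean under the full target is a mean over
  \<open>J\<close>.\<close>

lemma integral_PiM_restrict:
  fixes f :: "('i \<Rightarrow> 'a) \<Rightarrow> real"
  assumes "prob_space N" "J \<subseteq> I" "finite I" "f \<in> borel_measurable (PiM J (\<lambda>_. N))"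
  shows "(\<integral>x. f (restrict x J) \<partial>PiM I (\<lambda>_. N)) = (\<integral>x. f x \<partial>PiM J (\<lambda>_. N))"
proof -
  interpret product_prob_space "\<lambda>_. N" using product_prob_space_const[OF assms(1)] .
  show ?thesis
    using assms(4) measurable_restrict_subset[OF assms(2), of "\<lambda>_. N"]
    by (subst distr_restrict[OF assms(2,3)]) (rule integral_distr[symmetric])
qed

lemma integrable_PiM_restrict:
  fixes f :: "('i \<Rightarrow> 'a) \<Rightarrow> real"
  assumes "prob_space N" "J \<subseteq> I" "finite I" "integrable (PiM J (\<lambda>_. N)) f"
  shows "integrable (PiM I (\<lambda>_. N)) (\<lambda>x. f (restrict x J))"
proof -
  interpret product_prob_space "\<lambda>_. N" using product_prob_space_const[OF assms(1)] .
  have m: "(\<lambda>x. restrict x J) \<in> PiM I (\<lambda>_. N) \<rightarrow>\<^sub>M PiM J (\<lambda>_. N)"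
    by (rule measurable_restrict_subset) fact
  have "integrable (distr (PiM I (\<lambda>_. N)) (PiM J (\<lambda>_. N)) (\<lambda>x. restrict x J)) f"
    using assms(4) by (subst distr_restrict[OF assms(2,3), symmetric])
  then show ?thesis using m by (rule integrable_distr[rotated])
qed

lemma integral_PiM_product_mean_zero:
  fixes f :: "'a \<Rightarrow> real"
  assumes N: "prob_space N" and J: "finite J" and f: "integrable N f" and f2: "integrable N (\<lambda>x. (f x)\<^sup>2)"
    and mean: "(\<integral>x. f x \<partial>N) = 0" and jl: "j \<in> J" "l \<in> J"
  shows "integrable (PiM J (\<lambda>_. N)) (\<lambda>x. f (x j) * f (x l))"
    and "(\<integral>x. f (x j) * f (x l) \<partial>PiM J (\<lambda>_. N)) = (if j = l then \<integral>x. (f x)\<^sup>2 \<partial>N else 0)"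
proof -
  interpret N: prob_space N by fact
  interpret product_prob_space "\<lambda>_. N" using product_prob_space_const[OF N] .
  have fm[measurable]: "f \<in> borel_measurable N" using f by auto
  have "integrable (PiM J (\<lambda>_. N)) (\<lambda>x. f (x j) * f (x l)) \<and>
    (\<integral>x. f (x j) * f (x l) \<partial>PiM J (\<lambda>_. N)) = (if j = l then \<integral>x. (f x)\<^sup>2 \<partial>N else 0)"
  proof (cases "j = l")
    case True
    then show ?thesis
      using integral_PiM_component[of J "\<lambda>_. N" j "\<lambda>x. (f x)\<^sup>2"] N f2 jl by (simp add: power2_eq_square)
  next
    case False
    \<comment> \<open>Padding with the constant \<open>1\<close> makes the two factors a product
      over all of \<open>J\<close>, whose integral factorises; the factor at \<open>j\<close>
      integrates to \<open>0\<close>.\<close>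
    define g where "g = (\<lambda>i x. if i = j \<or> i = l then f x else 1)"
    have g: "integrable N (g i)" for i using f by (cases "i = j \<or> i = l") (auto simp: g_def)
    have prod: "(\<Prod>i\<in>J. g i (x i)) = f (x j) * f (x l)" for x
    proof -
      have "(\<Prod>i\<in>J. g i (x i)) = (\<Prod>i\<in>{j, l}. g i (x i))"
        using J jl by (intro prod.mono_neutral_right) (auto simp: g_def)
      then show ?thesis using False by (simp add: g_def)
    qed
    have "(\<Prod>i\<in>J. \<integral>x. g i x \<partial>N) = 0"
      using J jl mean by (intro prod_zero) (auto simp: g_def intro!: bexI[of _ j])
    then show ?thesis
      using product_integrable_prod[OF J, of g] product_integral_prod[OF J, of g] g False
      by (simp add: prod)
  qed
  then show "integrable (PiM J (\<lambda>_. N)) (\<lambda>x. f (x j) * f (x l))"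
    and "(\<integral>x. f (x j) * f (x l) \<partial>PiM J (\<lambda>_. N)) = (if j = l then \<integral>x. (f x)\<^sup>2 \<partial>N else 0)"
    by auto
qed

text \<open>A weak law of large numbers in L^1: the summands are orthogonal, so only the diagonal of
  the squared sum survives, and for bounded coefficients the norm grows like the square root of the
  number of terms.\<close>

lemma integral_abs_sum_iid_le:
  fixes f :: "'a \<Rightarrow> real" and c :: "'i \<Rightarrow> real"
  assumes N: "prob_space N" and J: "finite J" and [measurable]: "f \<in> borel_measurable N"
    and f2: "integrable N (\<lambda>x. (f x)\<^sup>2)" and mean: "(\<integral>x. f x \<partial>N) = 0"
  shows "integrable (PiM J (\<lambda>_. N)) (\<lambda>x. \<Sum>j\<in>J. c j * f (x j))"
    and "(\<integral>x. \<bar>\<Sum>j\<in>J. c j * f (x j)\<bar> \<partial>PiM J (\<lambda>_. N)) \<le> sqrt ((\<Sum>j\<in>J. (c j)\<^sup>2) * (\<integral>x. (f x)\<^sup>2 \<partial>N))"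
proof -
  interpret N: prob_space N by fact
  interpret product_prob_space "\<lambda>_. N" using product_prob_space_const[OF N] .
  interpret Q: prob_space "PiM J (\<lambda>_. N)" by (rule prob_space_PiM) (rule N)
  have f: "integrable N f" by (rule N.integral_abs_le_sqrt(1)) (use f2 in auto)
  note pair = integral_PiM_product_mean_zero[OF N J f f2 mean]
  have sq: "(\<Sum>j\<in>J. c j * f (x j))\<^sup>2 = (\<Sum>j\<in>J. \<Sum>l\<in>J. c j * c l * (f (x j) * f (x l)))" for x
    unfolding power2_eq_square sum_product by (intro sum.cong refl) (rule mult.assoc[THEN trans], simp)
  have int: "integrable (PiM J (\<lambda>_. N)) (\<lambda>x. (\<Sum>j\<in>J. c j * f (x j))\<^sup>2)"
    unfolding sq using pair(1) by (intro Bochner_Integration.integrable_sum integrable_mult_right) auto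
  have "(\<integral>x. (\<Sum>j\<in>J. c j * f (x j))\<^sup>2 \<partial>PiM J (\<lambda>_. N)) =
      (\<Sum>j\<in>J. \<Sum>l\<in>J. c j * c l * (if j = l then \<integral>x. (f x)\<^sup>2 \<partial>N else 0))"
    unfolding sq
    by (simp add: Bochner_Integration.integral_sum Bochner_Integration.integrable_sum pair)
  also have "\<dots> = (\<Sum>j\<in>J. (c j)\<^sup>2) * (\<integral>x. (f x)\<^sup>2 \<partial>N)"
    using J by (simp add: if_distrib sum.delta power2_eq_square sum_distrib_right cong: if_cong)
  finally have eq: "(\<integral>x. (\<Sum>j\<in>J. c j * f (x j))\<^sup>2 \<partial>PiM J (\<lambda>_. N)) = (\<Sum>j\<in>J. (c j)\<^sup>2) * (\<integral>x. (f x)\<^sup>2 \<partial>N)" .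
  show "integrable (PiM J (\<lambda>_. N)) (\<lambda>x. \<Sum>j\<in>J. c j * f (x j))"
    by (rule Q.integral_abs_le_sqrt(1)[OF _ int]) measurable
  show "(\<integral>x. \<bar>\<Sum>j\<in>J. c j * f (x j)\<bar> \<partial>PiM J (\<lambda>_. N)) \<le> sqrt ((\<Sum>j\<in>J. (c j)\<^sup>2) * (\<integral>x. (f x)\<^sup>2 \<partial>N))"
    unfolding eq[symmetric] by (rule Q.integral_abs_le_sqrt(2)[OF _ int]) measurable
qed

text \<open>Stability of the Gaussian law under linear combinations. Applied with the state frozen,
  it stands where a central limit theorem would be expected.\<close>

lemma integral_std_normal_linear_combination:
  fixes G :: "real \<Rightarrow> real" and a :: "'i \<Rightarrow> real"
  assumes J: "finite J" and G[measurable]: "G \<in> borel_measurable borel"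
  shows "(\<integral>x. G (\<Sum>j\<in>J. a j * x j) \<partial>PiM J (\<lambda>_. std_normal)) =
    (\<integral>y. G (sqrt (\<Sum>j\<in>J. (a j)\<^sup>2) * y) \<partial>std_normal)"
proof -
  \<comment> \<open>A zero coefficient gives a point mass, which has no density; such indices are
    dropped before normal densities are added up.\<close>
  define I where "I = {j\<in>J. a j \<noteq> 0}"
  define P where "P = PiM J (\<lambda>_. std_normal)"
  interpret N: prob_space std_normal by simp
  interpret product_prob_space "\<lambda>_. std_normal" using product_prob_space_const by blast
  interpret Q: prob_space P unfolding P_def by (rule prob_space_PiM) simp
  have I: "finite I" "I \<subseteq> J" using J by (auto simp: I_def)
  have sum_eq: "(\<Sum>j\<in>J. a j * x j) = (\<Sum>j\<in>I. a j * x j)" for x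
    using J by (intro sum.mono_neutral_right) (auto simp: I_def)
  have sum2_eq: "(\<Sum>j\<in>J. (a j)\<^sup>2) = (\<Sum>j\<in>I. (a j)\<^sup>2)"
    using J by (intro sum.mono_neutral_right) (auto simp: I_def)
  show ?thesis
  proof (cases "I = {}")
    case True
    then show ?thesis
      unfolding sum_eq sum2_eq P_def[symmetric] using Q.prob_space N.prob_space by simp
  next
    case False
    have rv: "(\<lambda>\<omega>. \<omega> j) \<in> P \<rightarrow>\<^sub>M borel" if "j \<in> J" for j
      unfolding P_def using that by (subst measurable_cong_sets[OF refl sets_std_normal[symmetric]]) simp
    have comp: "distr P borel (\<lambda>\<omega>. \<omega> j) = std_normal" if "j \<in> J" for j
    proof -
      have "distr P borel (\<lambda>\<omega>. \<omega> j) = distr P std_normal (\<lambda>\<omega>. \<omega> j)" by (rule distr_cong) auto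
      then show ?thesis unfolding P_def using distr_PiM_component[of J "\<lambda>_. std_normal" j] that by simp
    qed
    \<comment> \<open>Independence of the coordinates says that their joint law, the marginal of
      \<open>P\<close> on \<open>I\<close>, is the product of their laws.\<close>
    have "Q.indep_vars (\<lambda>_. borel) (\<lambda>j \<omega>. \<omega> j) I"
    proof (subst Q.indep_vars_iff_distr_eq_PiM'[OF False])
      show "Q.random_variable borel (\<lambda>\<omega>. \<omega> i)" if "i \<in> I" for i using rv that I by auto
      have "distr P (PiM I (\<lambda>_. borel)) (\<lambda>x. restrict x I) = distr P (PiM I (\<lambda>_. std_normal)) (\<lambda>x. restrict x I)"
        by (rule distr_cong) (auto simp: sets_PiM_cong[of I I "\<lambda>_. std_normal" "\<lambda>_. borel"])
      also have "\<dots> = PiM I (\<lambda>_. std_normal)"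
        unfolding P_def using distr_restrict[OF I(2) J] by simp
      also have "\<dots> = PiM I (\<lambda>i. distr P borel (\<lambda>\<omega>. \<omega> i))"
        using comp I by (intro PiM_cong) auto
      finally show "distr P (PiM I (\<lambda>_. borel)) (\<lambda>x. \<lambda>i\<in>I. x i) = PiM I (\<lambda>i. distr P borel (\<lambda>\<omega>. \<omega> i))"
        by (simp add: restrict_def)
    qed
    then have indep: "Q.indep_vars (\<lambda>_. borel) (\<lambda>j \<omega>. a j * \<omega> j) I"
      by (rule Q.indep_vars_compose2) auto
    have "distributed P lborel (\<lambda>\<omega>. a j * \<omega> j) (normal_density 0 \<bar>a j\<bar>)" if "j \<in> I" for j
    proof -
      have j: "j \<in> J" "a j \<noteq> 0" using that by (auto simp: I_def)
      have "distr P lborel (\<lambda>\<omega>. \<omega> j) = distr P borel (\<lambda>\<omega>. \<omega> j)" by (rule distr_cong) auto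
      then have "distributed P lborel (\<lambda>\<omega>. \<omega> j) std_normal_density"
        using comp[OF j(1)] rv[OF j(1)] by (simp add: distributed_def std_normal_def)
      from Q.normal_density_affine[OF this _ j(2), of 0] show ?thesis by simp
    qed
    then have S: "distributed P lborel (\<lambda>\<omega>. \<Sum>j\<in>I. a j * \<omega> j) (normal_density (\<Sum>j\<in>I. 0) (sqrt (\<Sum>j\<in>I. \<bar>a j\<bar>\<^sup>2)))"
      using I False by (intro Q.sum_indep_normal indep) (auto simp: I_def)
    define s where "s = sqrt (\<Sum>j\<in>J. (a j)\<^sup>2)"
    have "(\<Sum>j\<in>I. (a j)\<^sup>2) > 0" using I False by (intro sum_pos) (auto simp: I_def)
    then have s: "s > 0" by (simp add: s_def sum2_eq)
    from S have S: "distributed P lborel (\<lambda>\<omega>. \<Sum>j\<in>I. a j * \<omega> j) (normal_density 0 s)"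
      by (simp add: s_def sum2_eq)
    have "distributed std_normal lborel (\<lambda>y. y) std_normal_density"
      by (auto simp: distributed_def std_normal_def distr_id2)
    from N.normal_density_affine[OF this, of s 0] s
    have T: "distributed std_normal lborel (\<lambda>y. s * y) (normal_density 0 s)" by simp
    show ?thesis
      unfolding sum_eq P_def[symmetric] s_def[symmetric]
      using distributed_integral[OF S, of G] distributed_integral[OF T, of G] by simp
  qed
qed

lemma PiM_density:
  fixes f :: "'i \<Rightarrow> 'a \<Rightarrow> real"
  assumes I: "finite I" and M: "\<And>i. sigma_finite_measure (M i)"
    and f[measurable]: "\<And>i. i \<in> I \<Longrightarrow> f i \<in> borel_measurable (M i)" and nonneg: "\<And>i x. i \<in> I \<Longrightarrow> 0 \<le> f i x"
    and sf: "\<And>i. i \<in> I \<Longrightarrow> sigma_finite_measure (density (M i) (f i))"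
  shows "PiM I (\<lambda>i. density (M i) (f i)) = density (PiM I M) (\<lambda>x. \<Prod>i\<in>I. f i (x i))"
proof -
  interpret M: product_sigma_finite M by (rule product_sigma_finite.intro) (rule M)
  \<comment> \<open>The locale \<open>product_sigma_finite\<close> wants sigma-finiteness at every
    index, also outside \<open>I\<close>; \<open>M i\<close> is the filler there.\<close>
  define D where "D = (\<lambda>i. if i \<in> I then density (M i) (f i) else M i)"
  have D: "sigma_finite_measure (D i)" for i using M sf by (auto simp: D_def)
  interpret D: product_sigma_finite D by (rule product_sigma_finite.intro) (rule D)
  have DI: "PiM I (\<lambda>i. density (M i) (f i)) = PiM I D" by (intro PiM_cong) (auto simp: D_def)
  have meas: "(\<lambda>x. ennreal (\<Prod>i\<in>I. f i (x i))) \<in> borel_measurable (PiM I M)"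
    using I by measurable
  show ?thesis unfolding DI
  proof (rule D.PiM_eqI[OF I, symmetric])
    show "sets (density (PiM I M) (\<lambda>x. ennreal (\<Prod>i\<in>I. f i (x i)))) = sets (PiM I D)"
      by (simp, intro sets_PiM_cong) (auto simp: D_def)
    fix A assume "\<And>i. i \<in> I \<Longrightarrow> A i \<in> sets (D i)"
    then have A[measurable]: "\<And>i. i \<in> I \<Longrightarrow> A i \<in> sets (M i)" by (auto simp: D_def)
    have "Pi\<^sub>E I A \<in> sets (PiM I M)" using I A by (intro sets_PiM_I_finite) auto
    then have "emeasure (density (PiM I M) (\<lambda>x. ennreal (\<Prod>i\<in>I. f i (x i)))) (Pi\<^sub>E I A) =
      (\<integral>\<^sup>+x. ennreal (\<Prod>i\<in>I. f i (x i)) * indicator (Pi\<^sub>E I A) x \<partial>PiM I M)"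
      using meas by (rule emeasure_density[rotated])
    also have "\<dots> = (\<integral>\<^sup>+x. (\<Prod>i\<in>I. ennreal (f i (x i)) * indicator (A i) (x i)) \<partial>PiM I M)"
    proof (intro nn_integral_cong)
      fix x assume x: "x \<in> space (PiM I M)"
      have "ennreal (\<Prod>i\<in>I. f i (x i)) = (\<Prod>i\<in>I. ennreal (f i (x i)))"
        using nonneg by (intro prod_ennreal[symmetric]) auto
      moreover have "indicator (Pi\<^sub>E I A) x = (\<Prod>i\<in>I. indicator (A i) (x i) :: ennreal)"
      proof (cases "x \<in> Pi\<^sub>E I A")
        case True then show ?thesis by (auto simp: PiE_def Pi_def intro!: prod.neutral[symmetric])
      next
        case False
        then obtain i where "i \<in> I" "x i \<notin> A i" using x by (auto simp: space_PiM PiE_def Pi_def)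
        then show ?thesis using I False by (auto intro!: prod_zero[symmetric] bexI[of _ i])
      qed
      ultimately show "ennreal (\<Prod>i\<in>I. f i (x i)) * indicator (Pi\<^sub>E I A) x = (\<Prod>i\<in>I. ennreal (f i (x i)) * indicator (A i) (x i))"
        by (simp add: prod.distrib)
    qed
    also have "\<dots> = (\<Prod>i\<in>I. \<integral>\<^sup>+x. ennreal (f i x) * indicator (A i) x \<partial>M i)"
      using I by (intro M.product_nn_integral_prod) auto
    also have "\<dots> = (\<Prod>i\<in>I. emeasure (D i) (A i))"
      by (intro prod.cong refl) (auto simp: D_def emeasure_density)
    finally show "emeasure (density (PiM I M) (\<lambda>x. ennreal (\<Prod>i\<in>I. f i (x i)))) (Pi\<^sub>E I A) = (\<Prod>i\<in>I. emeasure (D i) (A i))" .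
  qed
qed

subsection \<open>The target density\<close>

lemma Taylor_second_order:
  fixes f f' f'' :: "real \<Rightarrow> real"
  assumes "\<And>x. (f has_real_derivative f' x) (at x)" "\<And>x. (f' has_real_derivative f'' x) (at x)"
  obtains y where "\<bar>y - x\<bar> \<le> \<bar>t\<bar>" "f (x + t) = f x + f' x * t + f'' y / 2 * t\<^sup>2"
proof (cases "t = 0")
  case True
  then show ?thesis using that[of x] by simp
next
  case False
  define D where "D = (\<lambda>n::nat. if n = 0 then f else if n = 1 then f' else f'')"
  have "\<forall>m s. m < 2 \<and> x - \<bar>t\<bar> \<le> s \<and> s \<le> x + \<bar>t\<bar> \<longrightarrow> DERIV (D m) s :> D (Suc m) s"
    using assms by (auto simp: D_def less_2_cases_iff)
  then have "\<exists>y. (if x + t < x then x + t < y \<and> y < x else x < y \<and> y < x + t) \<and>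
    f (x + t) = (\<Sum>m<2. (D m x / fact m) * (x + t - x) ^ m) + (D 2 y / fact 2) * (x + t - x) ^ 2"
    by (intro Taylor[where a="x - \<bar>t\<bar>" and b="x + \<bar>t\<bar>"]) (use False in \<open>auto simp: D_def\<close>)
  then obtain y where y: "if x + t < x then x + t < y \<and> y < x else x < y \<and> y < x + t"
    "f (x + t) = (\<Sum>m<2. (D m x / fact m) * (x + t - x) ^ m) + (D 2 y / fact 2) * (x + t - x) ^ 2"
    by blast
  show ?thesis
    by (rule that[of y]) (use y in \<open>auto simp: D_def numeral_2_eq_2 split: if_splits\<close>)
qed

lemma antiderivative_exists:
  fixes f :: "real \<Rightarrow> real"
  assumes "continuous_on UNIV f"
  obtains F where "\<And>x. (F has_real_derivative f x) (at x)"
proof -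
  have "\<exists>F. \<forall>x::real. -\<infinity> < ereal x \<longrightarrow> ereal x < \<infinity> \<longrightarrow> (F has_vector_derivative f x) (at x)"
    using assms by (intro einterval_antiderivative) (auto simp: continuous_on_eq_continuous_at)
  then show ?thesis using that by (auto simp: has_real_derivative_iff_has_vector_derivative)
qed

lemma integral_shift_lborel:
  fixes f :: "real \<Rightarrow> real"
  shows "(\<integral>x. f (x + c) \<partial>lborel) = (\<integral>x. f x \<partial>lborel)"
  using lborel_integral_real_affine[of 1 f c] by (simp add: add.commute)

lemma integrable_shift_lborel:
  fixes f :: "real \<Rightarrow> real"
  shows "integrable lborel f \<Longrightarrow> integrable lborel (\<lambda>x. f (x + c))"
  using lborel_integrable_real_affine[of f 1 c] by (simp add: add.commute)

text \<open>
  Averaging \<open>g (x + 1) - g x = \<integral>\<^sub>0\<^sup>1 g' (x + s) ds\<close> over \<open>x\<close> avoids discussing limits of \<open>g\<close> at infinity.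
\<close>

lemma integral_derivative_eq_zero:
  fixes g g' :: "real \<Rightarrow> real"
  assumes g: "integrable lborel g" and g': "integrable lborel g'"
    and deriv: "\<And>x. (g has_real_derivative g' x) (at x)" and cont: "continuous_on UNIV g'"
  shows "(\<integral>x. g' x \<partial>lborel) = 0"
proof -
  have [measurable]: "g' \<in> borel_measurable borel" using cont by (rule borel_measurable_continuous_onI)
  have pw: "(\<integral>s. indicator {0..1} s * g' (x + s) \<partial>lborel) = g (x + 1) - g x" for x
  proof -
    have "(\<integral>s. indicator {0..1} s *\<^sub>R g' (x + s) \<partial>lborel) = g (x + 1) - g (x + 0)"
    proof (rule integral_FTC_atLeastAtMost[where F="\<lambda>s. g (x + s)"])
      fix s :: real
      have "((\<lambda>s. g (x + s)) has_real_derivative g' (x + s) * 1) (at s within {0..1})"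
        by (rule DERIV_chain'[where f="\<lambda>s. x + s" and g=g, OF _ deriv[THEN has_field_derivative_at_within]]) (auto intro!: derivative_eq_intros)
      then show "((\<lambda>s. g (x + s)) has_vector_derivative g' (x + s)) (at s within {0..1})"
        by (simp add: has_real_derivative_iff_has_vector_derivative)
    qed (auto intro!: continuous_intros continuous_on_compose2[OF cont])
    then show ?thesis by simp
  qed
  have int: "integrable (lborel \<Otimes>\<^sub>M lborel) (\<lambda>(x, s). indicator {0..1} s * g' (x + s))"
  proof (rule integrableI_bounded)
    show "(\<lambda>(x, s). indicator {0..1} s * g' (x + s)) \<in> borel_measurable (lborel \<Otimes>\<^sub>M lborel)" by measurable
    have "(\<integral>\<^sup>+p. ennreal (norm (case p of (x, s) \<Rightarrow> indicator {0..1} s * g' (x + s))) \<partial>(lborel \<Otimes>\<^sub>M lborel)) =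
      (\<integral>\<^sup>+s. \<integral>\<^sup>+x. ennreal (norm (indicator {0..1} s * g' (x + s))) \<partial>lborel \<partial>lborel)"
      by (subst lborel_pair.nn_integral_snd[symmetric]) auto
    also have "\<dots> = (\<integral>\<^sup>+s. indicator {0..1::real} s * (\<integral>\<^sup>+x. ennreal (norm (g' x)) \<partial>lborel) \<partial>lborel)"
    proof (intro nn_integral_cong)
      fix s :: real
      have "(\<integral>\<^sup>+x. ennreal (norm (g' (x + s))) \<partial>lborel) = (\<integral>\<^sup>+x. ennreal (norm (g' x)) \<partial>lborel)"
        using nn_integral_real_affine[of "\<lambda>x. ennreal (norm (g' x))" 1 s] by (simp add: add.commute)
      then show "(\<integral>\<^sup>+x. ennreal (norm (indicator {0..1} s * g' (x + s))) \<partial>lborel) =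
          indicator {0..1} s * (\<integral>\<^sup>+x. ennreal (norm (g' x)) \<partial>lborel)"
        by (auto split: split_indicator)
    qed
    also have "\<dots> = (\<integral>\<^sup>+x. ennreal (norm (g' x)) \<partial>lborel)"
      by (subst nn_integral_multc) auto
    also have "\<dots> < \<infinity>" using g' by (auto simp: integrable_iff_bounded)
    finally show "(\<integral>\<^sup>+p. ennreal (norm (case p of (x, s) \<Rightarrow> indicator {0..1} s * g' (x + s))) \<partial>(lborel \<Otimes>\<^sub>M lborel)) < \<infinity>" .
  qed
  have "0 = (\<integral>x. g (x + 1) - g x \<partial>lborel)"
    using g integrable_shift_lborel[OF g, of 1] by (simp add: integral_shift_lborel)
  also have "\<dots> = (\<integral>x. (\<integral>s. indicator {0..1} s * g' (x + s) \<partial>lborel) \<partial>lborel)"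
    by (simp add: pw)
  also have "\<dots> = (\<integral>s. (\<integral>x. indicator {0..1} s * g' (x + s) \<partial>lborel) \<partial>lborel)"
    using lborel_pair.Fubini_integral[OF int] by simp
  also have "\<dots> = (\<integral>s. indicator {0..1::real} s *\<^sub>R (\<integral>x. g' x \<partial>lborel) \<partial>lborel)"
    by (simp add: integral_shift_lborel)
  also have "\<dots> = (\<integral>x. g' x \<partial>lborel)"
    by (subst integral_scaleR_left) (auto intro!: integrable_real_indicator simp: content_real)
  finally show ?thesis by simp
qed

section \<open>The score of the target and its Fisher information\<close>

locale target =
  fixes h h' h'' :: "real \<Rightarrow> real" and C :: real
  assumes h_pos: "\<And>x. h x > 0"
    and h_density: "prob_space (density lborel h)"
    and h_deriv: "\<And>x. (h has_real_derivative h' x) (at x)"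
    and h'_deriv: "\<And>x. (h' has_real_derivative h'' x) (at x)"
    and h''_cont: "continuous_on UNIV h''"
    and lipschitz: "C-lipschitz_on UNIV (\<lambda>x. h' x / h x)"
    and moment8: "integrable lborel (\<lambda>x. (h' x / h x) ^ 8 * h x)"
    and moment4: "integrable lborel (\<lambda>x. (h'' x / h x) ^ 4 * h x)"
begin

definition \<mu> :: "real measure" where "\<mu> = density lborel h"
text \<open>The density ratio of two states is the exponential of a sum of increments of
  \<open>u\<close>, so all expansions are made for \<open>u\<close>, whose derivative
  \<open>u'\<close> is the score.\<close>

definition u :: "real \<Rightarrow> real" where "u x = ln (h x)"
definition u' :: "real \<Rightarrow> real" where "u' x = h' x / h x"
definition u'' :: "real \<Rightarrow> real" where "u'' x = h'' x / h x - (u' x)\<^sup>2"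

lemma C_nonneg: "0 \<le> C" using lipschitz by (rule lipschitz_on_nonneg)

lemma cont_h: "continuous_on S h" and cont_h': "continuous_on S h'" and cont_h'': "continuous_on S h''"
  using h_deriv h'_deriv continuous_on_subset[OF h''_cont]
  by (auto intro!: DERIV_continuous_on[of S h h'] DERIV_continuous_on[of S h' h''] intro: has_field_derivative_at_within)

lemma h_neq_0: "h x \<noteq> 0"
  using h_pos[of x] by simp

lemma cont_u': "continuous_on S u'"
  unfolding u'_def[abs_def] by (intro continuous_on_divide cont_h cont_h') (simp add: h_neq_0)

lemma cont_u'': "continuous_on S u''"
  unfolding u''_def[abs_def]
  by (intro continuous_on_diff continuous_on_divide continuous_on_power cont_h cont_h'' cont_u') (simp add: h_neq_0)

lemma cont_u: "continuous_on S u"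
  unfolding u_def[abs_def] by (intro continuous_on_ln cont_h) (simp add: h_neq_0)

lemma measurable_target[measurable]:
  "h \<in> borel_measurable borel" "h' \<in> borel_measurable borel" "h'' \<in> borel_measurable borel"
  "u \<in> borel_measurable borel" "u' \<in> borel_measurable borel" "u'' \<in> borel_measurable borel"
  using cont_h cont_h' cont_h'' cont_u cont_u' cont_u'' by (auto intro: borel_measurable_continuous_onI)

lemma u_deriv: "(u has_real_derivative u' x) (at x)"
  unfolding u_def[abs_def] u'_def using h_pos[of x] h_deriv[of x]
  by (auto intro!: derivative_eq_intros simp: divide_inverse)

lemma u'_deriv: "(u' has_real_derivative u'' x) (at x)"
  unfolding u'_def[abs_def] u''_def using h_pos[of x]
  by (auto intro!: derivative_eq_intros h_deriv h'_deriv simp: u'_def field_simps power2_eq_square)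

lemma u'_lipschitz: "\<bar>u' x - u' y\<bar> \<le> C * \<bar>x - y\<bar>"
  using lipschitz_onD[OF lipschitz, of x y] by (simp add: u'_def dist_real_def)

text \<open>The Lipschitz bound on the score passes to its difference quotients and to their limit.
  Hence the quadratic Taylor error of \<open>u\<close> is uniform in \<open>x\<close>, even where
  the score is large.\<close>

lemma u''_bounded: "\<bar>u'' x\<bar> \<le> C"
proof -
  have "((\<lambda>y. \<bar>(u' y - u' x) / (y - x)\<bar>) \<longlongrightarrow> \<bar>u'' x\<bar>) (at x)"
    using u'_deriv[of x] by (intro tendsto_rabs) (simp add: has_field_derivative_iff)
  moreover have "\<forall>\<^sub>F y in at x. \<bar>(u' y - u' x) / (y - x)\<bar> \<le> C"
    using u'_lipschitz by (auto simp: eventually_at_filter abs_divide divide_le_eq)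
  ultimately show ?thesis by (rule tendsto_upperbound) simp
qed

lemma u_increment: "\<bar>u (x + t) - u x - u' x * t\<bar> \<le> C / 2 * t\<^sup>2"
proof -
  obtain y where "u (x + t) = u x + u' x * t + u'' y / 2 * t\<^sup>2"
    using Taylor_second_order[OF u_deriv u'_deriv] by metis
  then have "\<bar>u (x + t) - u x - u' x * t\<bar> = \<bar>u'' y\<bar> / 2 * t\<^sup>2" by (simp add: abs_mult)
  also have "\<dots> \<le> C / 2 * t\<^sup>2" using u''_bounded[of y] by (intro mult_right_mono) auto
  finally show ?thesis .
qed

lemma h_eq_exp: "h x = exp (u x)" using h_pos by (simp add: u_def)

lemma sets_\<mu>[simp, measurable_cong]: "sets \<mu> = sets borel" and space_\<mu>[simp]: "space \<mu> = UNIV"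
  by (simp_all add: \<mu>_def)

lemma prob_\<mu>: "prob_space \<mu>" unfolding \<mu>_def by (rule h_density)

lemma integrable_\<mu>_iff: "f \<in> borel_measurable borel \<Longrightarrow> integrable \<mu> f \<longleftrightarrow> integrable lborel (\<lambda>x. h x * f x)"
  for f :: "real \<Rightarrow> real"
  unfolding \<mu>_def using h_pos by (subst integrable_density) (auto simp: less_imp_le)

lemma integral_\<mu>: "f \<in> borel_measurable borel \<Longrightarrow> (\<integral>x. f x \<partial>\<mu>) = (\<integral>x. h x * f x \<partial>lborel)"
  for f :: "real \<Rightarrow> real"
  unfolding \<mu>_def using h_pos by (subst integral_density) (auto simp: less_imp_le)

text \<open>All lower powers are dominated by \<open>1\<close> plus the eighth power, on splitting
  at absolute value \<open>1\<close>.\<close>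

lemma integrable_u'_power: assumes "k \<le> 8" shows "integrable \<mu> (\<lambda>x. \<bar>u' x\<bar> ^ k)"
proof -
  interpret prob_space \<mu> by (rule prob_\<mu>)
  have "integrable \<mu> (\<lambda>x. (u' x) ^ 8)"
    using moment8 by (subst integrable_\<mu>_iff) (auto simp: u'_def mult.commute)
  then have i: "integrable \<mu> (\<lambda>x. 1 + (u' x) ^ 8)" by auto
  show ?thesis
  proof (rule Bochner_Integration.integrable_bound[OF i])
    show "AE x in \<mu>. norm (\<bar>u' x\<bar> ^ k) \<le> norm (1 + (u' x) ^ 8)"
    proof (rule AE_I2)
      fix x
      have e: "(u' x) ^ 8 = \<bar>u' x\<bar> ^ 8" by simp
      have "\<bar>u' x\<bar> ^ k \<le> 1 + \<bar>u' x\<bar> ^ 8"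
      proof (cases "\<bar>u' x\<bar> \<le> 1")
        case True then show ?thesis by (simp add: power_le_one add_increasing2)
      next
        case False then have "\<bar>u' x\<bar> ^ k \<le> \<bar>u' x\<bar> ^ 8" using assms by (intro power_increasing) auto
        then show ?thesis by simp
      qed
      then show "norm (\<bar>u' x\<bar> ^ k) \<le> norm (1 + (u' x) ^ 8)" unfolding e by simp
    qed
  qed measurable
qed

text \<open>Given the state, the linear part of the log density ratio has variance
  \<open>\<sigma>^2\<close> times a sum of \<open>(u')^2\<close>; this is the constant to which the
  average of that sum converges.\<close>

definition Fisher :: real where "Fisher = (\<integral>x. (u' x)\<^sup>2 \<partial>\<mu>)"

lemma integrable_u'_square: "integrable \<mu> (\<lambda>x. (u' x)\<^sup>2)" and integrable_u'_4: "integrable \<mu> (\<lambda>x. ((u' x)\<^sup>2)\<^sup>2)"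
  and integrable_u': "integrable \<mu> (\<lambda>x. \<bar>u' x\<bar>)"
  using integrable_u'_power[of 2] integrable_u'_power[of 4] integrable_u'_power[of 1]
  by (simp_all add: power_even_abs)

lemma integrable_u'': "integrable \<mu> u''"
proof -
  interpret prob_space \<mu> by (rule prob_\<mu>)
  show ?thesis by (rule integrable_const_bound[where B=C]) (auto simp: u''_bounded)
qed

text \<open>\<open>h * u'' = h'' - h * (u')^2\<close>, and the integral of \<open>h''\<close>
  vanishes. The identity ties the mean of the quadratic part of the log density ratio to the
  variance of its linear part, giving the pair \<open>- \<tau>^2 / 2\<close> and
  \<open>\<tau>^2\<close>.\<close>

lemma integral_u'': "(\<integral>x. u'' x \<partial>\<mu>) = - Fisher"
proof -
  interpret prob_space \<mu> by (rule prob_\<mu>)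
  have eq: "h x * u'' x = h'' x - h x * (u' x)\<^sup>2" for x
    using h_pos[of x] by (simp add: u''_def field_simps)
  have sq: "integrable lborel (\<lambda>x. h x * (u' x)\<^sup>2)"
    using integrable_u'_square by (subst (asm) integrable_\<mu>_iff) auto
  have "integrable lborel (\<lambda>x. h x * u'' x)"
    using integrable_u'' by (subst (asm) integrable_\<mu>_iff) auto
  from Bochner_Integration.integrable_add[OF this sq] have h'': "integrable lborel h''"
    by (simp add: eq)
  have "integrable \<mu> u'" using integrable_u' integrable_norm_iff[of u' \<mu>] by simp
  then have "integrable lborel (\<lambda>x. h x * u' x)" by (subst (asm) integrable_\<mu>_iff) auto
  then have h': "integrable lborel h'" using h_pos by (simp add: u'_def less_imp_neq[symmetric] less_imp_neq[THEN not_sym])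
  have "(\<integral>x. h'' x \<partial>lborel) = 0"
    by (rule integral_derivative_eq_zero[OF h' h'' h'_deriv h''_cont])
  then show ?thesis
    unfolding Fisher_def using h'' sq by (simp add: integral_\<mu> eq)
qed

lemma Fisher_nonneg: "0 \<le> Fisher" unfolding Fisher_def by (rule Bochner_Integration.integral_nonneg) simp

lemma Fisher_zero_imp: assumes "Fisher = 0" shows "u' x = 0"
proof -
  have "AE x in \<mu>. (u' x)\<^sup>2 = 0"
    using integral_nonneg_eq_0_iff_AE[OF integrable_u'_square] assms unfolding Fisher_def by simp
  then have "AE x in lborel. u' x = 0"
    unfolding \<mu>_def using h_pos by (subst (asm) AE_density) auto
  \<comment> \<open>The zero set of the continuous \<open>u'\<close> is closed, and a closed set of
    full Lebesgue measure is the whole line.\<close>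
  then have "AE x in lebesgue. u' x = 0" by (rule AE_completion)
  then have ae: "AE x in lebesgue. x \<in> {x. u' x = 0}" by simp
  have "closed {x. u' x = 0}" by (intro closed_Collect_eq cont_u' continuous_on_const)
  from mem_closed_if_AE_lebesgue[OF this ae] show ?thesis by simp
qed

text \<open>A vanishing score makes \<open>h\<close> constant, and no constant has integral
  \<open>1\<close> over the line. Positivity keeps \<open>\<tau>\<close> away from \<open>0\<close>,
  where \<open>gauss_acc \<tau> r\<close> would be \<open>min 1 r\<close>, with a kink at
  \<open>1\<close>.\<close>

lemma Fisher_pos: "Fisher > 0"
proof -
  interpret prob_space \<mu> by (rule prob_\<mu>)
  have "Fisher \<noteq> 0"
  proof
    assume "Fisher = 0"
    have "h' x = 0" for x using Fisher_zero_imp[OF \<open>Fisher = 0\<close>, of x] h_pos[of x] by (simp add: u'_def)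
    then have const: "h x = h 0" for x using h_deriv by (intro DERIV_isconst_all) auto
    then obtain c where c: "\<And>x. h x = c" by metis
    have "emeasure \<mu> (space \<mu>) = (\<integral>\<^sup>+x. ennreal c \<partial>lborel)"
      unfolding \<mu>_def by (subst emeasure_density) (auto simp: c)
    then show False using emeasure_space_1 h_pos[of 0] c by (simp add: ennreal_mult_top)
  qed
  with Fisher_nonneg show ?thesis by simp
qed
end

subsection \<open>The mean acceptance probability\<close>

lemma min_1_exp_lipschitz: "\<bar>min 1 (exp a) - min 1 (exp b)\<bar> \<le> \<bar>a - b\<bar>" for a b :: real
proof -
  have *: "\<bar>min 1 (exp a) - min 1 (exp b)\<bar> \<le> \<bar>a - b\<bar>" if "a \<le> b" for a b :: real
  proof -
    \<comment> \<open>\<open>min 1 (exp b) = exp (min 0 b)\<close>, and \<open>exp\<close> is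
      \<open>1\<close>-Lipschitz on the nonpositive half-line.\<close>
    define c where "c = min 0 b"
    define d where "d = min 0 a"
    have dc: "d \<le> c" "c - d \<le> b - a" "c \<le> 0" using that by (auto simp: c_def d_def)
    have "exp c - exp d = exp c * (1 - exp (d - c))" by (simp add: right_diff_distrib flip: exp_add)
    also have "\<dots> \<le> 1 * (c - d)"
    proof (rule mult_mono)
      show "1 - exp (d - c) \<le> c - d" using exp_ge_add_one_self[of "d - c"] by linarith
    qed (use dc in auto)
    finally have "exp c - exp d \<le> b - a" using dc by simp
    moreover have "min 1 (exp b) = exp c" "min 1 (exp a) = exp d"
      by (auto simp: c_def d_def min_def)
    ultimately show ?thesis using dc that by simp
  qed
  show ?thesis using *[of a b] *[of b a] by (cases "a \<le> b") auto
qed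

text \<open>The factor \<open>r\<close> is the shift \<open>ln r\<close> of the exponent, so the
  Lipschitz constant does not depend on it.\<close>

lemma min_1_mult_exp_lipschitz:
  fixes r a b :: real
  assumes "r > 0"
  shows "\<bar>min 1 (r * exp a) - min 1 (r * exp b)\<bar> \<le> \<bar>a - b\<bar>"
  using min_1_exp_lipschitz[of "ln r + a" "ln r + b"] assms by (simp add: exp_add)

lemma abs_ln_one_plus_le: "\<bar>ln (1 + x)\<bar> \<le> 2 * \<bar>x\<bar>" if "\<bar>x\<bar> \<le> 1/2" for x :: real
proof -
  have "\<bar>ln (1 + x) - x\<bar> \<le> 2 * x\<^sup>2" using that by (rule abs_ln_one_plus_x_minus_x_bound)
  moreover have "2 * x\<^sup>2 \<le> \<bar>x\<bar>"
    using that mult_mono[of "\<bar>x\<bar>" "1/2" "\<bar>x\<bar>" "\<bar>x\<bar>"] by (simp add: power2_eq_square flip: abs_mult)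
  ultimately show ?thesis by linarith
qed

lemma abs_sqrt_diff_le: "\<bar>sqrt a - sqrt b\<bar> \<le> sqrt \<bar>a - b\<bar>" if "0 \<le> a" "0 \<le> b"
proof -
  have *: "sqrt a \<le> sqrt b + sqrt (a - b)" if "0 \<le> b" "b \<le> a" for a b
    using sqrt_add_le_add_sqrt[of b "a - b"] that by simp
  show ?thesis
    using *[of a b] *[of b a] that by (cases "a \<le> b") (auto simp: abs_if)
qed

text \<open>The mean acceptance probability when the remaining coordinates contribute a log density
  ratio with law \<open>N(-\<tau>^2/2, \<tau>^2)\<close> and the moving coordinate the factor
  \<open>r\<close>.\<close>

definition gauss_acc :: "real \<Rightarrow> real \<Rightarrow> real" where
  "gauss_acc \<tau> r = (\<integral>y. min 1 (r * exp (\<tau> * y - \<tau>\<^sup>2 / 2)) \<partial>std_normal)"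

lemma integrable_min_exp: 
  assumes "prob_space M" and [measurable]: "W \<in> borel_measurable M" and "r > 0"
  shows "integrable M (\<lambda>x. min 1 (r * exp (W x :: real)))"
proof -
  interpret prob_space M by fact
  have "\<bar>min 1 (r * exp (W x))\<bar> \<le> 1" for x using mult_pos_pos[OF assms(3) exp_gt_zero, of "W x"] by (auto simp: min_def)
  then show ?thesis by (intro integrable_const_bound[where B=1] AE_I2) auto
qed

lemma integral_min_exp_bounds: 
  assumes "prob_space M" and [measurable]: "W \<in> borel_measurable M" and "r > 0"
  shows "0 \<le> (\<integral>x. min 1 (r * exp (W x :: real)) \<partial>M)" "(\<integral>x. min 1 (r * exp (W x)) \<partial>M) \<le> 1"
proof -
  interpret prob_space M by fact
  show "0 \<le> (\<integral>x. min 1 (r * exp (W x :: real)) \<partial>M)"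
    using assms(3) by (intro integral_nonneg_AE AE_I2) simp
  have "(\<integral>x. min 1 (r * exp (W x)) \<partial>M) \<le> (\<integral>x. 1 \<partial>M)"
    by (intro integral_mono integrable_min_exp assms) auto
  then show "(\<integral>x. min 1 (r * exp (W x)) \<partial>M) \<le> 1" by (simp add: prob_space)
qed

lemma AE_std_normal_neq: "AE y in std_normal. y \<noteq> c"
proof -
  have "AE y in lborel. 0 < ennreal (std_normal_density y) \<longrightarrow> y \<noteq> c"
    using AE_lborel_singleton[of c] by eventually_elim auto
  then show ?thesis unfolding std_normal_def by (subst AE_density) auto
qed

text \<open>
  The tilted law \<open>e\<^sup>W dN\<close> of \<open>W = \<tau> y - \<tau>\<^sup>2/2\<close> is the law of \<open>- W\<close>: the trace that reversibility
  leaves in the limit. It makes the derivative of \<open>gauss_acc \<tau>\<close> at \<open>1\<close> half of its value.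
\<close>

lemma gauss_acc_half:
  assumes \<tau>: "\<tau> > 0"
  shows "(\<integral>y. (if y < \<tau> / 2 then exp (\<tau> * y - \<tau>\<^sup>2 / 2) else 0) \<partial>std_normal) = gauss_acc \<tau> 1 / 2"
    and "gauss_acc \<tau> 1 > 0"
proof -
  interpret N: prob_space std_normal by simp
  define s where "s = (\<lambda>y. if y < \<tau> / 2 then exp (\<tau> * y - \<tau>\<^sup>2 / 2) else 0)"
  have W_neg: "\<tau> * y - \<tau>\<^sup>2 / 2 < 0 \<longleftrightarrow> y < \<tau> / 2" for y
  proof -
    have "\<tau> * y - \<tau>\<^sup>2 / 2 = \<tau> * (y - \<tau> / 2)" by (simp add: power2_eq_square algebra_simps)
    then show ?thesis using \<tau> by (simp add: mult_less_0_iff)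
  qed
  have [measurable]: "s \<in> borel_measurable borel" unfolding s_def by measurable
  have s01: "0 \<le> s y" "s y \<le> 1" for y using W_neg[of y] by (auto simp: s_def)
  have int_s: "integrable std_normal s"
    using s01 by (intro N.integrable_const_bound[where B=1] AE_I2) auto
  have int_i: "integrable std_normal (indicator {\<tau> / 2<..} :: real \<Rightarrow> real)"
    by (intro N.integrable_const_bound[where B=1] AE_I2) auto
  have "(\<integral>y. s y \<partial>std_normal) = (\<integral>y. std_normal_density y * s y \<partial>lborel)"
    by (rule integral_std_normal_eq) measurable
  \<comment> \<open>The reflection of \<open>y\<close> to \<open>\<tau> - y\<close> changes the sign
    of the exponent \<open>\<tau> * y - \<tau>^2 / 2\<close>, and the Gaussian density absorbs the
    exponential factor.\<close>
  also have "\<dots> = (\<integral>y. std_normal_density (\<tau> - y) * s (\<tau> - y) \<partial>lborel)"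
    using lborel_integral_real_affine[of "-1" "\<lambda>y. std_normal_density y * s y" \<tau>] by simp
  also have "\<dots> = (\<integral>y. std_normal_density y * indicator {\<tau> / 2<..} y \<partial>lborel)"
  proof (rule Bochner_Integration.integral_cong[OF refl])
    fix y
    have "std_normal_density (\<tau> - y) * exp (\<tau> * (\<tau> - y) - \<tau>\<^sup>2 / 2) = std_normal_density y"
    proof -
      have "exp (- (\<tau> - y)\<^sup>2 / 2) * exp (\<tau> * (\<tau> - y) - \<tau>\<^sup>2 / 2) = exp (- y\<^sup>2 / 2)"
        unfolding exp_add[symmetric] by (rule arg_cong[where f=exp]) (simp add: power2_eq_square field_simps)
      then show ?thesis by (simp add: std_normal_density_def)
    qed
    moreover have "\<tau> - y < \<tau> / 2 \<longleftrightarrow> \<tau> / 2 < y" by auto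
    ultimately show "std_normal_density (\<tau> - y) * s (\<tau> - y) = std_normal_density y * indicator {\<tau> / 2<..} y"
      by (auto simp: s_def split: split_indicator)
  qed
  also have "\<dots> = (\<integral>y. indicator {\<tau> / 2<..} y \<partial>std_normal)"
    by (rule integral_std_normal_eq[symmetric]) measurable
  finally have sym: "(\<integral>y. s y \<partial>std_normal) = (\<integral>y. indicator {\<tau> / 2<..} y \<partial>std_normal)" .
  \<comment> \<open>At \<open>y = \<tau> / 2\<close> the integrand is \<open>1\<close> while both
    pieces vanish, so the decomposition holds only almost everywhere.\<close>
  have ae: "AE y in std_normal. y \<noteq> \<tau> / 2" by (rule AE_std_normal_neq)
  have "gauss_acc \<tau> 1 = (\<integral>y. s y + indicator {\<tau> / 2<..} y \<partial>std_normal)"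
    unfolding gauss_acc_def
  proof (rule integral_cong_AE)
    show "AE y in std_normal. min 1 (1 * exp (\<tau> * y - \<tau>\<^sup>2 / 2)) = s y + indicator {\<tau> / 2<..} y"
      using ae
    proof eventually_elim
      case (elim y)
      show ?case using W_neg[of y] elim by (auto simp: s_def min_def split: split_indicator)
    qed
  qed measurable
  also have "\<dots> = 2 * (\<integral>y. s y \<partial>std_normal)"
    using int_s int_i by (simp add: sym)
  finally have eq: "gauss_acc \<tau> 1 = 2 * (\<integral>y. s y \<partial>std_normal)" .
  then show "(\<integral>y. (if y < \<tau> / 2 then exp (\<tau> * y - \<tau>\<^sup>2 / 2) else 0) \<partial>std_normal) = gauss_acc \<tau> 1 / 2"
    unfolding s_def by simp
  have "gauss_acc \<tau> 1 \<noteq> 0"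
  proof
    have int: "integrable std_normal (\<lambda>y. min 1 (1 * exp (\<tau> * y - \<tau>\<^sup>2 / 2)))"
      by (rule integrable_min_exp) auto
    assume "gauss_acc \<tau> 1 = 0"
    then have "AE y in std_normal. min 1 (1 * exp (\<tau> * y - \<tau>\<^sup>2 / 2)) = 0"
      unfolding gauss_acc_def using integral_nonneg_eq_0_iff_AE[OF int] by auto
    then have "AE y in std_normal. False" by eventually_elim (auto simp: min_def split: if_splits)
    then show False using N.AE_False by simp
  qed
  moreover have "gauss_acc \<tau> 1 \<ge> 0" unfolding gauss_acc_def by (rule integral_min_exp_bounds) auto
  ultimately show "gauss_acc \<tau> 1 > 0" by simp
qed

text \<open>Differentiation under the integral at \<open>r = 1\<close>: where the exponent is
  negative the integrand is linear in \<open>r\<close>, where it is positive the integrand is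
  locally constant, and the kink is a null set. The sequence may have either sign, so both one-sided
  slopes are covered.\<close>

lemma gauss_acc_slope:
  assumes \<tau>: "\<tau> > 0" and \<eta>: "\<eta> \<longlonglongrightarrow> 0" "\<And>n. \<eta> n \<noteq> 0" "\<And>n. \<bar>\<eta> n\<bar> \<le> 1/2"
  shows "(\<lambda>n. (gauss_acc \<tau> (1 + \<eta> n) - gauss_acc \<tau> 1) / \<eta> n) \<longlonglongrightarrow> gauss_acc \<tau> 1 / 2"
proof -
  interpret N: prob_space std_normal by simp
  define W where "W = (\<lambda>y. \<tau> * y - \<tau>\<^sup>2 / 2)"
  have [measurable]: "W \<in> borel_measurable borel" unfolding W_def by measurable
  have pos: "1 + \<eta> n > 0" for n using \<eta>(3)[of n] by (simp add: abs_le_iff)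
  define D where "D n y = (min 1 ((1 + \<eta> n) * exp (W y)) - min 1 (exp (W y))) / \<eta> n" for n y
  \<comment> \<open>The integrand is \<open>1\<close>-Lipschitz in \<open>ln r\<close>, and
    \<open>|ln (1 + x)| \<le> 2 |x|\<close> for \<open>|x| \<le> 1/2\<close>; this is the
    \<open>2\<close>.\<close>
  have D_le: "\<bar>D n y\<bar> \<le> 2" for n y
  proof -
    have "\<bar>min 1 ((1 + \<eta> n) * exp (W y)) - min 1 (exp (W y))\<bar> \<le> \<bar>ln (1 + \<eta> n)\<bar>"
      using min_1_exp_lipschitz[of "ln (1 + \<eta> n) + W y" "W y"] pos[of n] by (simp add: exp_add)
    also have "\<dots> \<le> 2 * \<bar>\<eta> n\<bar>" by (rule abs_ln_one_plus_le) (rule \<eta>)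
    finally show ?thesis using \<eta>(2)[of n] by (simp add: D_def divide_le_eq)
  qed
  have lim: "(\<lambda>n. D n y) \<longlonglongrightarrow> (if y < \<tau> / 2 then exp (W y) else 0)" if "y \<noteq> \<tau> / 2" for y
  proof -
    have W_eq: "W y = \<tau> * (y - \<tau> / 2)" by (simp add: W_def power2_eq_square algebra_simps)
    have r: "(\<lambda>n. (1 + \<eta> n) * exp (W y)) \<longlonglongrightarrow> (1 + 0) * exp (W y)" by (intro tendsto_intros \<eta>)
    show ?thesis
    proof (cases "y < \<tau> / 2")
      case True
      then have "W y < 0" using \<tau> by (simp add: W_eq mult_less_0_iff)
      then have "(1 + 0) * exp (W y) < 1" by simp
      from order_tendstoD(2)[OF r this] have "\<forall>\<^sub>F n in sequentially. D n y = exp (W y)"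
        by eventually_elim (use \<open>W y < 0\<close> \<eta>(2) in \<open>auto simp: D_def field_simps min_def\<close>)
      then show ?thesis using True by (auto intro: tendsto_eventually)
    next
      case False
      then have "W y > 0" using \<tau> that by (simp add: W_eq)
      then have "(1 + 0) * exp (W y) > 1" by simp
      from order_tendstoD(1)[OF r this] have "\<forall>\<^sub>F n in sequentially. D n y = 0"
        by eventually_elim (use \<open>W y > 0\<close> in \<open>auto simp: D_def min_def\<close>)
      then show ?thesis using False by (auto intro: tendsto_eventually)
    qed
  qed
  have ae: "AE y in std_normal. y \<noteq> \<tau> / 2" by (rule AE_std_normal_neq)
  have "(\<lambda>n. \<integral>y. D n y \<partial>std_normal) \<longlonglongrightarrow> (\<integral>y. (if y < \<tau> / 2 then exp (W y) else 0) \<partial>std_normal)"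
  proof (rule integral_dominated_convergence[where w="\<lambda>_. 2"])
    show "AE y in std_normal. (\<lambda>n. D n y) \<longlonglongrightarrow> (if y < \<tau> / 2 then exp (W y) else 0)"
      using ae by eventually_elim (rule lim)
    show "AE y in std_normal. norm (D n y) \<le> 2" for n using D_le by auto
  qed (auto simp: D_def)
  moreover have "(\<integral>y. D n y \<partial>std_normal) = (gauss_acc \<tau> (1 + \<eta> n) - gauss_acc \<tau> 1) / \<eta> n" for n
  proof -
    have g: "gauss_acc \<tau> r = (\<integral>y. min 1 (r * exp (W y)) \<partial>std_normal)" for r
      by (simp add: gauss_acc_def W_def)
    have i: "integrable std_normal (\<lambda>y. min 1 (r * exp (W y)))" if "r > 0" for r
      using that by (intro integrable_min_exp) auto
    show ?thesis unfolding D_def g using i[of "1 + \<eta> n"] i[of 1] pos[of n] by simp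
  qed
  moreover have "(\<integral>y. (if y < \<tau> / 2 then exp (W y) else 0) \<partial>std_normal) = gauss_acc \<tau> 1 / 2"
    unfolding W_def by (rule gauss_acc_half(1)[OF \<tau>])
  ultimately show ?thesis by (simp only:)
qed

text \<open>The exponent moves by \<open>(s - t) * y\<close>, and the mean of \<open>|y|\<close> is
  at most \<open>1\<close>. It serves to replace the state-dependent standard deviation of the
  linear part by \<open>\<tau>\<close>.\<close>

lemma gauss_acc_lipschitz_scale:
  assumes "r > 0"
  shows "\<bar>(\<integral>y. min 1 (r * exp (s * y - m)) \<partial>std_normal) - (\<integral>y. min 1 (r * exp (t * y - m)) \<partial>std_normal)\<bar> \<le> \<bar>s - t\<bar>"
proof -
  interpret N: prob_space std_normal by simp
  have int: "integrable std_normal (\<lambda>y. min 1 (r * exp (s * y - m)))" for s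
    using assms by (intro integrable_min_exp) auto
  have "\<bar>(\<integral>y. min 1 (r * exp (s * y - m)) \<partial>std_normal) - (\<integral>y. min 1 (r * exp (t * y - m)) \<partial>std_normal)\<bar> =
     \<bar>\<integral>y. min 1 (r * exp (s * y - m)) - min 1 (r * exp (t * y - m)) \<partial>std_normal\<bar>"
    using int by simp
  also have "\<dots> \<le> (\<integral>y. \<bar>min 1 (r * exp (s * y - m)) - min 1 (r * exp (t * y - m))\<bar> \<partial>std_normal)"
    by (rule integral_abs_bound)
  also have "\<dots> \<le> (\<integral>y. \<bar>s - t\<bar> * \<bar>y\<bar> \<partial>std_normal)"
  proof (rule integral_mono)
    show "integrable std_normal (\<lambda>y. \<bar>s - t\<bar> * \<bar>y\<bar>)" using integrable_std_normal_power(2)[of 1] by simp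
    show "\<bar>min 1 (r * exp (s * y - m)) - min 1 (r * exp (t * y - m))\<bar> \<le> \<bar>s - t\<bar> * \<bar>y\<bar>" for y
      using min_1_mult_exp_lipschitz[OF assms, of "s * y - m" "t * y - m"] by (simp add: left_diff_distrib flip: abs_mult)
  qed (use int in auto)
  also have "\<dots> = \<bar>s - t\<bar> * (\<integral>y. \<bar>y\<bar> \<partial>std_normal)" by simp
  also have "\<dots> \<le> \<bar>s - t\<bar> * sqrt (\<integral>y. y\<^sup>2 \<partial>std_normal)"
    by (intro mult_left_mono N.integral_abs_le_sqrt(2)) auto
  finally show ?thesis by (simp add: integral_std_normal_moments)
qed

section \<open>The acceptance probability in finite dimension and its law of large numbers\<close>

context target begin

definition remainder :: "real \<Rightarrow> real \<Rightarrow> real" where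
  "remainder x t = u (x + t) - u x - u' x * t - u'' x / 2 * t\<^sup>2"

lemma remainder_le: "\<bar>remainder x t\<bar> \<le> C * t\<^sup>2"
proof -
  have "\<bar>u'' x / 2 * t\<^sup>2\<bar> \<le> C / 2 * t\<^sup>2"
    using u''_bounded[of x] by (simp add: abs_mult mult_right_mono)
  then show ?thesis using u_increment[of x t] unfolding remainder_def by linarith
qed

lemma remainder_scaled_le: "\<bar>remainder x (\<sigma> * y)\<bar> \<le> C * \<sigma>\<^sup>2 * y\<^sup>2"
  using remainder_le[of x "\<sigma> * y"] by (simp add: power_mult_distrib mult.assoc)

lemma remainder_measurable[measurable]:
  assumes [measurable]: "f \<in> borel_measurable M" "g \<in> borel_measurable M"
  shows "(\<lambda>w. remainder (f w) (g w)) \<in> borel_measurable M"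
  unfolding remainder_def by measurable

text \<open>The remainder is of smaller order than \<open>\<sigma>^2\<close> by continuity of
  \<open>u''\<close> at the intermediate point of Taylor's formula. This is pointwise in
  \<open>x\<close>; domination later takes the place of uniformity.\<close>

lemma remainder_tendsto:
  assumes \<sigma>: "\<sigma> \<longlonglongrightarrow> 0" "\<And>n. 0 < \<sigma> n"
  shows "(\<lambda>n. remainder x (\<sigma> n * y) / (\<sigma> n)\<^sup>2) \<longlonglongrightarrow> 0"
proof -
  have "\<exists>v. \<bar>v - x\<bar> \<le> \<bar>\<sigma> n * y\<bar> \<and> remainder x (\<sigma> n * y) = (u'' v - u'' x) / 2 * (\<sigma> n * y)\<^sup>2" for n
  proof -
    obtain v where "\<bar>v - x\<bar> \<le> \<bar>\<sigma> n * y\<bar>" "u (x + \<sigma> n * y) = u x + u' x * (\<sigma> n * y) + u'' v / 2 * (\<sigma> n * y)\<^sup>2"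
      using Taylor_second_order[OF u_deriv u'_deriv] by metis
    then show ?thesis by (intro exI[of _ v]) (simp add: remainder_def algebra_simps diff_divide_distrib)
  qed
  then obtain v where v: "\<And>n. \<bar>v n - x\<bar> \<le> \<bar>\<sigma> n * y\<bar>"
    "\<And>n. remainder x (\<sigma> n * y) = (u'' (v n) - u'' x) / 2 * (\<sigma> n * y)\<^sup>2" by metis
  have lim0: "(\<lambda>n. \<bar>\<sigma> n * y\<bar>) \<longlonglongrightarrow> 0"
    by (rule tendsto_rabs_zero, rule tendsto_mult_left_zero, rule \<sigma>)
  have "(\<lambda>n. v n - x) \<longlonglongrightarrow> 0"
    by (rule Lim_null_comparison[OF _ lim0]) (simp add: v(1))
  then have "v \<longlonglongrightarrow> x" by (simp add: LIM_zero_iff)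
  moreover have "isCont u'' x"
    using cont_u''[of UNIV] by (simp add: continuous_on_eq_continuous_at)
  ultimately have "(\<lambda>n. u'' (v n)) \<longlonglongrightarrow> u'' x"
    by (rule isCont_tendsto_compose[rotated])
  then have "(\<lambda>n. (u'' (v n) - u'' x) / 2 * y\<^sup>2) \<longlonglongrightarrow> (u'' x - u'' x) / 2 * y\<^sup>2"
    by (intro tendsto_intros) auto
  moreover have "remainder x (\<sigma> n * y) / (\<sigma> n)\<^sup>2 = (u'' (v n) - u'' x) / 2 * y\<^sup>2" for n
    using \<sigma>(2)[of n] by (simp add: v power_mult_distrib)
  ultimately show ?thesis by (simp only: diff_self div_0 mult_zero_left)
qed

definition mean_remainder :: "real \<Rightarrow> real \<Rightarrow> real" where
  "mean_remainder \<sigma> x = (\<integral>y. \<bar>remainder x (\<sigma> * y)\<bar> \<partial>std_normal)"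

lemma integrable_remainder: "integrable std_normal (\<lambda>y. remainder x (\<sigma> * y))"
proof (rule Bochner_Integration.integrable_bound)
  show "integrable std_normal (\<lambda>y. C * \<sigma>\<^sup>2 * y\<^sup>2)" by simp
  show "AE y in std_normal. norm (remainder x (\<sigma> * y)) \<le> norm (C * \<sigma>\<^sup>2 * y\<^sup>2)"
    using remainder_scaled_le[of x] C_nonneg by (intro AE_I2) simp
qed measurable

lemma mean_remainder_measurable[measurable]: "mean_remainder \<sigma> \<in> borel_measurable borel"
proof -
  interpret N: prob_space std_normal by simp
  show ?thesis unfolding mean_remainder_def[abs_def] by measurable
qed

lemma mean_remainder_le: "mean_remainder \<sigma> x \<le> C * \<sigma>\<^sup>2" and mean_remainder_nonneg: "0 \<le> mean_remainder \<sigma> x"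
proof -
  have "mean_remainder \<sigma> x \<le> (\<integral>y. C * \<sigma>\<^sup>2 * y\<^sup>2 \<partial>std_normal)"
    unfolding mean_remainder_def using remainder_scaled_le[of x]
    by (intro integral_mono integrable_abs integrable_remainder) auto
  then show "mean_remainder \<sigma> x \<le> C * \<sigma>\<^sup>2" by (simp add: integral_std_normal_moments)
  show "0 \<le> mean_remainder \<sigma> x" unfolding mean_remainder_def by (intro integral_nonneg_AE AE_I2) simp
qed

text \<open>Dominated convergence twice: over the noise with majorant \<open>C * y^2\<close>, over
  the state with majorant \<open>C\<close>. As the number of coordinates times
  \<open>\<sigma>^2\<close> stays constant, the sum of all Taylor remainders becomes negligible in
  mean.\<close>

lemma mean_remainder_tendsto:
  assumes \<sigma>: "\<sigma> \<longlonglongrightarrow> 0" "\<And>n. 0 < \<sigma> n"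
  shows "(\<lambda>n. (\<integral>x. mean_remainder (\<sigma> n) x \<partial>\<mu>) / (\<sigma> n)\<^sup>2) \<longlonglongrightarrow> 0"
proof -
  interpret N: prob_space std_normal by simp
  interpret prob_space \<mu> by (rule prob_\<mu>)
  have inner: "(\<lambda>n. mean_remainder (\<sigma> n) x / (\<sigma> n)\<^sup>2) \<longlonglongrightarrow> 0" for x
  proof -
    have "(\<lambda>n. \<integral>y. \<bar>remainder x (\<sigma> n * y) / (\<sigma> n)\<^sup>2\<bar> \<partial>std_normal) \<longlonglongrightarrow> (\<integral>y. \<bar>0\<bar> \<partial>std_normal)"
    proof (rule integral_dominated_convergence[where w="\<lambda>y. C * y\<^sup>2"])
      show "AE y in std_normal. (\<lambda>n. \<bar>remainder x (\<sigma> n * y) / (\<sigma> n)\<^sup>2\<bar>) \<longlonglongrightarrow> \<bar>0\<bar>"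
        by (intro AE_I2 tendsto_rabs remainder_tendsto \<sigma>)
      show "AE y in std_normal. norm \<bar>remainder x (\<sigma> n * y) / (\<sigma> n)\<^sup>2\<bar> \<le> C * y\<^sup>2" for n
      proof (intro AE_I2)
        fix y show "norm \<bar>remainder x (\<sigma> n * y) / (\<sigma> n)\<^sup>2\<bar> \<le> C * y\<^sup>2"
          using remainder_scaled_le[of x "\<sigma> n" y] \<sigma>(2)[of n] by (simp add: divide_le_eq ac_simps)
      qed
    qed auto
    then show ?thesis by (simp add: mean_remainder_def abs_divide)
  qed
  have "(\<lambda>n. \<integral>x. mean_remainder (\<sigma> n) x / (\<sigma> n)\<^sup>2 \<partial>\<mu>) \<longlonglongrightarrow> (\<integral>x. 0 \<partial>\<mu>)"
  proof (rule integral_dominated_convergence[where w="\<lambda>_. C"])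
    show "AE x in \<mu>. norm (mean_remainder (\<sigma> n) x / (\<sigma> n)\<^sup>2) \<le> C" for n
      using mean_remainder_le mean_remainder_nonneg \<sigma>(2)[of n] by (intro AE_I2) (simp add: divide_le_eq)
  qed (auto intro: inner)
  then show ?thesis by simp
qed

text \<open>
  Here \<open>r\<close> stands for the density ratio contributed by the coordinate that \<open>J\<close> leaves out.
\<close>

definition acc :: "nat set \<Rightarrow> real \<Rightarrow> (nat \<Rightarrow> real) \<Rightarrow> real \<Rightarrow> real" where
  "acc J \<sigma> z r = (\<integral>\<xi>. min 1 (r * exp (\<Sum>j\<in>J. u (z j + \<sigma> * \<xi> j) - u (z j))) \<partial>PiM J (\<lambda>_. std_normal))"

lemma prob_PiM_std: "prob_space (PiM J (\<lambda>_. std_normal))" and prob_PiM_\<mu>: "prob_space (PiM J (\<lambda>_. \<mu>))"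
  using prob_\<mu> by (auto intro: prob_space_PiM)

lemma acc_measurable[measurable]: "(\<lambda>z. acc J \<sigma> z r) \<in> borel_measurable (PiM J (\<lambda>_. \<mu>))"
proof -
  interpret Q: prob_space "PiM J (\<lambda>_. std_normal)" by (rule prob_PiM_std)
  show ?thesis unfolding acc_def by measurable
qed

lemma acc_bounds: assumes "r > 0" shows "0 \<le> acc J \<sigma> z r" "acc J \<sigma> z r \<le> 1"
  unfolding acc_def by (rule integral_min_exp_bounds; (intro prob_PiM_std assms)?; measurable)+

text \<open>The four terms come from the Taylor remainders, the fluctuation of the squared noise
  about \<open>1\<close>, that of \<open>u''\<close> about \<open>- Fisher\<close>, and that of
  \<open>(u')^2\<close> about \<open>Fisher\<close>. None involves \<open>r\<close>, so one bound
  serves at several values of \<open>r\<close> at once.\<close>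

definition acc_error :: "nat set \<Rightarrow> real \<Rightarrow> (nat \<Rightarrow> real) \<Rightarrow> real" where
  "acc_error J \<sigma> z = (\<Sum>j\<in>J. mean_remainder \<sigma> (z j)) + \<sigma>\<^sup>2 / 2 * (C * sqrt (2 * real (card J)))
     + \<sigma>\<^sup>2 / 2 * \<bar>\<Sum>j\<in>J. u'' (z j) + Fisher\<bar> + sqrt (\<sigma>\<^sup>2 * \<bar>\<Sum>j\<in>J. (u' (z j))\<^sup>2 - Fisher\<bar>)"

text \<open>Given \<open>z\<close>, the linear part of the log density ratio is exactly Gaussian, so
  only its variance and the quadratic part have to be compared with the limit; both are sums to
  which a law of large numbers applies. The integrand is \<open>1\<close>-Lipschitz in the exponent
  for every \<open>r\<close>.\<close>

lemma acc_approx: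
  assumes J: "finite J" and r: "r > 0" and \<sigma>: "\<sigma> > 0" and \<tau>: "\<tau>\<^sup>2 = \<sigma>\<^sup>2 * real (card J) * Fisher" "\<tau> \<ge> 0"
  shows "\<bar>acc J \<sigma> z r - gauss_acc \<tau> r\<bar> \<le> acc_error J \<sigma> z"
proof -
  define P where "P = PiM J (\<lambda>_. std_normal)"
  interpret N: prob_space std_normal by simp
  interpret Q: prob_space P unfolding P_def by (rule prob_PiM_std)
  define D where "D \<xi> = (\<Sum>j\<in>J. u (z j + \<sigma> * \<xi> j) - u (z j))" for \<xi>
  define L where "L \<xi> = (\<Sum>j\<in>J. (\<sigma> * u' (z j)) * \<xi> j)" for \<xi> :: "nat \<Rightarrow> real"
  define q where "q = \<tau>\<^sup>2 / 2"
  define s where "s = sqrt (\<Sum>j\<in>J. (\<sigma> * u' (z j))\<^sup>2)"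
  have [measurable]: "D \<in> borel_measurable P" "L \<in> borel_measurable P"
    unfolding D_def[abs_def] L_def[abs_def] P_def by measurable
  have f_sq: "(\<integral>y. (y\<^sup>2 - 1)\<^sup>2 \<partial>std_normal) = 2" and f_int: "integrable std_normal (\<lambda>y. (y\<^sup>2 - 1)\<^sup>2)"
    and f_mean: "(\<integral>y. y\<^sup>2 - 1 \<partial>std_normal) = 0"
  proof -
    have eq: "(y\<^sup>2 - 1)\<^sup>2 = y ^ 4 - 2 * y\<^sup>2 + 1" for y :: real
      by (simp add: power2_eq_square numeral_eq_Suc algebra_simps)
    show "integrable std_normal (\<lambda>y. (y\<^sup>2 - 1)\<^sup>2)" unfolding eq by simp
    show "(\<integral>y. (y\<^sup>2 - 1)\<^sup>2 \<partial>std_normal) = 2"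
      unfolding eq using N.prob_space by (simp add: integral_std_normal_moments)
    show "(\<integral>y. y\<^sup>2 - 1 \<partial>std_normal) = 0"
      using N.prob_space by (simp add: integral_std_normal_moments)
  qed
  \<comment> \<open>The square of a standard normal has mean \<open>1\<close> and variance
    \<open>2\<close>; the latter is the \<open>2\<close> under the root in
    \<open>acc_error\<close>.\<close>
  define V where "V \<xi> = (\<Sum>j\<in>J. u'' (z j) * ((\<xi> j)\<^sup>2 - 1))" for \<xi> :: "nat \<Rightarrow> real"
  have V_int: "integrable P V"
    and V_le: "(\<integral>\<xi>. \<bar>V \<xi>\<bar> \<partial>P) \<le> sqrt ((\<Sum>j\<in>J. (u'' (z j))\<^sup>2) * 2)"
    using integral_abs_sum_iid_le[OF prob_space_std_normal J _ f_int f_mean, of "\<lambda>j. u'' (z j)"]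
    unfolding V_def[abs_def] P_def f_sq by auto
  have comp: "integrable P (\<lambda>\<xi>. \<bar>remainder (z j) (\<sigma> * \<xi> j)\<bar>)"
    "(\<integral>\<xi>. \<bar>remainder (z j) (\<sigma> * \<xi> j)\<bar> \<partial>P) = mean_remainder \<sigma> (z j)" if "j \<in> J" for j
    using integral_PiM_component[of J "\<lambda>_. std_normal" j "\<lambda>y. \<bar>remainder (z j) (\<sigma> * y)\<bar>"] that
      integrable_remainder[of "z j" \<sigma>] by (auto simp: P_def mean_remainder_def)
  define U where "U = \<sigma>\<^sup>2 / 2 * (\<Sum>j\<in>J. u'' (z j) + Fisher)"
  have decomp: "D \<xi> - (L \<xi> - q) = (\<Sum>j\<in>J. remainder (z j) (\<sigma> * \<xi> j)) + \<sigma>\<^sup>2 / 2 * V \<xi> + U" for \<xi>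
  proof -
    \<comment> \<open>Centring \<open>u''\<close> at \<open>- Fisher\<close> leaves a deterministic
      sum, which the choice of \<open>\<tau>\<close> makes equal to \<open>- q\<close>.\<close>
    have "D \<xi> - L \<xi> = (\<Sum>j\<in>J. remainder (z j) (\<sigma> * \<xi> j) + \<sigma>\<^sup>2 / 2 * (u'' (z j) * ((\<xi> j)\<^sup>2 - 1)) + \<sigma>\<^sup>2 / 2 * (u'' (z j) + Fisher) - \<sigma>\<^sup>2 / 2 * Fisher)"
      unfolding D_def L_def sum_subtractf[symmetric]
      by (intro sum.cong refl) (simp add: remainder_def power_mult_distrib field_simps)
    also have "\<dots> = (\<Sum>j\<in>J. remainder (z j) (\<sigma> * \<xi> j)) + \<sigma>\<^sup>2 / 2 * V \<xi> + U - real (card J) * (\<sigma>\<^sup>2 / 2 * Fisher)"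
      unfolding V_def U_def sum_distrib_left by (simp add: sum.distrib sum_subtractf)
    moreover have "q = real (card J) * (\<sigma>\<^sup>2 / 2 * Fisher)" by (simp add: q_def \<tau>)
    ultimately show ?thesis by linarith
  qed
  have G_int: "integrable P (\<lambda>\<xi>. min 1 (r * exp (D \<xi>)))" "integrable P (\<lambda>\<xi>. min 1 (r * exp (L \<xi> - q)))"
    using r by (auto intro!: integrable_min_exp Q.prob_space_axioms)
  have "\<bar>acc J \<sigma> z r - (\<integral>\<xi>. min 1 (r * exp (L \<xi> - q)) \<partial>P)\<bar> = \<bar>\<integral>\<xi>. min 1 (r * exp (D \<xi>)) - min 1 (r * exp (L \<xi> - q)) \<partial>P\<bar>"
    unfolding acc_def D_def[symmetric] P_def[symmetric] using G_int by simp
  also have "\<dots> \<le> (\<integral>\<xi>. \<bar>min 1 (r * exp (D \<xi>)) - min 1 (r * exp (L \<xi> - q))\<bar> \<partial>P)"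
    by (rule integral_abs_bound)
  also have "\<dots> \<le> (\<integral>\<xi>. (\<Sum>j\<in>J. \<bar>remainder (z j) (\<sigma> * \<xi> j)\<bar>) + \<sigma>\<^sup>2 / 2 * \<bar>V \<xi>\<bar> + \<bar>U\<bar> \<partial>P)"
  proof (rule integral_mono)
    fix \<xi>
    have "\<bar>D \<xi> - (L \<xi> - q)\<bar> \<le> \<bar>\<Sum>j\<in>J. remainder (z j) (\<sigma> * \<xi> j)\<bar> + \<sigma>\<^sup>2 / 2 * \<bar>V \<xi>\<bar> + \<bar>U\<bar>"
      unfolding decomp using \<sigma> by (intro order_trans[OF abs_triangle_ineq] add_mono) (auto simp: abs_mult)
    moreover have "\<bar>\<Sum>j\<in>J. remainder (z j) (\<sigma> * \<xi> j)\<bar> \<le> (\<Sum>j\<in>J. \<bar>remainder (z j) (\<sigma> * \<xi> j)\<bar>)"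
      by (rule sum_abs)
    ultimately show "\<bar>min 1 (r * exp (D \<xi>)) - min 1 (r * exp (L \<xi> - q))\<bar> \<le> (\<Sum>j\<in>J. \<bar>remainder (z j) (\<sigma> * \<xi> j)\<bar>) + \<sigma>\<^sup>2 / 2 * \<bar>V \<xi>\<bar> + \<bar>U\<bar>"
      using min_1_mult_exp_lipschitz[OF r, of "D \<xi>" "L \<xi> - q"] by linarith
  qed (use G_int V_int comp in \<open>auto intro!: Bochner_Integration.integrable_add Bochner_Integration.integrable_sum\<close>)
  also have "\<dots> = (\<Sum>j\<in>J. mean_remainder \<sigma> (z j)) + \<sigma>\<^sup>2 / 2 * (\<integral>\<xi>. \<bar>V \<xi>\<bar> \<partial>P) + \<bar>U\<bar>"
    using V_int comp Q.prob_space
    by (simp add: Bochner_Integration.integral_add Bochner_Integration.integral_sum Bochner_Integration.integrable_sum Bochner_Integration.integrable_add)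
  also have "\<dots> \<le> (\<Sum>j\<in>J. mean_remainder \<sigma> (z j)) + \<sigma>\<^sup>2 / 2 * (C * sqrt (2 * real (card J))) + \<bar>U\<bar>"
  proof -
    have "(\<Sum>j\<in>J. (u'' (z j))\<^sup>2) \<le> real (card J) * C\<^sup>2"
      using u''_bounded C_nonneg by (intro sum_bounded_above) (simp add: abs_le_square_iff[symmetric])
    then have "sqrt ((\<Sum>j\<in>J. (u'' (z j))\<^sup>2) * 2) \<le> sqrt (real (card J) * C\<^sup>2 * 2)" by simp
    also have "\<dots> = C * sqrt (2 * real (card J))" using C_nonneg by (simp add: real_sqrt_mult)
    finally have "\<sigma>\<^sup>2 / 2 * (\<integral>\<xi>. \<bar>V \<xi>\<bar> \<partial>P) \<le> \<sigma>\<^sup>2 / 2 * (C * sqrt (2 * real (card J)))"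
      using V_le by (intro mult_left_mono) auto
    then show ?thesis by simp
  qed
  also have "\<bar>U\<bar> = \<sigma>\<^sup>2 / 2 * \<bar>\<Sum>j\<in>J. u'' (z j) + Fisher\<bar>" by (simp add: U_def abs_mult)
  finally have 1: "\<bar>acc J \<sigma> z r - (\<integral>\<xi>. min 1 (r * exp (L \<xi> - q)) \<partial>P)\<bar> \<le>
    (\<Sum>j\<in>J. mean_remainder \<sigma> (z j)) + \<sigma>\<^sup>2 / 2 * (C * sqrt (2 * real (card J))) + \<sigma>\<^sup>2 / 2 * \<bar>\<Sum>j\<in>J. u'' (z j) + Fisher\<bar>" .
  have "(\<integral>\<xi>. min 1 (r * exp (L \<xi> - q)) \<partial>P) = (\<integral>y. min 1 (r * exp (s * y - q)) \<partial>std_normal)"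
    unfolding L_def P_def s_def
    by (rule integral_std_normal_linear_combination[OF J, where G="\<lambda>v. min 1 (r * exp (v - q))"]) measurable
  then have "\<bar>(\<integral>\<xi>. min 1 (r * exp (L \<xi> - q)) \<partial>P) - gauss_acc \<tau> r\<bar> \<le> \<bar>s - \<tau>\<bar>"
    using gauss_acc_lipschitz_scale[OF r, of s q \<tau>] by (simp only: gauss_acc_def q_def)
  \<comment> \<open>Only the squares of \<open>s\<close> and \<open>\<tau>\<close> are comparable;
    the loss is the square root in the last term of \<open>acc_error\<close>.\<close>
  also have "\<bar>s - \<tau>\<bar> = \<bar>sqrt (\<Sum>j\<in>J. (\<sigma> * u' (z j))\<^sup>2) - sqrt (\<tau>\<^sup>2)\<bar>" using \<tau>(2) by (simp add: s_def)
  also have "\<dots> \<le> sqrt \<bar>(\<Sum>j\<in>J. (\<sigma> * u' (z j))\<^sup>2) - \<tau>\<^sup>2\<bar>"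
    by (rule abs_sqrt_diff_le) (auto intro: sum_nonneg)
  also have "(\<Sum>j\<in>J. (\<sigma> * u' (z j))\<^sup>2) - \<tau>\<^sup>2 = \<sigma>\<^sup>2 * (\<Sum>j\<in>J. (u' (z j))\<^sup>2 - Fisher)"
    by (simp add: \<tau> power_mult_distrib sum_subtractf sum_distrib_left right_diff_distrib)
  also have "\<bar>\<dots>\<bar> = \<sigma>\<^sup>2 * \<bar>\<Sum>j\<in>J. (u' (z j))\<^sup>2 - Fisher\<bar>" by (simp add: abs_mult)
  finally show ?thesis using 1 unfolding acc_error_def by linarith
qed

text \<open>Under the product target the two centred sums are of the order of the square root of
  \<open>card J\<close>; in the last term, concavity of the square root moves the mean
  inside.\<close>

lemma integral_acc_error:
  assumes J: "finite J" and \<sigma>: "\<sigma> > 0"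
  shows "integrable (PiM J (\<lambda>_. \<mu>)) (acc_error J \<sigma>)"
    and "(\<integral>z. acc_error J \<sigma> z \<partial>PiM J (\<lambda>_. \<mu>)) \<le> real (card J) * (\<integral>x. mean_remainder \<sigma> x \<partial>\<mu>)
      + \<sigma>\<^sup>2 / 2 * (C * sqrt (2 * real (card J)))
      + \<sigma>\<^sup>2 / 2 * sqrt (real (card J) * (\<integral>x. (u'' x + Fisher)\<^sup>2 \<partial>\<mu>))
      + sqrt (\<sigma>\<^sup>2 * sqrt (real (card J) * (\<integral>x. ((u' x)\<^sup>2 - Fisher)\<^sup>2 \<partial>\<mu>)))"
proof -
  define P where "P = PiM J (\<lambda>_. \<mu>)"
  interpret prob_space \<mu> by (rule prob_\<mu>)
  interpret Q: prob_space P unfolding P_def by (rule prob_PiM_\<mu>)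
  have mr_int: "integrable \<mu> (mean_remainder \<sigma>)"
    using mean_remainder_le mean_remainder_nonneg
    by (intro integrable_const_bound[where B="C * \<sigma>\<^sup>2"] AE_I2) auto
  have mr: "integrable P (\<lambda>z. mean_remainder \<sigma> (z j))" "(\<integral>z. mean_remainder \<sigma> (z j) \<partial>P) = (\<integral>x. mean_remainder \<sigma> x \<partial>\<mu>)"
    if "j \<in> J" for j
    using integral_PiM_component[of J "\<lambda>_. \<mu>" j "mean_remainder \<sigma>"] that mr_int prob_\<mu> by (auto simp: P_def)
  have f1: "(\<integral>x. u'' x + Fisher \<partial>\<mu>) = 0" "integrable \<mu> (\<lambda>x. (u'' x + Fisher)\<^sup>2)"
  proof -
    show "(\<integral>x. u'' x + Fisher \<partial>\<mu>) = 0" using integrable_u'' integral_u'' prob_space by simp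
    have "\<bar>u'' x + Fisher\<bar> \<le> C + Fisher" for x using u''_bounded[of x] Fisher_pos by linarith
    then have "(u'' x + Fisher)\<^sup>2 \<le> (C + Fisher)\<^sup>2" for x by (metis abs_le_square_iff abs_of_nonneg abs_ge_zero order_trans)
    then show "integrable \<mu> (\<lambda>x. (u'' x + Fisher)\<^sup>2)"
      by (intro integrable_const_bound[where B="(C + Fisher)\<^sup>2"] AE_I2) auto
  qed
  \<comment> \<open>The variance of \<open>(u')^2\<close> is finite because the score has a fourth
    moment.\<close>
  have f2: "(\<integral>x. (u' x)\<^sup>2 - Fisher \<partial>\<mu>) = 0" "integrable \<mu> (\<lambda>x. ((u' x)\<^sup>2 - Fisher)\<^sup>2)"
    using integrable_u'_square integrable_u'_4 prob_space by (auto simp: Fisher_def[symmetric] power2_diff)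
  define U where "U z = (\<Sum>j\<in>J. u'' (z j) + Fisher)" for z :: "nat \<Rightarrow> real"
  define R where "R z = (\<Sum>j\<in>J. (u' (z j))\<^sup>2 - Fisher)" for z :: "nat \<Rightarrow> real"
  have U: "integrable P U" "(\<integral>z. \<bar>U z\<bar> \<partial>P) \<le> sqrt (real (card J) * (\<integral>x. (u'' x + Fisher)\<^sup>2 \<partial>\<mu>))"
    using integral_abs_sum_iid_le[OF prob_\<mu> J _ f1(2,1), of "\<lambda>_. 1"] unfolding U_def[abs_def] P_def by auto
  have R: "integrable P R" "(\<integral>z. \<bar>R z\<bar> \<partial>P) \<le> sqrt (real (card J) * (\<integral>x. ((u' x)\<^sup>2 - Fisher)\<^sup>2 \<partial>\<mu>))"
    using integral_abs_sum_iid_le[OF prob_\<mu> J _ f2(2,1), of "\<lambda>_. 1"] unfolding R_def[abs_def] P_def by auto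
  have [measurable]: "R \<in> borel_measurable P" using R by auto
  have sq: "(sqrt (\<sigma>\<^sup>2 * \<bar>R z\<bar>))\<^sup>2 = \<sigma>\<^sup>2 * \<bar>R z\<bar>" for z by simp
  have S_int: "integrable P (\<lambda>z. sqrt (\<sigma>\<^sup>2 * \<bar>R z\<bar>))"
    by (rule Q.integral_abs_le_sqrt(1)) (unfold sq, use R in auto)
  have "(\<integral>z. sqrt (\<sigma>\<^sup>2 * \<bar>R z\<bar>) \<partial>P) = (\<integral>z. \<bar>sqrt (\<sigma>\<^sup>2 * \<bar>R z\<bar>)\<bar> \<partial>P)" by simp
  also have "\<dots> \<le> sqrt (\<integral>z. (sqrt (\<sigma>\<^sup>2 * \<bar>R z\<bar>))\<^sup>2 \<partial>P)"
    by (rule Q.integral_abs_le_sqrt(2)) (unfold sq, use R in auto)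
  also have "\<dots> = sqrt (\<sigma>\<^sup>2 * (\<integral>z. \<bar>R z\<bar> \<partial>P))" unfolding sq by simp
  also have "\<dots> \<le> sqrt (\<sigma>\<^sup>2 * sqrt (real (card J) * (\<integral>x. ((u' x)\<^sup>2 - Fisher)\<^sup>2 \<partial>\<mu>)))"
    using R by (intro real_sqrt_le_mono mult_left_mono) auto
  finally have S: "(\<integral>z. sqrt (\<sigma>\<^sup>2 * \<bar>R z\<bar>) \<partial>P) \<le> sqrt (\<sigma>\<^sup>2 * sqrt (real (card J) * (\<integral>x. ((u' x)\<^sup>2 - Fisher)\<^sup>2 \<partial>\<mu>)))" .
  define c where "c = \<sigma>\<^sup>2 / 2 * (C * sqrt (2 * real (card J)))"
  have ae: "acc_error J \<sigma> = (\<lambda>z. (\<Sum>j\<in>J. mean_remainder \<sigma> (z j)) + c + \<sigma>\<^sup>2 / 2 * \<bar>U z\<bar> + sqrt (\<sigma>\<^sup>2 * \<bar>R z\<bar>))"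
    by (rule ext) (simp add: acc_error_def c_def U_def R_def)
  have sum_int: "integrable P (\<lambda>z. \<Sum>j\<in>J. mean_remainder \<sigma> (z j))"
    using mr by (intro Bochner_Integration.integrable_sum) auto
  show "integrable (PiM J (\<lambda>_. \<mu>)) (acc_error J \<sigma>)"
    unfolding ae P_def[symmetric] using sum_int U S_int by (intro Bochner_Integration.integrable_add integrable_mult_right integrable_abs) auto
  have "(\<integral>z. acc_error J \<sigma> z \<partial>P) = (\<integral>z. (\<Sum>j\<in>J. mean_remainder \<sigma> (z j)) \<partial>P) + c + \<sigma>\<^sup>2 / 2 * (\<integral>z. \<bar>U z\<bar> \<partial>P) + (\<integral>z. sqrt (\<sigma>\<^sup>2 * \<bar>R z\<bar>) \<partial>P)"
    unfolding ae using sum_int U S_int Q.prob_space by simp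
  moreover have "(\<integral>z. (\<Sum>j\<in>J. mean_remainder \<sigma> (z j)) \<partial>P) = real (card J) * (\<integral>x. mean_remainder \<sigma> x \<partial>\<mu>)"
    using mr by (subst Bochner_Integration.integral_sum) auto
  moreover have "\<sigma>\<^sup>2 / 2 * (\<integral>z. \<bar>U z\<bar> \<partial>P) \<le> \<sigma>\<^sup>2 / 2 * sqrt (real (card J) * (\<integral>x. (u'' x + Fisher)\<^sup>2 \<partial>\<mu>))"
    using U by (intro mult_left_mono) auto
  ultimately show "(\<integral>z. acc_error J \<sigma> z \<partial>PiM J (\<lambda>_. \<mu>)) \<le> real (card J) * (\<integral>x. mean_remainder \<sigma> x \<partial>\<mu>)
      + \<sigma>\<^sup>2 / 2 * (C * sqrt (2 * real (card J)))
      + \<sigma>\<^sup>2 / 2 * sqrt (real (card J) * (\<integral>x. (u'' x + Fisher)\<^sup>2 \<partial>\<mu>))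
      + sqrt (\<sigma>\<^sup>2 * sqrt (real (card J) * (\<integral>x. ((u' x)\<^sup>2 - Fisher)\<^sup>2 \<partial>\<mu>)))"
    using S unfolding P_def[symmetric] c_def by linarith
qed

text \<open>With \<open>\<sigma>^2 = l^2 / k\<close> for \<open>k = card J\<close>, the two
  quadratic fluctuations are \<open>O(k^(-1/2))\<close>, the last term is
  \<open>O(k^(-1/4))\<close>, and the Taylor term tends to \<open>0\<close> without a rate. The
  bound depends on \<open>J\<close> through its size only, which makes the convergence uniform in
  the omitted coordinate.\<close>

lemma acc_error_tendsto:
  assumes l: "l > 0"
  obtains e :: "nat \<Rightarrow> real" where "e \<longlonglongrightarrow> 0"
    "\<And>J. finite J \<Longrightarrow> J \<noteq> {} \<Longrightarrow> (\<integral>z. acc_error J (l / sqrt (real (card J))) z \<partial>PiM J (\<lambda>_. \<mu>)) \<le> e (card J)"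
proof -
  define A where "A = (\<integral>x. (u'' x + Fisher)\<^sup>2 \<partial>\<mu>)"
  define B where "B = (\<integral>x. ((u' x)\<^sup>2 - Fisher)\<^sup>2 \<partial>\<mu>)"
  define s where "s k = 1 / sqrt (real k)" for k :: nat
  define e where "e k = l\<^sup>2 * ((\<integral>x. mean_remainder (l * s k) x \<partial>\<mu>) / (l * s k)\<^sup>2) + l\<^sup>2 / 2 * (C * sqrt 2) * s k
      + l\<^sup>2 / 2 * sqrt A * s k + sqrt (l\<^sup>2 * sqrt B * s k)" for k
  have s: "s \<longlonglongrightarrow> 0" unfolding s_def
    by (intro tendsto_divide_0[OF tendsto_const] filterlim_at_top_imp_at_infinity
        filterlim_compose[OF sqrt_at_top] filterlim_real_sequentially)
  \<comment> \<open>\<open>s 0\<close> is \<open>0\<close> by the convention for division, while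
    \<open>mean_remainder_tendsto\<close> wants positive scales throughout; hence the index
    shift.\<close>
  then have s': "(\<lambda>k. s (Suc k)) \<longlonglongrightarrow> 0" by (rule LIMSEQ_Suc)
  have "(\<lambda>k. l * s (Suc k)) \<longlonglongrightarrow> 0" by (rule tendsto_mult_right_zero[OF s'])
  then have m: "(\<lambda>k. (\<integral>x. mean_remainder (l * s (Suc k)) x \<partial>\<mu>) / (l * s (Suc k))\<^sup>2) \<longlonglongrightarrow> 0"
    by (rule mean_remainder_tendsto) (use l in \<open>simp add: s_def\<close>)
  have "(\<lambda>k. e (Suc k)) \<longlonglongrightarrow> l\<^sup>2 * 0 + l\<^sup>2 / 2 * (C * sqrt 2) * 0 + l\<^sup>2 / 2 * sqrt A * 0 + sqrt (l\<^sup>2 * sqrt B * 0)"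
    unfolding e_def by (intro tendsto_intros m s')
  then have "(\<lambda>k. e (Suc k)) \<longlonglongrightarrow> 0" by simp
  then have e: "e \<longlonglongrightarrow> 0" by (rule LIMSEQ_imp_Suc)
  show ?thesis
  proof (rule that[OF e])
    fix J :: "nat set" assume J: "finite J" "J \<noteq> {}"
    define k where "k = card J"
    have k: "k > 0" using J by (simp add: k_def card_gt_0_iff)
    have ls: "l / sqrt (real k) = l * s k" by (simp add: s_def)
    have \<sigma>: "l * s k > 0" using l k by (simp add: s_def)
    have sq: "(l * s k)\<^sup>2 = l\<^sup>2 / real k" using k by (simp add: s_def power_mult_distrib power_divide)
    have ks: "sqrt (real k) / real k = s k" using k by (simp add: s_def sqrt_divide_self_eq inverse_eq_divide)
    have t1: "real k * X = l\<^sup>2 * (X / (l * s k)\<^sup>2)" for X using k l by (simp add: sq)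
    have t2: "(l * s k)\<^sup>2 / 2 * (C * sqrt (2 * real k)) = l\<^sup>2 / 2 * (C * sqrt 2) * s k"
      by (subst sq, subst ks[symmetric]) (simp add: real_sqrt_mult mult_ac)
    have t3: "(l * s k)\<^sup>2 / 2 * sqrt (real k * A) = l\<^sup>2 / 2 * sqrt A * s k"
      by (subst sq, subst ks[symmetric]) (simp add: real_sqrt_mult mult_ac)
    have t4: "(l * s k)\<^sup>2 * sqrt (real k * B) = l\<^sup>2 * sqrt B * s k"
      by (subst sq, subst ks[symmetric]) (simp add: real_sqrt_mult mult_ac)
    show "(\<integral>z. acc_error J (l / sqrt (real (card J))) z \<partial>PiM J (\<lambda>_. \<mu>)) \<le> e (card J)"
      using integral_acc_error(2)[OF J(1) \<sigma>]
      unfolding k_def[symmetric] ls A_def[symmetric] B_def[symmetric] t2 t3 t4 e_def t1[symmetric] .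
  qed
qed

end

subsection \<open>The Metropolis kernel\<close>

lemma PiM_distr_coordinatewise:
  fixes g :: "'i \<Rightarrow> 'a \<Rightarrow> 'b"
  assumes I: "finite I" and N: "\<And>i. i \<in> I \<Longrightarrow> prob_space (N i)"
    and g[measurable]: "\<And>i. i \<in> I \<Longrightarrow> g i \<in> N i \<rightarrow>\<^sub>M M i"
  shows "PiM I (\<lambda>i. distr (N i) (M i) (g i)) = distr (PiM I N) (PiM I M) (\<lambda>x. \<lambda>i\<in>I. g i (x i))"
proof -
  \<comment> \<open>Outside \<open>I\<close> a one-point space is the sigma-finite filler that the
    locale asks for.\<close>
  define D where "D = (\<lambda>i. if i \<in> I then distr (N i) (M i) (g i) else count_space {undefined})"
  have D: "sigma_finite_measure (D i)" for i
  proof (cases "i \<in> I")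
    case True
    then interpret prob_space "D i" unfolding D_def using N g by (auto intro: prob_space.prob_space_distr)
    show ?thesis by unfold_locales
  next
    case False
    then show ?thesis unfolding D_def by (auto intro: sigma_finite_measure_count_space_finite)
  qed
  interpret D: product_sigma_finite D by (rule product_sigma_finite.intro) (rule D)
  have DI: "PiM I (\<lambda>i. distr (N i) (M i) (g i)) = PiM I D" by (intro PiM_cong) (auto simp: D_def)
  have m: "(\<lambda>x. \<lambda>i\<in>I. g i (x i)) \<in> PiM I N \<rightarrow>\<^sub>M PiM I M" by measurable
  show ?thesis unfolding DI
  proof (rule D.PiM_eqI[OF I, symmetric])
    show "sets (distr (PiM I N) (PiM I M) (\<lambda>x. \<lambda>i\<in>I. g i (x i))) = sets (PiM I D)"
      by (simp, intro sets_PiM_cong) (auto simp: D_def)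
    fix A assume "\<And>i. i \<in> I \<Longrightarrow> A i \<in> sets (D i)"
    then have A[measurable]: "\<And>i. i \<in> I \<Longrightarrow> A i \<in> sets (M i)" by (auto simp: D_def)
    have "emeasure (distr (PiM I N) (PiM I M) (\<lambda>x. \<lambda>i\<in>I. g i (x i))) (Pi\<^sub>E I A) =
      emeasure (PiM I N) ((\<lambda>x. \<lambda>i\<in>I. g i (x i)) -` Pi\<^sub>E I A \<inter> space (PiM I N))"
      using m I A by (intro emeasure_distr sets_PiM_I_finite) auto
    also have "(\<lambda>x. \<lambda>i\<in>I. g i (x i)) -` Pi\<^sub>E I A \<inter> space (PiM I N) = Pi\<^sub>E I (\<lambda>i. g i -` A i \<inter> space (N i))"
      by (auto simp: space_PiM PiE_def Pi_def extensional_def)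
    also have "emeasure (PiM I N) \<dots> = (\<Prod>i\<in>I. emeasure (N i) (g i -` A i \<inter> space (N i)))"
    proof -
      have "emeasure (PiM I N) (prod_emb I N I (Pi\<^sub>E I (\<lambda>i. g i -` A i \<inter> space (N i)))) = (\<Prod>i\<in>I. emeasure (N i) (g i -` A i \<inter> space (N i)))"
        using I A N by (intro emeasure_PiM_emb) auto
      moreover have "prod_emb I N I (Pi\<^sub>E I (\<lambda>i. g i -` A i \<inter> space (N i))) = Pi\<^sub>E I (\<lambda>i. g i -` A i \<inter> space (N i))"
        by (rule prod_emb_PiE_same_index) auto
      ultimately show ?thesis by simp
    qed
    also have "\<dots> = (\<Prod>i\<in>I. emeasure (D i) (A i))"
      by (intro prod.cong refl) (auto simp: D_def emeasure_distr)
    finally show "emeasure (distr (PiM I N) (PiM I M) (\<lambda>x. \<lambda>i\<in>I. g i (x i))) (Pi\<^sub>E I A) = (\<Prod>i\<in>I. emeasure (D i) (A i))" .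
  qed
qed

lemma sets_euclid[measurable_cong]: "sets (euclid d) = sets (PiM {1..d} (\<lambda>_. borel))"
  by (simp add: euclid_def)

text \<open>Two forms of the proposal are kept: the image of a fixed Gaussian vector serves
  measurability in \<open>z\<close> and the expansion in \<open>\<sigma>\<close>, the density form
  serves detailed balance.\<close>

lemma normal_proposal_eq_distr:
  assumes "\<sigma> > 0"
  shows "normal_proposal d (\<sigma>\<^sup>2) z = distr (PiM {1..d} (\<lambda>_. std_normal)) (euclid d) (\<lambda>\<xi>. \<lambda>i\<in>{1..d}. z i + \<sigma> * \<xi> i)"
proof -
  have "normal_proposal d (\<sigma>\<^sup>2) z = PiM {1..d} (\<lambda>i. distr std_normal borel (\<lambda>y. z i + \<sigma> * y))"
    using assms by (simp add: normal_proposal_def normal_eq_distr_std_normal)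
  also have "\<dots> = distr (PiM {1..d} (\<lambda>_. std_normal)) (PiM {1..d} (\<lambda>_. borel)) (\<lambda>\<xi>. \<lambda>i\<in>{1..d}. z i + \<sigma> * \<xi> i)"
    by (rule PiM_distr_coordinatewise) auto
  finally show ?thesis by (simp add: euclid_def)
qed

section \<open>One Metropolis step and detailed balance\<close>

abbreviation lborel_PiM :: "nat \<Rightarrow> (nat \<Rightarrow> real) measure" where
  "lborel_PiM d \<equiv> (\<Pi>\<^sub>M i\<in>{1..d}. lborel)"

definition proposal_density :: "nat \<Rightarrow> real \<Rightarrow> (nat \<Rightarrow> real) \<Rightarrow> (nat \<Rightarrow> real) \<Rightarrow> real" where
  "proposal_density d \<sigma> z y = (\<Prod>i\<in>{1..d}. normal_density (z i) \<sigma> (y i))"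

lemma proposal_density_nonneg: "0 \<le> proposal_density d \<sigma> z y"
  unfolding proposal_density_def by (intro prod_nonneg) auto

lemma proposal_density_sym: "proposal_density d \<sigma> z y = proposal_density d \<sigma> y z"
  unfolding proposal_density_def normal_density_def by (intro prod.cong refl) (simp add: power2_commute)

lemma proposal_density_measurable[measurable]:
  "(\<lambda>w. proposal_density d \<sigma> (fst w) (snd w)) \<in> borel_measurable (lborel_PiM d \<Otimes>\<^sub>M lborel_PiM d)"
  unfolding proposal_density_def normal_density_def by measurable

lemma normal_proposal_eq_density:
  assumes "\<sigma> > 0"
  shows "normal_proposal d (\<sigma>\<^sup>2) z = density (lborel_PiM d) (proposal_density d \<sigma> z)"
proof -
  have "sigma_finite_measure (density lborel (normal_density (z i) \<sigma>))" for i
  proof -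
    interpret prob_space "density lborel (normal_density (z i) \<sigma>)" using assms by (rule prob_space_normal_density)
    show ?thesis by unfold_locales
  qed
  then show ?thesis
    using assms unfolding normal_proposal_def proposal_density_def real_sqrt_abs abs_of_pos[OF assms]
    by (intro PiM_density) (auto intro: lborel.sigma_finite_measure_axioms)
qed

lemma prob_space_normal_proposal: "\<sigma> > 0 \<Longrightarrow> prob_space (normal_proposal d (\<sigma>\<^sup>2) z)"
  unfolding normal_proposal_def by (intro prob_space_PiM prob_space_normal_density) auto

lemma sets_normal_proposal: "sets (normal_proposal d v z) = sets (euclid d)"
  unfolding normal_proposal_def euclid_def by (intro sets_PiM_cong) auto

lemma normal_proposal_measurable:
  assumes "\<sigma> > 0"
  shows "normal_proposal d (\<sigma>\<^sup>2) \<in> euclid d \<rightarrow>\<^sub>M subprob_algebra (euclid d)"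
proof (rule measurable_cong[THEN iffD1])
  show "distr (PiM {1..d} (\<lambda>_. std_normal)) (euclid d) (\<lambda>\<xi>. \<lambda>i\<in>{1..d}. z i + \<sigma> * \<xi> i) = normal_proposal d (\<sigma>\<^sup>2) z" for z
    using normal_proposal_eq_distr[OF assms] by simp
  interpret Q: prob_space "PiM {1..d} (\<lambda>_. std_normal)" by (intro prob_space_PiM) simp
  show "(\<lambda>z. distr (PiM {1..d} (\<lambda>_. std_normal)) (euclid d) (\<lambda>\<xi>. \<lambda>i\<in>{1..d}. z i + \<sigma> * \<xi> i)) \<in> euclid d \<rightarrow>\<^sub>M subprob_algebra (euclid d)"
  proof (rule measurable_distr2[where M="PiM {1..d} (\<lambda>_. std_normal)"])
    show "(\<lambda>(z, \<xi>). \<lambda>i\<in>{1..d}. z i + \<sigma> * \<xi> i) \<in> euclid d \<Otimes>\<^sub>M PiM {1..d} (\<lambda>_. std_normal) \<rightarrow>\<^sub>M euclid d"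
      unfolding euclid_def by measurable
  qed (rule measurable_const[OF Q.M_in_subprob])
qed

definition accept_step :: "nat \<Rightarrow> ((nat \<Rightarrow> real) \<Rightarrow> real) \<Rightarrow> (nat \<Rightarrow> real) \<Rightarrow> (nat \<Rightarrow> real) \<Rightarrow> (nat \<Rightarrow> real) measure" where
  "accept_step d p z y = measure_pmf (bernoulli_pmf (min 1 (p y / p z))) \<bind>
     (\<lambda>accept. return (euclid d) (if accept then y else z))"

lemma rwm_kernel_eq: "rwm_kernel d p v z = normal_proposal d v z \<bind> accept_step d p z"
  by (simp add: rwm_kernel_def accept_step_def[abs_def])

lemma return_measurable_pmf:
  assumes "z \<in> space E" "y \<in> space E"
  shows "(\<lambda>b. return E (if b then y else z)) \<in> measure_pmf q \<rightarrow>\<^sub>M subprob_algebra E"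
  using assms by (auto simp: measurable_def space_subprob_algebra intro!: prob_space_imp_subprob_space prob_space_return)

lemma
  assumes z: "z \<in> space (euclid d)" and y: "y \<in> space (euclid d)" and pos: "p z > 0" "p y > 0"
  shows prob_space_accept_step: "prob_space (accept_step d p z y)"
    and sets_accept_step: "sets (accept_step d p z y) = sets (euclid d)"
    and nn_integral_accept_step: "f \<in> borel_measurable (euclid d) \<Longrightarrow>
      (\<integral>\<^sup>+x. f x \<partial>accept_step d p z y) = ennreal (min 1 (p y / p z)) * f y + ennreal (1 - min 1 (p y / p z)) * f z"
proof -
  let ?q = "bernoulli_pmf (min 1 (p y / p z))"
  have m: "(\<lambda>b. return (euclid d) (if b then y else z)) \<in> measure_pmf ?q \<rightarrow>\<^sub>M subprob_algebra (euclid d)"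
    using z y by (rule return_measurable_pmf)
  show "prob_space (accept_step d p z y)"
    unfolding accept_step_def using z y m
    by (intro prob_space.prob_space_bind[where S="euclid d"] prob_space_measure_pmf AE_I2) (auto intro: prob_space_return)
  show "sets (accept_step d p z y) = sets (euclid d)"
    unfolding accept_step_def by (rule sets_bind) (auto simp: z y)
  assume f: "f \<in> borel_measurable (euclid d)"
  have "(\<integral>\<^sup>+x. f x \<partial>accept_step d p z y) = (\<integral>\<^sup>+b. f (if b then y else z) \<partial>measure_pmf ?q)"
    unfolding accept_step_def nn_integral_bind[OF f m]
    using z y f by (intro nn_integral_cong) (auto simp: nn_integral_return)
  also have "\<dots> = ennreal (min 1 (p y / p z)) * f y + ennreal (1 - min 1 (p y / p z)) * f z"
    using pos by (subst nn_integral_bernoulli_pmf) (auto simp: mult.commute)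
  finally show "(\<integral>\<^sup>+x. f x \<partial>accept_step d p z y) = ennreal (min 1 (p y / p z)) * f y + ennreal (1 - min 1 (p y / p z)) * f z" .
qed

lemma integral_accept_step:
  assumes z: "z \<in> space (euclid d)" and y: "y \<in> space (euclid d)" and pos: "p z > 0" "p y > 0"
    and f: "bounded_measurable (euclid d) f"
  shows "(\<integral>x. f x \<partial>accept_step d p z y) = f z + min 1 (p y / p z) * (f y - f z)"
proof -
  let ?q = "bernoulli_pmf (min 1 (p y / p z))"
  obtain B where B: "\<And>x. x \<in> space (euclid d) \<Longrightarrow> \<bar>f x\<bar> \<le> B" and fm: "f \<in> borel_measurable (euclid d)"
    using f by (auto simp: bounded_measurable_def)
  have m: "(\<lambda>b. return (euclid d) (if b then y else z)) \<in> measure_pmf ?q \<rightarrow>\<^sub>M subprob_algebra (euclid d)"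
    using z y by (rule return_measurable_pmf)
  have "(\<integral>x. f x \<partial>accept_step d p z y) = (\<integral>b. (\<integral>x. f x \<partial>return (euclid d) (if b then y else z)) \<partial>measure_pmf ?q)"
    unfolding accept_step_def
    by (rule integral_bind[OF fm B m, where B'=1])
      (auto intro!: AE_I2 finite_measure.intro simp: emeasure_return z y measure_pmf.finite_measure_axioms indicator_def)
  also have "\<dots> = (\<integral>b. f (if b then y else z) \<partial>measure_pmf ?q)"
    using z y fm by (intro Bochner_Integration.integral_cong refl) (auto simp: integral_return)
  also have "\<dots> = f z + min 1 (p y / p z) * (f y - f z)"
    using pos by (subst integral_bernoulli_pmf) (auto simp: algebra_simps)
  finally show ?thesis .
qed

lemma accept_step_measurable:
  assumes p[measurable]: "p \<in> borel_measurable (euclid d)" and pos: "\<And>x. p x > 0"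
  shows "(\<lambda>w. accept_step d p (fst w) (snd w)) \<in> euclid d \<Otimes>\<^sub>M euclid d \<rightarrow>\<^sub>M subprob_algebra (euclid d)"
proof (rule measurable_subprob_algebra)
  fix w assume "w \<in> space (euclid d \<Otimes>\<^sub>M euclid d)"
  then have w: "fst w \<in> space (euclid d)" "snd w \<in> space (euclid d)" by (auto simp: space_pair_measure)
  show "subprob_space (accept_step d p (fst w) (snd w))"
    by (intro prob_space_imp_subprob_space prob_space_accept_step w pos)
  show "sets (accept_step d p (fst w) (snd w)) = sets (euclid d)"
    by (intro sets_accept_step w pos)
next
  fix A assume A[measurable]: "A \<in> sets (euclid d)"
  have "emeasure (accept_step d p (fst w) (snd w)) A =
      ennreal (min 1 (p (snd w) / p (fst w))) * indicator A (snd w) + ennreal (1 - min 1 (p (snd w) / p (fst w))) * indicator A (fst w)"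
    if "w \<in> space (euclid d \<Otimes>\<^sub>M euclid d)" for w
  proof -
    have w: "fst w \<in> space (euclid d)" "snd w \<in> space (euclid d)" using that by (auto simp: space_pair_measure)
    have "emeasure (accept_step d p (fst w) (snd w)) A = (\<integral>\<^sup>+x. indicator A x \<partial>accept_step d p (fst w) (snd w))"
      using A sets_accept_step[of "fst w" d "snd w" p] w pos by simp
    then show ?thesis using nn_integral_accept_step[of "fst w" d "snd w" p "indicator A"] w pos by simp
  qed
  then show "(\<lambda>w. emeasure (accept_step d p (fst w) (snd w)) A) \<in> borel_measurable (euclid d \<Otimes>\<^sub>M euclid d)"
    by (subst measurable_cong) (assumption, measurable)
qed

context
  fixes d :: nat and p :: "(nat \<Rightarrow> real) \<Rightarrow> real" and \<sigma> :: real
  assumes p[measurable]: "p \<in> borel_measurable (euclid d)" and pos: "\<And>x. p x > 0" and \<sigma>: "\<sigma> > 0"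
begin

lemma accept_step_measurable_snd:
  assumes z: "z \<in> space (euclid d)"
  shows "accept_step d p z \<in> normal_proposal d v z \<rightarrow>\<^sub>M subprob_algebra (euclid d)"
proof -
  have "(\<lambda>y. accept_step d p (fst (z, y)) (snd (z, y))) \<in> euclid d \<rightarrow>\<^sub>M subprob_algebra (euclid d)"
    by (rule measurable_compose[OF measurable_Pair1'[OF z] accept_step_measurable[OF p pos]])
  then show ?thesis by (simp add: measurable_cong_sets[OF sets_normal_proposal refl])
qed

lemma rwm_kernel_measurable: "rwm_kernel d p (\<sigma>\<^sup>2) \<in> euclid d \<rightarrow>\<^sub>M prob_algebra (euclid d)"
proof (rule measurable_prob_algebraI)
  show "rwm_kernel d p (\<sigma>\<^sup>2) \<in> euclid d \<rightarrow>\<^sub>M subprob_algebra (euclid d)"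
    unfolding rwm_kernel_eq[abs_def]
    by (rule measurable_bind[OF normal_proposal_measurable[OF \<sigma>] accept_step_measurable[OF p pos]])
  fix z assume z: "z \<in> space (euclid d)"
  show "prob_space (rwm_kernel d p (\<sigma>\<^sup>2) z)"
    unfolding rwm_kernel_eq using sets_eq_imp_space_eq[OF sets_normal_proposal] z pos
    by (intro prob_space.prob_space_bind[OF prob_space_normal_proposal[OF \<sigma>] _ accept_step_measurable_snd] AE_I2)
      (auto intro: prob_space_accept_step)
qed

text \<open>A rejected proposal leaves \<open>f z\<close> unchanged, so only the increments of
  accepted moves remain.\<close>

lemma integral_rwm_kernel:
  assumes z: "z \<in> space (euclid d)" and f: "bounded_measurable (euclid d) f"
  shows "(\<integral>x. f x \<partial>rwm_kernel d p (\<sigma>\<^sup>2) z) = f z + (\<integral>y. min 1 (p y / p z) * (f y - f z) \<partial>normal_proposal d (\<sigma>\<^sup>2) z)"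
proof -
  interpret Q: prob_space "normal_proposal d (\<sigma>\<^sup>2) z" by (rule prob_space_normal_proposal[OF \<sigma>])
  have sp: "space (normal_proposal d (\<sigma>\<^sup>2) z) = space (euclid d)" by (rule sets_eq_imp_space_eq[OF sets_normal_proposal])
  obtain B where B: "\<And>x. x \<in> space (euclid d) \<Longrightarrow> \<bar>f x\<bar> \<le> B" and fm[measurable]: "f \<in> borel_measurable (euclid d)"
    using f by (auto simp: bounded_measurable_def)
  note [measurable_cong] = sets_normal_proposal
  have int: "integrable (normal_proposal d (\<sigma>\<^sup>2) z) (\<lambda>y. min 1 (p y / p z) * (f y - f z))"
  proof (rule Q.integrable_const_bound[where B="2 * B"])
    show "AE y in normal_proposal d (\<sigma>\<^sup>2) z. norm (min 1 (p y / p z) * (f y - f z)) \<le> 2 * B"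
    proof (rule AE_I2)
      fix y assume "y \<in> space (normal_proposal d (\<sigma>\<^sup>2) z)"
      then have "\<bar>f y - f z\<bar> \<le> 2 * B" using B[of y] B[OF z] sp by simp
      moreover have "\<bar>min 1 (p y / p z)\<bar> \<le> 1" using pos[of y] pos[of z] by (simp add: min_def)
      ultimately have "\<bar>min 1 (p y / p z)\<bar> * \<bar>f y - f z\<bar> \<le> 1 * (2 * B)" by (intro mult_mono) auto
      then show "norm (min 1 (p y / p z) * (f y - f z)) \<le> 2 * B" by (simp add: abs_mult)
    qed
  qed measurable
  have "(\<integral>x. f x \<partial>rwm_kernel d p (\<sigma>\<^sup>2) z) = (\<integral>y. (\<integral>x. f x \<partial>accept_step d p z y) \<partial>normal_proposal d (\<sigma>\<^sup>2) z)"
    unfolding rwm_kernel_eq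
    by (rule integral_bind[OF fm B accept_step_measurable_snd[OF z], where B'=1])
      (auto intro!: AE_I2 prob_space.emeasure_space_1[THEN eq_refl] prob_space_accept_step simp: z sp pos Q.finite_measure_axioms)
  also have "\<dots> = (\<integral>y. f z + min 1 (p y / p z) * (f y - f z) \<partial>normal_proposal d (\<sigma>\<^sup>2) z)"
    using z pos f sp by (intro Bochner_Integration.integral_cong refl integral_accept_step) auto
  also have "\<dots> = f z + (\<integral>y. min 1 (p y / p z) * (f y - f z) \<partial>normal_proposal d (\<sigma>\<^sup>2) z)"
    using int Q.prob_space by simp
  finally show ?thesis .
qed

text \<open>The weight \<open>p(z) q(z, y) min(1, p(y)/p(z)) = q(z, y) min(p(z), p(y))\<close> is symmetric.\<close>

lemma rwm_kernel_reversible: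
  assumes p1: "(\<integral>\<^sup>+z. ennreal (p z) \<partial>lborel_PiM d) = 1"
    and f: "bounded_measurable (euclid d) f" and g: "bounded_measurable (euclid d) g"
  shows "(\<integral>z. p z * (f z * (\<integral>y. g y \<partial>rwm_kernel d p (\<sigma>\<^sup>2) z)) \<partial>lborel_PiM d) =
         (\<integral>z. p z * (g z * (\<integral>y. f y \<partial>rwm_kernel d p (\<sigma>\<^sup>2) z)) \<partial>lborel_PiM d)"
proof -
  define L where "L = lborel_PiM d"
  define q where "q = proposal_density d \<sigma>"
  define S where "S z y = q z y * min (p z) (p y)" for z y
  have sets_L[measurable_cong]: "sets L = sets (euclid d)" unfolding L_def euclid_def by (intro sets_PiM_cong) auto
  have sp: "space L = space (euclid d)" by (rule sets_eq_imp_space_eq[OF sets_L])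
  interpret product_sigma_finite "\<lambda>_::nat. lborel :: real measure"
    by (rule product_sigma_finite.intro) (rule lborel.sigma_finite_measure_axioms)
  interpret L: sigma_finite_measure L unfolding L_def by (rule sigma_finite) simp
  interpret LL: pair_sigma_finite L L ..
  have qm[measurable]: "(\<lambda>w. q (fst w) (snd w)) \<in> borel_measurable (L \<Otimes>\<^sub>M L)"
    unfolding q_def L_def by (rule proposal_density_measurable)
  have pm[measurable]: "p \<in> borel_measurable L" by measurable
  have Sm[measurable]: "(\<lambda>w. S (fst w) (snd w)) \<in> borel_measurable (L \<Otimes>\<^sub>M L)"
    unfolding S_def by measurable
  have q_nonneg: "0 \<le> q z y" for z y unfolding q_def by (rule proposal_density_nonneg)
  have S_nonneg: "0 \<le> S z y" for z y unfolding S_def using q_nonneg[of z y] pos[of z] pos[of y] by simp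
  have S_sym: "S z y = S y z" for z y unfolding S_def q_def by (subst proposal_density_sym) (simp add: min.commute)
  have q1: "(\<integral>\<^sup>+y. ennreal (q z y) \<partial>L) = 1" if z: "z \<in> space L" for z
  proof -
    have [measurable]: "q z \<in> borel_measurable L"
      using measurable_compose[OF measurable_Pair1'[OF z] qm] by simp
    interpret Q: prob_space "normal_proposal d (\<sigma>\<^sup>2) z" by (rule prob_space_normal_proposal[OF \<sigma>])
    have "emeasure (normal_proposal d (\<sigma>\<^sup>2) z) (space (normal_proposal d (\<sigma>\<^sup>2) z)) = (\<integral>\<^sup>+y. ennreal (q z y) \<partial>L)"
      unfolding normal_proposal_eq_density[OF \<sigma>] q_def[symmetric] L_def[symmetric]
      by (subst emeasure_density) auto
    then show ?thesis using Q.emeasure_space_1 by simp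
  qed
  \<comment> \<open>\<open>S z y \<le> p z * q z y\<close>, which has total mass \<open>1\<close>;
    this integrability carries every exchange of integrals below.\<close>
  have S_int: "integrable (L \<Otimes>\<^sub>M L) (\<lambda>w. S (fst w) (snd w))"
  proof (rule integrableI_bounded)
    have "(\<integral>\<^sup>+w. ennreal (norm (S (fst w) (snd w))) \<partial>(L \<Otimes>\<^sub>M L)) = (\<integral>\<^sup>+z. \<integral>\<^sup>+y. ennreal (S z y) \<partial>L \<partial>L)"
      using S_nonneg by (subst L.nn_integral_fst[symmetric]) auto
    also have "\<dots> \<le> (\<integral>\<^sup>+z. \<integral>\<^sup>+y. ennreal (p z) * ennreal (q z y) \<partial>L \<partial>L)"
    proof (intro nn_integral_mono)
      fix z y
      have "S z y \<le> q z y * p z" unfolding S_def using q_nonneg[of z y] by (intro mult_left_mono) auto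
      then have "S z y \<le> p z * q z y" by (simp add: mult.commute)
      then show "ennreal (S z y) \<le> ennreal (p z) * ennreal (q z y)"
        using pos[of z] by (subst ennreal_mult''[symmetric]) (auto intro: ennreal_leI simp: q_nonneg)
    qed
    also have "\<dots> = (\<integral>\<^sup>+z. ennreal (p z) \<partial>L)"
    proof (intro nn_integral_cong)
      fix z assume z: "z \<in> space L"
      have [measurable]: "q z \<in> borel_measurable L"
        using measurable_compose[OF measurable_Pair1'[OF z] qm] by simp
      show "(\<integral>\<^sup>+y. ennreal (p z) * ennreal (q z y) \<partial>L) = ennreal (p z)"
        using q1[OF z] by (subst nn_integral_cmult) auto
    qed
    also have "\<dots> < \<infinity>" using p1 by (simp add: L_def)
    finally show "(\<integral>\<^sup>+w. ennreal (norm (S (fst w) (snd w))) \<partial>(L \<Otimes>\<^sub>M L)) < \<infinity>" .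
  qed measurable
  have bound: "integrable (L \<Otimes>\<^sub>M L) (\<lambda>w. S (fst w) (snd w) * (F (fst w) * G (snd w)))"
    if F: "bounded_measurable (euclid d) F" and G: "bounded_measurable (euclid d) G" for F G
  proof -
    obtain A where A: "\<And>x. x \<in> space (euclid d) \<Longrightarrow> \<bar>F x\<bar> \<le> A" and [measurable]: "F \<in> borel_measurable (euclid d)"
      using F by (auto simp: bounded_measurable_def)
    obtain B where B: "\<And>x. x \<in> space (euclid d) \<Longrightarrow> \<bar>G x\<bar> \<le> B" and [measurable]: "G \<in> borel_measurable (euclid d)"
      using G by (auto simp: bounded_measurable_def)
    have i: "integrable (L \<Otimes>\<^sub>M L) (\<lambda>w. (A * B) * S (fst w) (snd w))" using S_int by simp
    show ?thesis
    proof (rule Bochner_Integration.integrable_bound[OF i])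
      show "AE w in L \<Otimes>\<^sub>M L. norm (S (fst w) (snd w) * (F (fst w) * G (snd w))) \<le> norm ((A * B) * S (fst w) (snd w))"
      proof (rule AE_I2)
        fix w assume "w \<in> space (L \<Otimes>\<^sub>M L)"
        then have w: "fst w \<in> space (euclid d)" "snd w \<in> space (euclid d)" by (auto simp: space_pair_measure sp)
        have "\<bar>F (fst w)\<bar> * \<bar>G (snd w)\<bar> \<le> A * B" using A[OF w(1)] B[OF w(2)] by (intro mult_mono) auto
        then have "\<bar>F (fst w)\<bar> * \<bar>G (snd w)\<bar> \<le> \<bar>A * B\<bar>" by linarith
        from mult_left_mono[OF this abs_ge_zero[of "S (fst w) (snd w)"]]
        show "norm (S (fst w) (snd w) * (F (fst w) * G (snd w))) \<le> norm ((A * B) * S (fst w) (snd w))"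
          by (simp add: abs_mult mult_ac)
      qed
    qed measurable
  qed
  have one: "bounded_measurable (euclid d) (\<lambda>_. 1)" by simp
  \<comment> \<open>\<open>T\<close> is the bilinear form of the accepted flow; Fubini and the
    symmetry of \<open>S\<close> make it symmetric.\<close>
  define T where "T F G = (\<integral>z. (\<integral>y. S z y * (F z * G y) \<partial>L) \<partial>L)" for F G :: "(nat \<Rightarrow> real) \<Rightarrow> real"
  have T_sym: "T F G = T G F" if F: "bounded_measurable (euclid d) F" and G: "bounded_measurable (euclid d) G" for F G
  proof -
    have "T F G = (\<integral>y. (\<integral>z. S z y * (F z * G y) \<partial>L) \<partial>L)"
      unfolding T_def using bound[OF F G] by (intro LL.Fubini_integral[symmetric]) (simp add: case_prod_beta')
    also have "\<dots> = T G F" unfolding T_def by (subst S_sym) (simp add: mult_ac)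
    finally show ?thesis .
  qed
  \<comment> \<open>Each of the three parts is symmetric: \<open>T F G\<close> by
    \<open>T_sym\<close>, the other two because they involve \<open>F\<close> and \<open>G\<close>
    only through their product.\<close>
  have main: "(\<integral>z. p z * (F z * (\<integral>y. G y \<partial>rwm_kernel d p (\<sigma>\<^sup>2) z)) \<partial>L) = (\<integral>z. p z * (F z * G z) \<partial>L) + T F G - T (\<lambda>z. F z * G z) (\<lambda>_. 1)"
    if F: "bounded_measurable (euclid d) F" and G: "bounded_measurable (euclid d) G" for F G
  proof -
    have FG: "bounded_measurable (euclid d) (\<lambda>z. F z * G z)" using F G by (rule bounded_measurable_mult)
    have [measurable]: "F \<in> borel_measurable (euclid d)" "G \<in> borel_measurable (euclid d)"
      using F G by (auto dest: bounded_measurableD)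
    have i1: "integrable L (\<lambda>z. p z * (F z * G z))"
    proof -
      obtain A where A: "\<And>x. x \<in> space (euclid d) \<Longrightarrow> \<bar>F x * G x\<bar> \<le> A" using FG by (auto simp: bounded_measurable_def)
      have "(\<integral>\<^sup>+z. ennreal (p z) \<partial>L) = 1" using p1 by (simp only: L_def)
      then have "integrable L p" using pos by (intro integrableI_nonneg) (auto simp: less_imp_le)
      then have i: "integrable L (\<lambda>z. A * p z)" by simp
      show ?thesis
      proof (rule Bochner_Integration.integrable_bound[OF i])
        show "AE z in L. norm (p z * (F z * G z)) \<le> norm (A * p z)"
        proof (rule AE_I2)
          fix z assume "z \<in> space L"
          then have "\<bar>F z * G z\<bar> \<le> \<bar>A\<bar>" using A[of z] sp by auto
          from mult_left_mono[OF this abs_ge_zero[of "p z"]]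
          show "norm (p z * (F z * G z)) \<le> norm (A * p z)"
            by (simp add: abs_mult mult_ac)
        qed
      qed measurable
    qed
    have i2: "integrable L (\<lambda>z. \<integral>y. S z y * (F z * G y) \<partial>L)"
      using LL.integrable_fst'[OF bound[OF F G]] by simp
    have i3: "integrable L (\<lambda>z. \<integral>y. S z y * ((F z * G z) * 1) \<partial>L)"
      using LL.integrable_fst'[OF bound[OF FG one]] by simp
    have ae2: "AE z in L. integrable L (\<lambda>y. S z y * (F z * G y))" using LL.AE_integrable_fst'[OF bound[OF F G]] by simp
    have ae3: "AE z in L. integrable L (\<lambda>y. S z y * ((F z * G z) * 1))" using LL.AE_integrable_fst'[OF bound[OF FG one]] by simp
    have "(\<integral>z. p z * (F z * (\<integral>y. G y \<partial>rwm_kernel d p (\<sigma>\<^sup>2) z)) \<partial>L) =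
      (\<integral>z. p z * (F z * G z) + (\<integral>y. S z y * (F z * G y) \<partial>L) - (\<integral>y. S z y * ((F z * G z) * 1) \<partial>L) \<partial>L)"
    proof (rule integral_cong_AE)
      show "(\<lambda>z. p z * (F z * (\<integral>y. G y \<partial>rwm_kernel d p (\<sigma>\<^sup>2) z))) \<in> borel_measurable L"
        using measurable_prob_algebraD[OF rwm_kernel_measurable] by measurable
      show "(\<lambda>z. p z * (F z * G z) + (\<integral>y. S z y * (F z * G y) \<partial>L) - (\<integral>y. S z y * ((F z * G z) * 1) \<partial>L)) \<in> borel_measurable L"
        using i1 i2 i3 by (intro borel_measurable_diff borel_measurable_add) auto
      show "AE z in L. p z * (F z * (\<integral>y. G y \<partial>rwm_kernel d p (\<sigma>\<^sup>2) z)) =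
        p z * (F z * G z) + (\<integral>y. S z y * (F z * G y) \<partial>L) - (\<integral>y. S z y * ((F z * G z) * 1) \<partial>L)"
        using ae2 ae3 AE_space
      proof eventually_elim
        case (elim z)
        then have z: "z \<in> space (euclid d)" by (simp add: sp)
        have [measurable]: "q z \<in> borel_measurable L"
          using measurable_compose[OF measurable_Pair1'[OF elim(3)] qm] by simp
        have eq: "(\<integral>y. min 1 (p y / p z) * (G y - G z) \<partial>normal_proposal d (\<sigma>\<^sup>2) z) = (\<integral>y. q z y * (min 1 (p y / p z) * (G y - G z)) \<partial>L)"
          unfolding normal_proposal_eq_density[OF \<sigma>] q_def[symmetric] L_def[symmetric]
          by (subst integral_density) (auto simp: q_nonneg)
        have "p z * (F z * (\<integral>y. G y \<partial>rwm_kernel d p (\<sigma>\<^sup>2) z)) =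
          p z * (F z * G z) + (\<integral>y. (p z * F z) * (q z y * (min 1 (p y / p z) * (G y - G z))) \<partial>L)"
          by (simp only: integral_rwm_kernel[OF z G] eq integral_mult_right_zero distrib_left mult.assoc)
        also have "(\<integral>y. (p z * F z) * (q z y * (min 1 (p y / p z) * (G y - G z))) \<partial>L) =
            (\<integral>y. S z y * (F z * G y) - S z y * ((F z * G z) * 1) \<partial>L)"
        proof (rule Bochner_Integration.integral_cong[OF refl])
          fix y
          have "p z * min 1 (p y / p z) = min (p z) (p y)" using pos[of z] by (simp add: min_def field_simps)
          then have "S z y = q z y * (p z * min 1 (p y / p z))" by (simp add: S_def)
          then show "(p z * F z) * (q z y * (min 1 (p y / p z) * (G y - G z))) = S z y * (F z * G y) - S z y * ((F z * G z) * 1)"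
            by (simp add: algebra_simps)
        qed
        also have "\<dots> = (\<integral>y. S z y * (F z * G y) \<partial>L) - (\<integral>y. S z y * ((F z * G z) * 1) \<partial>L)"
          using elim by (intro Bochner_Integration.integral_diff) auto
        finally show ?case by simp
      qed
    qed
    also have "\<dots> = (\<integral>z. p z * (F z * G z) \<partial>L) + T F G - T (\<lambda>z. F z * G z) (\<lambda>_. 1)"
      unfolding T_def using i1 i2 i3 by simp
    finally show ?thesis .
  qed
  have "T (\<lambda>z. f z * g z) (\<lambda>_. 1) = T (\<lambda>z. g z * f z) (\<lambda>_. 1)" by (simp add: mult.commute)
  moreover have "(\<integral>z. p z * (f z * g z) \<partial>L) = (\<integral>z. p z * (g z * f z) \<partial>L)" by (simp add: mult.commute)
  ultimately show ?thesis
    unfolding L_def[symmetric] main[OF f g] main[OF g f] using T_sym[OF f g] by simp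
qed

end

text \<open>The moving coordinate is put outermost, so that the inner integral over the others
  becomes \<open>acc\<close>.\<close>

lemma product_integral_insert_swap:
  fixes f :: "('i \<Rightarrow> 'a) \<Rightarrow> real"
  assumes N: "prob_space N" and J: "finite J" "i \<notin> J" and f: "bounded_measurable (PiM (insert i J) (\<lambda>_. N)) f"
  shows "(\<integral>x. f x \<partial>PiM (insert i J) (\<lambda>_. N)) = (\<integral>y. (\<integral>x. f (x(i := y)) \<partial>PiM J (\<lambda>_. N)) \<partial>N)"
proof -
  interpret N: prob_space N by fact
  interpret product_prob_space "\<lambda>_. N" by (rule product_prob_space_const[OF N])
  interpret Q: prob_space "PiM J (\<lambda>_. N)" by (rule prob_space_PiM) (rule N)
  interpret R: prob_space "PiM (insert i J) (\<lambda>_. N)" by (rule prob_space_PiM) (rule N)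
  interpret QN: pair_prob_space "PiM J (\<lambda>_. N)" N ..
  obtain B where B: "\<And>x. x \<in> space (PiM (insert i J) (\<lambda>_. N)) \<Longrightarrow> \<bar>f x\<bar> \<le> B"
    and fm: "f \<in> borel_measurable (PiM (insert i J) (\<lambda>_. N))" using f by (auto simp: bounded_measurable_def)
  have add: "(\<lambda>(x, y). x(i := y)) \<in> PiM J (\<lambda>_. N) \<Otimes>\<^sub>M N \<rightarrow>\<^sub>M PiM (insert i J) (\<lambda>_. N)"
    by (rule measurable_add_dim)
  have int: "integrable (PiM J (\<lambda>_. N) \<Otimes>\<^sub>M N) (\<lambda>(x, y). f (x(i := y)))"
  proof (rule QN.integrable_const_bound[where B=B])
    show "AE w in PiM J (\<lambda>_. N) \<Otimes>\<^sub>M N. norm (case w of (x, y) \<Rightarrow> f (x(i := y))) \<le> B"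
      using measurable_space[OF add] B by (intro AE_I2) auto
    show "(\<lambda>(x, y). f (x(i := y))) \<in> borel_measurable (PiM J (\<lambda>_. N) \<Otimes>\<^sub>M N)"
      using measurable_compose[OF add fm] by (simp add: case_prod_beta')
  qed
  have "(\<integral>x. f x \<partial>PiM (insert i J) (\<lambda>_. N)) = (\<integral>x. (\<integral>y. f (x(i := y)) \<partial>N) \<partial>PiM J (\<lambda>_. N))"
    by (rule product_integral_insert[OF J R.integrable_bounded_measurable[OF f]])
  also have "\<dots> = (\<integral>y. (\<integral>x. f (x(i := y)) \<partial>PiM J (\<lambda>_. N)) \<partial>N)"
    by (rule QN.Fubini_integral[OF int, symmetric])
  finally show ?thesis .
qed

section \<open>The chain with product target as a self-adjoint operator\<close>

context target begin

definition \<pi> :: "nat \<Rightarrow> (nat \<Rightarrow> real) measure" where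
  "\<pi> d = PiM {1..d} (\<lambda>_. \<mu>)"

abbreviation rwm :: "nat \<Rightarrow> real \<Rightarrow> (nat \<Rightarrow> real) \<Rightarrow> (nat \<Rightarrow> real) measure" where
  "rwm d \<sigma> \<equiv> rwm_kernel d (prod_density h d) (\<sigma>\<^sup>2)"

lemma prod_density_measurable[measurable]: "prod_density h d \<in> borel_measurable (euclid d)"
  unfolding prod_density_def[abs_def] euclid_def by measurable

lemma prod_density_pos: "prod_density h d x > 0"
  unfolding prod_density_def using h_pos by (intro prod_pos) auto

lemma sets_\<pi>[measurable_cong]: "sets (\<pi> d) = sets (euclid d)"
  unfolding euclid_def \<pi>_def by (intro sets_PiM_cong) auto

lemma space_\<pi>: "space (\<pi> d) = space (euclid d)"
  by (rule sets_eq_imp_space_eq[OF sets_\<pi>])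

lemma \<pi>_eq_density: "\<pi> d = density (lborel_PiM d) (prod_density h d)"
proof -
  interpret prob_space \<mu> by (rule prob_\<mu>)
  have "sigma_finite_measure \<mu>" by unfold_locales
  then show ?thesis
    unfolding \<pi>_def \<mu>_def prod_density_def using h_pos
    by (intro PiM_density) (auto intro: lborel.sigma_finite_measure_axioms less_imp_le)
qed

lemma bounded_measurable_\<pi>: "bounded_measurable (\<pi> d) f \<longleftrightarrow> bounded_measurable (euclid d) f"
  by (simp add: bounded_measurable_def space_\<pi> measurable_cong_sets[OF sets_\<pi> refl])

lemma prob_\<pi>: "prob_space (\<pi> d)" unfolding \<pi>_def using prob_\<mu> by (auto intro: prob_space_PiM)

lemma integral_\<pi>:
  fixes f :: "(nat \<Rightarrow> real) \<Rightarrow> real"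
  assumes "f \<in> borel_measurable (euclid d)"
  shows "(\<integral>z. f z \<partial>\<pi> d) = (\<integral>z. prod_density h d z * f z \<partial>lborel_PiM d)"
proof -
  have s: "sets (lborel_PiM d) = sets (euclid d)" unfolding euclid_def by (intro sets_PiM_cong) auto
  show ?thesis
    unfolding \<pi>_eq_density
    using assms prod_density_measurable[of d] prod_density_pos[of d, THEN less_imp_le]
    by (subst integral_density) (simp_all only: measurable_cong_sets[OF s refl] AE_I2 real_scaleR_def simp_thms)
qed

lemma reversible_kernel_rwm:
  assumes \<sigma>: "\<sigma> > 0"
  shows "reversible_kernel (\<pi> d) (rwm d \<sigma>)"
proof -
  interpret prob_space "\<pi> d" by (rule prob_\<pi>)
  note K = rwm_kernel_measurable[OF prod_density_measurable prod_density_pos \<sigma>]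
  have s: "sets (lborel_PiM d) = sets (euclid d)" unfolding euclid_def by (intro sets_PiM_cong) auto
  show ?thesis
  proof (unfold_locales)
    show "rwm d \<sigma> \<in> \<pi> d \<rightarrow>\<^sub>M prob_algebra (\<pi> d)"
    proof -
      have "prob_algebra (\<pi> d) = prob_algebra (euclid d)"
        by (simp add: prob_algebra_def subprob_algebra_cong[OF sets_\<pi>])
      then show ?thesis using K by (simp add: measurable_cong_sets[OF sets_\<pi> refl])
    qed
    fix f g assume "bounded_measurable (\<pi> d) f" "bounded_measurable (\<pi> d) g"
    then have fg: "bounded_measurable (euclid d) f" "bounded_measurable (euclid d) g"
      by (auto simp: bounded_measurable_\<pi>)
    then have [measurable]: "f \<in> borel_measurable (euclid d)" "g \<in> borel_measurable (euclid d)"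
      by (auto dest: bounded_measurableD)
    note [measurable] = measurable_prob_algebraD[OF K]
    have "(\<integral>\<^sup>+z. ennreal (prod_density h d z) \<partial>lborel_PiM d) = emeasure (\<pi> d) (space (\<pi> d))"
    proof -
      have m: "(\<lambda>x. ennreal (prod_density h d x)) \<in> borel_measurable (lborel_PiM d)"
        unfolding measurable_cong_sets[OF s refl] by measurable
      show ?thesis unfolding \<pi>_eq_density by (subst emeasure_density[OF m]) (auto intro!: nn_integral_cong)
    qed
    then have p1: "(\<integral>\<^sup>+z. ennreal (prod_density h d z) \<partial>lborel_PiM d) = 1" using emeasure_space_1 by simp
    have m: "(\<lambda>z. f z * (\<integral>y. g y \<partial>rwm d \<sigma> z)) \<in> borel_measurable (euclid d)"
      "(\<lambda>z. g z * (\<integral>y. f y \<partial>rwm d \<sigma> z)) \<in> borel_measurable (euclid d)" by measurable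
    show "(\<integral>x. f x * (\<integral>y. g y \<partial>rwm d \<sigma> x) \<partial>\<pi> d) = (\<integral>x. g x * (\<integral>y. f y \<partial>rwm d \<sigma> x) \<partial>\<pi> d)"
      unfolding integral_\<pi>[OF m(1)] integral_\<pi>[OF m(2)]
      by (rule rwm_kernel_reversible[OF prod_density_measurable prod_density_pos \<sigma> p1 fg])
  qed
qed

abbreviation rwm_op :: "nat \<Rightarrow> real \<Rightarrow> ((nat \<Rightarrow> real) \<Rightarrow> real) \<Rightarrow> (nat \<Rightarrow> real) \<Rightarrow> real" where
  "rwm_op d \<sigma> \<equiv> reversible_kernel.op (rwm d \<sigma>)"

lemma rwm_law_measurable:
  assumes \<sigma>: "\<sigma> > 0"
  shows "rwm_law d (prod_density h d) (\<sigma>\<^sup>2) n \<in> euclid d \<rightarrow>\<^sub>M prob_algebra (euclid d)"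
proof (induction n)
  case 0
  then show ?case by (simp add: measurable_return_prob_space cong: measurable_cong)
next
  case (Suc n)
  show ?case
    using measurable_bind_prob_space[OF Suc rwm_kernel_measurable[OF prod_density_measurable prod_density_pos \<sigma>]]
    by simp
qed

text \<open>\<open>rwm_law\<close> appends steps at the end, and the last step is absorbed into the
  test function; hence the induction runs over all \<open>f\<close> with the starting point
  fixed.\<close>

lemma integral_rwm_law:
  assumes \<sigma>: "\<sigma> > 0" and z: "z \<in> space (euclid d)" and f: "bounded_measurable (euclid d) f"
  shows "(\<integral>x. f x \<partial>rwm_law d (prod_density h d) (\<sigma>\<^sup>2) n z) = (rwm_op d \<sigma> ^^ n) f z"
  using f
proof (induction n arbitrary: f)
  case 0
  then show ?case using z by (simp add: integral_return bounded_measurableD)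
next
  case (Suc n)
  interpret reversible_kernel "\<pi> d" "rwm d \<sigma>" by (rule reversible_kernel_rwm[OF \<sigma>])
  obtain B where B: "\<And>x. x \<in> space (euclid d) \<Longrightarrow> \<bar>f x\<bar> \<le> B" and fm: "f \<in> borel_measurable (euclid d)"
    using Suc.prems by (auto simp: bounded_measurable_def)
  let ?law = "rwm_law d (prod_density h d) (\<sigma>\<^sup>2) n z"
  have law: "prob_space ?law" "sets ?law = sets (euclid d)"
    using measurable_space[OF rwm_law_measurable[OF \<sigma>] z] by (auto simp: space_prob_algebra)
  note K = rwm_kernel_measurable[OF prod_density_measurable prod_density_pos \<sigma>, of d]
  have K': "rwm d \<sigma> \<in> ?law \<rightarrow>\<^sub>M subprob_algebra (euclid d)"
    using measurable_prob_algebraD[OF K] by (simp add: measurable_cong_sets[OF law(2) refl])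
  have "(\<integral>x. f x \<partial>rwm_law d (prod_density h d) (\<sigma>\<^sup>2) (Suc n) z) = (\<integral>x. (\<integral>y. f y \<partial>rwm d \<sigma> x) \<partial>?law)"
    unfolding rwm_law.simps
  proof (rule integral_bind[OF fm B K', where B'=1])
    show "finite_measure ?law" using law(1) by (rule prob_space.finite_measure)
    show "AE x in ?law. emeasure (rwm d \<sigma> x) (space (rwm d \<sigma> x)) \<le> ennreal 1"
      using measurable_space[OF K] sets_eq_imp_space_eq[OF law(2)]
      by (intro AE_I2) (auto simp: space_prob_algebra prob_space.emeasure_space_1)
  qed
  also have "\<dots> = (\<integral>x. op f x \<partial>?law)" by (simp add: op_def)
  also have "\<dots> = (op ^^ n) (op f) z"
    using Suc.prems op_bm[of f] by (intro Suc.IH) (simp add: bounded_measurable_\<pi>)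
  finally show ?case by (simp add: funpow_swap1)
qed

lemma bounded_measurable_coordinate:
  assumes [measurable]: "\<phi> \<in> borel_measurable borel" and "\<And>x. \<bar>\<phi> x\<bar> \<le> B" and i: "i \<in> {1..d}"
  shows "bounded_measurable (euclid d) (\<lambda>z. \<phi> (z i))"
proof (rule bounded_measurableI[where C=B])
  show "(\<lambda>z. \<phi> (z i)) \<in> borel_measurable (euclid d)" unfolding euclid_def using i by measurable
qed (use assms in auto)

text \<open>Only an accepted move changes coordinate \<open>i\<close>. Integrating out the noise of
  the other coordinates leaves a one-dimensional Gaussian integral which they enter through
  \<open>acc\<close> alone.\<close>

lemma rwm_op_coordinate:
  assumes \<sigma>: "\<sigma> > 0" and z: "z \<in> space (euclid d)" and i: "i \<in> {1..d}"
    and \<phi>m[measurable]: "\<phi> \<in> borel_measurable borel" and \<phi>: "\<And>x. \<bar>\<phi> x\<bar> \<le> B"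
  shows "rwm_op d \<sigma> (\<lambda>z. \<phi> (z i)) z - \<phi> (z i) =
    (\<integral>y. (\<phi> (z i + \<sigma> * y) - \<phi> (z i)) * acc ({1..d} - {i}) \<sigma> z (exp (u (z i + \<sigma> * y) - u (z i))) \<partial>std_normal)"
proof -
  interpret reversible_kernel "\<pi> d" "rwm d \<sigma>" by (rule reversible_kernel_rwm[OF \<sigma>])
  define J where "J = {1..d} - {i}"
  have J: "finite J" "i \<notin> J" "{1..d} = insert i J" using i by (auto simp: J_def)
  let ?S = "PiM {1..d} (\<lambda>_. std_normal)"
  let ?Y = "\<lambda>\<xi>. \<lambda>j\<in>{1..d}. z j + \<sigma> * \<xi> j"
  let ?p = "prod_density h d"
  have Ym: "?Y \<in> ?S \<rightarrow>\<^sub>M euclid d" unfolding euclid_def by measurable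
  have fm: "(\<lambda>y. min 1 (?p y / ?p z) * (\<phi> (y i) - \<phi> (z i))) \<in> borel_measurable (euclid d)"
  proof -
    have [measurable]: "(\<lambda>y. y i) \<in> euclid d \<rightarrow>\<^sub>M borel" unfolding euclid_def using i by measurable
    show ?thesis by measurable
  qed
  have ratio: "?p (?Y \<xi>) / ?p z = exp (\<Sum>j\<in>{1..d}. u (z j + \<sigma> * \<xi> j) - u (z j))" for \<xi>
    unfolding prod_density_def prod_dividef[symmetric] exp_sum[OF finite_atLeastAtMost]
    by (intro prod.cong refl) (simp add: h_eq_exp exp_diff)
  define F where "F \<xi> = min 1 (exp (\<Sum>j\<in>insert i J. u (z j + \<sigma> * \<xi> j) - u (z j))) * (\<phi> (z i + \<sigma> * \<xi> i) - \<phi> (z i))" for \<xi>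
  have "rwm_op d \<sigma> (\<lambda>z. \<phi> (z i)) z - \<phi> (z i) = (\<integral>y. min 1 (?p y / ?p z) * (\<phi> (y i) - \<phi> (z i)) \<partial>normal_proposal d (\<sigma>\<^sup>2) z)"
    unfolding op_def
    by (subst integral_rwm_kernel[OF prod_density_measurable prod_density_pos \<sigma> z bounded_measurable_coordinate[OF \<phi>m \<phi> i]]) simp
  also have "\<dots> = (\<integral>\<xi>. min 1 (?p (?Y \<xi>) / ?p z) * (\<phi> (?Y \<xi> i) - \<phi> (z i)) \<partial>?S)"
    unfolding normal_proposal_eq_distr[OF \<sigma>] using Ym fm by (rule integral_distr)
  also have "\<dots> = (\<integral>\<xi>. F \<xi> \<partial>PiM (insert i J) (\<lambda>_. std_normal))"
    unfolding ratio F_def J(3)[symmetric] using i by simp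
  also have "\<dots> = (\<integral>y. (\<integral>x. F (x(i := y)) \<partial>PiM J (\<lambda>_. std_normal)) \<partial>std_normal)"
  proof (rule product_integral_insert_swap[OF prob_space_std_normal J(1,2)])
    show "bounded_measurable (PiM (insert i J) (\<lambda>_. std_normal)) F"
    proof (rule bounded_measurableI[where C="1 * (2 * B)"])
      show "F \<in> borel_measurable (PiM (insert i J) (\<lambda>_. std_normal))" unfolding F_def by measurable
      fix \<xi>
      show "\<bar>F \<xi>\<bar> \<le> 1 * (2 * B)"
        unfolding F_def abs_mult using \<phi>[of "z i"] \<phi>[of "z i + \<sigma> * \<xi> i"]
        by (intro mult_mono) (auto simp: min_def)
    qed
  qed
  also have "\<dots> = (\<integral>y. (\<phi> (z i + \<sigma> * y) - \<phi> (z i)) * acc J \<sigma> z (exp (u (z i + \<sigma> * y) - u (z i))) \<partial>std_normal)"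
  proof (rule Bochner_Integration.integral_cong[OF refl])
    fix y
    have "F (x(i := y)) = (\<phi> (z i + \<sigma> * y) - \<phi> (z i)) * min 1 (exp (u (z i + \<sigma> * y) - u (z i)) * exp (\<Sum>j\<in>J. u (z j + \<sigma> * x j) - u (z j)))" for x
    proof -
      have "(\<Sum>j\<in>J. u (z j + \<sigma> * (x(i := y)) j) - u (z j)) = (\<Sum>j\<in>J. u (z j + \<sigma> * x j) - u (z j))"
        using J(2) by (intro sum.cong) auto
      then show ?thesis unfolding F_def using J by (simp add: exp_add)
    qed
    then show "(\<integral>x. F (x(i := y)) \<partial>PiM J (\<lambda>_. std_normal)) = (\<phi> (z i + \<sigma> * y) - \<phi> (z i)) * acc J \<sigma> z (exp (u (z i + \<sigma> * y) - u (z i)))"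
      unfolding acc_def by simp
  qed
  finally show ?thesis unfolding J_def .
qed

text \<open>Acceptance probabilities and the mean of \<open>|y|\<close> are at most
  \<open>1\<close>. For small \<open>\<sigma>\<close> this makes the one-step change of a fixed
  Lipschitz function of a coordinate negligible.\<close>

lemma rwm_op_lipschitz:
  assumes \<sigma>: "\<sigma> > 0" and z: "z \<in> space (euclid d)" and i: "i \<in> {1..d}"
    and \<psi>m[measurable]: "\<psi> \<in> borel_measurable borel" and \<psi>: "\<And>x. \<bar>\<psi> x\<bar> \<le> B"
    and lip: "\<And>x y. \<bar>\<psi> x - \<psi> y\<bar> \<le> K * \<bar>x - y\<bar>"
  shows "\<bar>rwm_op d \<sigma> (\<lambda>z. \<psi> (z i)) z - \<psi> (z i)\<bar> \<le> K * \<sigma>"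
proof -
  interpret N: prob_space std_normal by simp
  have "\<bar>rwm_op d \<sigma> (\<lambda>z. \<psi> (z i)) z - \<psi> (z i)\<bar> \<le>
    (\<integral>y. \<bar>(\<psi> (z i + \<sigma> * y) - \<psi> (z i)) * acc ({1..d} - {i}) \<sigma> z (exp (u (z i + \<sigma> * y) - u (z i)))\<bar> \<partial>std_normal)"
    unfolding rwm_op_coordinate[OF \<sigma> z i \<psi>m \<psi>] by (rule integral_abs_bound)
  also have "\<dots> \<le> (\<integral>y. (K * \<sigma>) * \<bar>y\<bar> \<partial>std_normal)"
  proof (rule integral_mono')
    show "integrable std_normal (\<lambda>y. (K * \<sigma>) * \<bar>y\<bar>)" using integrable_std_normal_power(2)[of 1] by simp
    fix y
    have "\<bar>\<psi> (z i + \<sigma> * y) - \<psi> (z i)\<bar> \<le> K * \<bar>\<sigma> * y\<bar>" using lip[of "z i + \<sigma> * y" "z i"] by simp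
    also have "\<dots> = (K * \<sigma>) * \<bar>y\<bar>" using \<sigma> by (simp add: abs_mult)
    finally have *: "\<bar>\<psi> (z i + \<sigma> * y) - \<psi> (z i)\<bar> \<le> (K * \<sigma>) * \<bar>y\<bar>" .
    have "\<bar>(\<psi> (z i + \<sigma> * y) - \<psi> (z i)) * acc ({1..d} - {i}) \<sigma> z (exp (u (z i + \<sigma> * y) - u (z i)))\<bar> \<le> ((K * \<sigma>) * \<bar>y\<bar>) * 1"
      unfolding abs_mult using * acc_bounds[of "exp (u (z i + \<sigma> * y) - u (z i))"] by (intro mult_mono) auto
    then show "\<bar>(\<psi> (z i + \<sigma> * y) - \<psi> (z i)) * acc ({1..d} - {i}) \<sigma> z (exp (u (z i + \<sigma> * y) - u (z i)))\<bar> \<le> (K * \<sigma>) * \<bar>y\<bar>"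
      by simp
    show "0 \<le> (K * \<sigma>) * \<bar>y\<bar>" using * by linarith
  qed
  also have "\<dots> = (K * \<sigma>) * (\<integral>y. \<bar>y\<bar> \<partial>std_normal)" by simp
  also have "\<dots> \<le> (K * \<sigma>) * sqrt (\<integral>y. y\<^sup>2 \<partial>std_normal)"
  proof (rule mult_left_mono)
    show "(\<integral>y. \<bar>y\<bar> \<partial>std_normal) \<le> sqrt (\<integral>y. y\<^sup>2 \<partial>std_normal)" by (rule N.integral_abs_le_sqrt(2)) auto
    have "0 \<le> K" using lip[of 0 1] by simp
    then show "0 \<le> K * \<sigma>" using \<sigma> by simp
  qed
  finally show ?thesis by (simp add: integral_std_normal_moments)
qed

end

subsection \<open>Convergence of generators\<close>

lemma abs_exp_diff_one_le:
  fixes x :: real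
  assumes "\<bar>x\<bar> \<le> 1"
  shows "\<bar>exp x - 1 - x\<bar> \<le> x\<^sup>2" "\<bar>exp x - 1\<bar> \<le> 2 * \<bar>x\<bar>"
proof -
  have low: "1 + x \<le> exp x" by (rule exp_ge_add_one_self)
  have up: "exp x \<le> 1 + x + x\<^sup>2"
  proof (cases "0 \<le> x")
    case True
    then show ?thesis using assms by (intro exp_bound) auto
  next
    case False
    \<comment> \<open>For negative \<open>x\<close>:
      \<open>exp x \<le> 1 / (1 - x) \<le> 1 + x + x^2\<close>, since
      \<open>(1 + x + x^2) * (1 - x) = 1 - x^3\<close> is at least \<open>1\<close>.\<close>
    have "exp x * (1 - x) \<le> exp x * exp (- x)"
      using exp_ge_add_one_self[of "-x"] by (intro mult_left_mono) auto
    then have "exp x * (1 - x) \<le> 1" by (simp flip: exp_add)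
    also have "1 \<le> (1 + x + x\<^sup>2) * (1 - x)"
    proof -
      have "x ^ 3 \<le> 0" using False by (simp add: power_le_zero_eq)
      moreover have "(1 + x + x\<^sup>2) * (1 - x) = 1 - x ^ 3" by (simp add: algebra_simps power2_eq_square power3_eq_cube)
      ultimately show ?thesis by simp
    qed
    finally show ?thesis using False by (simp add: mult_le_cancel_right)
  qed
  show *: "\<bar>exp x - 1 - x\<bar> \<le> x\<^sup>2" unfolding abs_le_iff using low up zero_le_power2[of x] by linarith
  have "x\<^sup>2 \<le> \<bar>x\<bar>" using assms mult_left_le[of "\<bar>x\<bar>" "\<bar>x\<bar>"] by (simp add: power2_eq_square flip: abs_mult)
  then show "\<bar>exp x - 1\<bar> \<le> 2 * \<bar>x\<bar>" using * by linarith
qed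

text \<open>For concave \<open>\<beta>\<close> every chord from \<open>1\<close> to a point at
  distance at most \<open>\<eta>\<close> has a slope between these two chord slopes; the sum of
  their deviations from \<open>b\<close> therefore controls all of them.\<close>

definition slope_error :: "(real \<Rightarrow> real) \<Rightarrow> real \<Rightarrow> real \<Rightarrow> real" where
  "slope_error \<beta> b \<eta> = \<bar>(\<beta> (1 + \<eta>) - \<beta> 1) / \<eta> - b\<bar> + \<bar>(\<beta> 1 - \<beta> (1 - \<eta>)) / \<eta> - b\<bar>"

text \<open>
  Concavity turns closeness of \<open>\<beta>\<close> to a limit function at the three points \<open>1\<close>, \<open>1 \<plusminus> \<eta>\<close> into a
  linearisation at \<open>1\<close>; no control on derivatives is needed.
\<close>

lemma concave_linearisation:
  fixes \<beta> :: "real \<Rightarrow> real"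
  assumes conc: "concave_on {0<..} \<beta>" and \<eta>: "0 < \<eta>" "\<eta> < 1" and t: "\<bar>t\<bar> \<le> \<eta>"
  shows "\<bar>\<beta> (1 + t) - \<beta> 1 - b * t\<bar> \<le> \<bar>t\<bar> * slope_error \<beta> b \<eta>"
proof -
  define sp where "sp = (\<beta> (1 + \<eta>) - \<beta> 1) / \<eta>"
  define sm where "sm = (\<beta> 1 - \<beta> (1 - \<eta>)) / \<eta>"
  have sp: "\<beta> (1 + \<eta>) = \<beta> 1 + \<eta> * sp" and sm: "\<beta> (1 - \<eta>) = \<beta> 1 - \<eta> * sm"
    using \<eta> by (auto simp: sp_def sm_def)
  have comb: "(1 - \<theta>) * \<beta> x + \<theta> * \<beta> y \<le> \<beta> ((1 - \<theta>) * x + \<theta> * y)" if "0 \<le> \<theta>" "\<theta> \<le> 1" "0 < x" "0 < y" for \<theta> x y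
    using concave_onD[OF conc that(1,2), of x y] that by simp
  have err: "slope_error \<beta> b \<eta> = \<bar>sp - b\<bar> + \<bar>sm - b\<bar>" by (simp add: slope_error_def sp_def sm_def)
  have outer: "t * sp \<le> \<beta> (1 + t) - \<beta> 1" "\<beta> (1 + t) - \<beta> 1 \<le> t * sm" if "0 \<le> t"
  proof -
    have "(1 - t / \<eta>) * \<beta> 1 + t / \<eta> * \<beta> (1 + \<eta>) \<le> \<beta> ((1 - t / \<eta>) * 1 + t / \<eta> * (1 + \<eta>))"
      using that t \<eta> by (intro comb) auto
    also have "(1 - t / \<eta>) * 1 + t / \<eta> * (1 + \<eta>) = 1 + t" using \<eta> by (simp add: field_simps)
    also have "(1 - t / \<eta>) * \<beta> 1 + t / \<eta> * \<beta> (1 + \<eta>) = \<beta> 1 + t * sp" using \<eta> by (simp add: sp field_simps)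
    finally show "t * sp \<le> \<beta> (1 + t) - \<beta> 1" by simp
    \<comment> \<open>This \<open>\<theta>\<close> writes \<open>1\<close> as a convex combination
      of \<open>1 - \<eta>\<close> and \<open>1 + t\<close>.\<close>
    define \<theta> where "\<theta> = \<eta> / (t + \<eta>)"
    have \<theta>: "0 \<le> \<theta>" "\<theta> \<le> 1" "0 < \<theta>" "(1 - \<theta>) * \<eta> = \<theta> * t" using that \<eta> by (auto simp: \<theta>_def field_simps)
    have "(1 - \<theta>) * \<beta> (1 - \<eta>) + \<theta> * \<beta> (1 + t) \<le> \<beta> ((1 - \<theta>) * (1 - \<eta>) + \<theta> * (1 + t))"
      using that t \<eta> \<theta> by (intro comb) auto
    also have "(1 - \<theta>) * (1 - \<eta>) + \<theta> * (1 + t) = 1" using \<theta>(4) by (simp add: algebra_simps)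
    finally have "\<theta> * (\<beta> (1 + t) - \<beta> 1) \<le> ((1 - \<theta>) * \<eta>) * sm" by (simp add: sm algebra_simps)
    then have "\<theta> * (\<beta> (1 + t) - \<beta> 1) \<le> \<theta> * (t * sm)" by (simp add: \<theta>(4) mult.assoc)
    then show "\<beta> (1 + t) - \<beta> 1 \<le> t * sm" using \<theta>(3) by (simp add: mult_le_cancel_left)
  qed
  have inner: "t * sm \<le> \<beta> (1 + t) - \<beta> 1" "\<beta> (1 + t) - \<beta> 1 \<le> t * sp" if "t \<le> 0"
  proof -
    have "(1 - (-t) / \<eta>) * \<beta> 1 + (-t) / \<eta> * \<beta> (1 - \<eta>) \<le> \<beta> ((1 - (-t) / \<eta>) * 1 + (-t) / \<eta> * (1 - \<eta>))"
      using that t \<eta> by (intro comb) (auto simp: field_simps)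
    also have "(1 - (-t) / \<eta>) * 1 + (-t) / \<eta> * (1 - \<eta>) = 1 + t" using \<eta> by (simp add: field_simps)
    also have "(1 - (-t) / \<eta>) * \<beta> 1 + (-t) / \<eta> * \<beta> (1 - \<eta>) = \<beta> 1 + t * sm" using \<eta> by (simp add: sm field_simps)
    finally show "t * sm \<le> \<beta> (1 + t) - \<beta> 1" by simp
    \<comment> \<open>The mirror image: \<open>1\<close> is now a convex combination of
      \<open>1 + \<eta>\<close> and \<open>1 + t\<close>.\<close>
    define \<theta> where "\<theta> = \<eta> / (\<eta> - t)"
    have \<theta>: "0 \<le> \<theta>" "\<theta> \<le> 1" "0 < \<theta>" "(1 - \<theta>) * \<eta> = - \<theta> * t" using that \<eta> by (auto simp: \<theta>_def field_simps)
    have "(1 - \<theta>) * \<beta> (1 + \<eta>) + \<theta> * \<beta> (1 + t) \<le> \<beta> ((1 - \<theta>) * (1 + \<eta>) + \<theta> * (1 + t))"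
      using that t \<eta> \<theta> by (intro comb) auto
    also have "(1 - \<theta>) * (1 + \<eta>) + \<theta> * (1 + t) = 1" using \<theta>(4) by (simp add: algebra_simps)
    finally have "\<theta> * (\<beta> (1 + t) - \<beta> 1) \<le> - (((1 - \<theta>) * \<eta>) * sp)" by (simp add: sp algebra_simps)
    then have "\<theta> * (\<beta> (1 + t) - \<beta> 1) \<le> \<theta> * (t * sp)" by (simp add: \<theta>(4) mult.assoc)
    then show "\<beta> (1 + t) - \<beta> 1 \<le> t * sp" using \<theta>(3) by (simp add: mult_le_cancel_left)
  qed
  have bnd: "\<bar>v\<bar> \<le> \<bar>p\<bar> + \<bar>q\<bar>" if "p \<le> v" "v \<le> q" for v p q :: real using that by linarith
  have "\<bar>\<beta> (1 + t) - \<beta> 1 - b * t\<bar> \<le> \<bar>t * (sp - b)\<bar> + \<bar>t * (sm - b)\<bar>"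
  proof (cases "0 \<le> t")
    case True
    show ?thesis by (rule bnd) (use outer[OF True] in \<open>auto simp: algebra_simps\<close>)
  next
    case False
    then have "t \<le> 0" by simp
    have "\<bar>\<beta> (1 + t) - \<beta> 1 - b * t\<bar> \<le> \<bar>t * (sm - b)\<bar> + \<bar>t * (sp - b)\<bar>"
      by (rule bnd) (use inner[OF \<open>t \<le> 0\<close>] in \<open>auto simp: algebra_simps\<close>)
    then show ?thesis by simp
  qed
  also have "\<dots> = \<bar>t\<bar> * slope_error \<beta> b \<eta>" by (simp add: err abs_mult distrib_left)
  finally show ?thesis .
qed

lemma slope_error_nonneg: "0 \<le> slope_error \<beta> b \<eta>"
  by (simp add: slope_error_def)

text \<open>If \<open>exp x\<close> is within \<open>\<eta>\<close> of \<open>1\<close>, concavity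
  applies, and \<open>exp x - 1\<close> is traded for \<open>x\<close> at quadratic cost. Otherwise
  \<open>|x| \<ge> \<eta> / 2\<close>, and the Lipschitz bound, linear in \<open>|x|\<close>, is
  itself at most a multiple of \<open>x^2 / \<eta>\<close>.\<close>

lemma concave_linearisation_exp:
  fixes \<beta> :: "real \<Rightarrow> real"
  assumes conc: "concave_on {0<..} \<beta>" and lip: "\<And>x. \<bar>\<beta> (exp x) - \<beta> 1\<bar> \<le> \<bar>x\<bar>"
    and \<eta>: "0 < \<eta>" "\<eta> \<le> 1/2" and b: "0 \<le> b" "b \<le> 1"
  shows "\<bar>\<beta> (exp x) - \<beta> 1 - b * x\<bar> \<le> 2 * \<bar>x\<bar> * slope_error \<beta> b \<eta> + 5 / \<eta> * x\<^sup>2"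
proof -
  define t where "t = exp x - 1"
  note se = slope_error_nonneg[of \<beta> b \<eta>]
  have "1 * x\<^sup>2 \<le> 5 / \<eta> * x\<^sup>2" using \<eta> by (intro mult_right_mono) (auto simp: field_simps)
  then have x2: "x\<^sup>2 \<le> 5 / \<eta> * x\<^sup>2" by simp
  show ?thesis
  proof (cases "\<bar>t\<bar> \<le> \<eta>")
    case True
    have "\<bar>ln (1 + t)\<bar> \<le> 2 * \<bar>t\<bar>" using True \<eta> by (intro abs_ln_one_plus_le) simp
    then have "\<bar>x\<bar> \<le> 1" using True \<eta> by (simp add: t_def)
    note ex = abs_exp_diff_one_le[OF this]
    have "\<bar>\<beta> (1 + t) - \<beta> 1 - b * t\<bar> \<le> \<bar>t\<bar> * slope_error \<beta> b \<eta>"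
      using \<eta> True by (intro concave_linearisation conc) auto
    also have "\<dots> \<le> 2 * \<bar>x\<bar> * slope_error \<beta> b \<eta>" using ex(2) se by (intro mult_right_mono) (auto simp: t_def)
    finally have 1: "\<bar>\<beta> (exp x) - \<beta> 1 - b * t\<bar> \<le> 2 * \<bar>x\<bar> * slope_error \<beta> b \<eta>" by (simp add: t_def)
    have "\<bar>b * t - b * x\<bar> = b * \<bar>t - x\<bar>" using b by (simp add: abs_mult flip: right_diff_distrib)
    also have "\<dots> \<le> 1 * x\<^sup>2" using ex(1) b by (intro mult_mono) (auto simp: t_def)
    finally show ?thesis using 1 x2 by linarith
  next
    case False
    have "\<eta> / 2 \<le> \<bar>x\<bar>"
    proof (cases "\<bar>x\<bar> \<le> 1")
      case True
      then show ?thesis using abs_exp_diff_one_le(2)[OF True] False by (simp add: t_def)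
    qed (use \<eta> in simp)
    then have "\<bar>x\<bar> * (\<eta> / 2) \<le> \<bar>x\<bar> * \<bar>x\<bar>" by (intro mult_left_mono) auto
    then have "2 * \<bar>x\<bar> \<le> 4 / \<eta> * x\<^sup>2" using \<eta> by (simp add: field_simps power2_eq_square flip: abs_mult)
    also have "\<dots> \<le> 5 / \<eta> * x\<^sup>2" using \<eta> by (intro mult_right_mono divide_right_mono) auto
    finally have 2: "2 * \<bar>x\<bar> \<le> 5 / \<eta> * x\<^sup>2" .
    have "\<bar>b * x\<bar> \<le> 1 * \<bar>x\<bar>" unfolding abs_mult using b by (intro mult_right_mono) auto
    then have "\<bar>\<beta> (exp x) - \<beta> 1 - b * x\<bar> \<le> 2 * \<bar>x\<bar>" using lip[of x] by linarith
    moreover have "0 \<le> 2 * \<bar>x\<bar> * slope_error \<beta> b \<eta>" using se by simp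
    ultimately show ?thesis using 2 by linarith
  qed
qed

context target begin

lemma acc_integrable:
  assumes "r > 0"
  shows "integrable (PiM J (\<lambda>_. std_normal)) (\<lambda>\<xi>. min 1 (r * exp (\<Sum>j\<in>J. u (z j + \<sigma> * \<xi> j) - u (z j))))"
  using assms by (intro integrable_min_exp prob_PiM_std) measurable

text \<open>For fixed noise the integrand \<open>min 1 (r * w)\<close> is a minimum of two affine
  functions of \<open>r\<close>, and averaging keeps concavity.\<close>

lemma acc_concave: "concave_on {0<..} (acc J \<sigma> z)"
  unfolding concave_on_iff
proof (intro conjI ballI allI impI)
  fix x y a b :: real
  assume xy: "x \<in> {0<..}" "y \<in> {0<..}" and ab: "0 \<le> a" "0 \<le> b" "a + b = 1"
  let ?w = "\<lambda>\<xi>. exp (\<Sum>j\<in>J. u (z j + \<sigma> * \<xi> j) - u (z j))"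
  have pos: "a * x + b * y > 0" using xy ab by (cases "a = 0") (auto intro: add_pos_nonneg)
  have "a * acc J \<sigma> z x + b * acc J \<sigma> z y = (\<integral>\<xi>. a * min 1 (x * ?w \<xi>) + b * min 1 (y * ?w \<xi>) \<partial>PiM J (\<lambda>_. std_normal))"
    unfolding acc_def using xy by (simp add: acc_integrable)
  also have "\<dots> \<le> (\<integral>\<xi>. min 1 ((a * x + b * y) * ?w \<xi>) \<partial>PiM J (\<lambda>_. std_normal))"
  proof (rule integral_mono)
    fix \<xi>
    have "a * min 1 (x * ?w \<xi>) + b * min 1 (y * ?w \<xi>) \<le> a * 1 + b * 1"
      using ab by (intro add_mono mult_left_mono) auto
    moreover have "a * min 1 (x * ?w \<xi>) + b * min 1 (y * ?w \<xi>) \<le> a * (x * ?w \<xi>) + b * (y * ?w \<xi>)"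
      using ab by (intro add_mono mult_left_mono) auto
    ultimately show "a * min 1 (x * ?w \<xi>) + b * min 1 (y * ?w \<xi>) \<le> min 1 ((a * x + b * y) * ?w \<xi>)"
      using ab by (simp add: algebra_simps)
  qed (use xy pos in \<open>auto intro!: acc_integrable\<close>)
  finally show "acc J \<sigma> z (a *\<^sub>R x + b *\<^sub>R y) \<ge> a * acc J \<sigma> z x + b * acc J \<sigma> z y"
    unfolding acc_def by simp
qed auto

lemma acc_exp_lipschitz: "\<bar>acc J \<sigma> z (exp x) - acc J \<sigma> z 1\<bar> \<le> \<bar>x\<bar>"
proof -
  interpret Q: prob_space "PiM J (\<lambda>_. std_normal)" by (rule prob_PiM_std)
  let ?w = "\<lambda>\<xi>. (\<Sum>j\<in>J. u (z j + \<sigma> * \<xi> j) - u (z j))"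
  have i: "integrable (PiM J (\<lambda>_. std_normal)) (\<lambda>\<xi>. min 1 (r * exp (?w \<xi>)))" if "r > 0" for r
    using that by (rule acc_integrable)
  have "\<bar>acc J \<sigma> z (exp x) - acc J \<sigma> z 1\<bar> = \<bar>\<integral>\<xi>. min 1 (exp x * exp (?w \<xi>)) - min 1 (1 * exp (?w \<xi>)) \<partial>PiM J (\<lambda>_. std_normal)\<bar>"
    unfolding acc_def using i[of "exp x"] i[of 1] by simp
  also have "\<dots> \<le> (\<integral>\<xi>. \<bar>min 1 (exp x * exp (?w \<xi>)) - min 1 (1 * exp (?w \<xi>))\<bar> \<partial>PiM J (\<lambda>_. std_normal))"
    by (rule integral_abs_bound)
  also have "\<dots> \<le> (\<integral>\<xi>. \<bar>x\<bar> \<partial>PiM J (\<lambda>_. std_normal))"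
  proof (rule integral_mono)
    show "\<bar>min 1 (exp x * exp (?w \<xi>)) - min 1 (1 * exp (?w \<xi>))\<bar> \<le> \<bar>x\<bar>" for \<xi>
      using min_1_exp_lipschitz[of "x + ?w \<xi>" "?w \<xi>"] by (simp add: exp_add)
  qed (use i[of "exp x"] i[of 1] in auto)
  finally show ?thesis using Q.prob_space by simp
qed

end

lemma power_le_one_plus_power6: "\<bar>y\<bar> ^ j \<le> 1 + y ^ 6" if "j \<le> 6" for y :: real
proof -
  have e: "y ^ 6 = \<bar>y\<bar> ^ 6" by simp
  show ?thesis
  proof (cases "\<bar>y\<bar> \<le> 1")
    case True
    then have "\<bar>y\<bar> ^ j \<le> 1" by (simp add: power_le_one)
    then show ?thesis unfolding e using zero_le_power[of "\<bar>y\<bar>" 6] by linarith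
  next
    case False
    then have "\<bar>y\<bar> ^ j \<le> \<bar>y\<bar> ^ 6" using that by (intro power_increasing) auto
    then show ?thesis unfolding e by simp
  qed
qed

text \<open>\<open>U\<close> bounds the score only where \<open>\<phi>'\<close> does not vanish,
  which is where the drift \<open>u' * \<phi>'\<close> lives; the score itself may be
  unbounded.\<close>

locale test_function = target +
  fixes \<phi> \<phi>' \<phi>'' :: "real \<Rightarrow> real" and B B1 B2 L U :: real
  assumes \<phi>_deriv: "\<And>x. (\<phi> has_real_derivative \<phi>' x) (at x)"
    and \<phi>'_deriv: "\<And>x. (\<phi>' has_real_derivative \<phi>'' x) (at x)"
    and \<phi>''_lip: "\<And>x y. \<bar>\<phi>'' x - \<phi>'' y\<bar> \<le> L * \<bar>x - y\<bar>"
    and \<phi>_le: "\<And>x. \<bar>\<phi> x\<bar> \<le> B" and \<phi>'_le: "\<And>x. \<bar>\<phi>' x\<bar> \<le> B1" and \<phi>''_le: "\<And>x. \<bar>\<phi>'' x\<bar> \<le> B2"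
    and U: "\<And>x. \<phi>' x \<noteq> 0 \<Longrightarrow> \<bar>u' x\<bar> \<le> U" and U_nonneg: "0 \<le> U"
begin

lemma nonneg: "0 \<le> B1" "0 \<le> B2" "0 \<le> L"
  using order_trans[OF abs_ge_zero \<phi>'_le] order_trans[OF abs_ge_zero \<phi>''_le] order_trans[OF abs_ge_zero \<phi>''_lip[of 0 1]] by auto

lemma \<phi>_measurable[measurable]: "\<phi> \<in> borel_measurable borel" "\<phi>' \<in> borel_measurable borel" "\<phi>'' \<in> borel_measurable borel"
proof -
  show "\<phi> \<in> borel_measurable borel"
    by (rule borel_measurable_continuous_onI, rule DERIV_continuous_on, rule has_field_derivative_at_within, rule \<phi>_deriv)
  show "\<phi>' \<in> borel_measurable borel"
    by (rule borel_measurable_continuous_onI, rule DERIV_continuous_on, rule has_field_derivative_at_within, rule \<phi>'_deriv)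
  have "L-lipschitz_on UNIV \<phi>''" using \<phi>''_lip nonneg(3) by (intro lipschitz_onI) (auto simp: dist_real_def)
  then show "\<phi>'' \<in> borel_measurable borel"
    by (intro borel_measurable_continuous_onI lipschitz_on_continuous_on)
qed

lemma \<phi>_increment: "\<bar>\<phi> (x + t) - \<phi> x - \<phi>' x * t\<bar> \<le> B2 / 2 * t\<^sup>2"
  "\<bar>\<phi> (x + t) - \<phi> x - \<phi>' x * t - \<phi>'' x / 2 * t\<^sup>2\<bar> \<le> L * \<bar>t\<bar> ^ 3"
proof -
  obtain v where v: "\<bar>v - x\<bar> \<le> \<bar>t\<bar>" "\<phi> (x + t) = \<phi> x + \<phi>' x * t + \<phi>'' v / 2 * t\<^sup>2"
    using Taylor_second_order[OF \<phi>_deriv \<phi>'_deriv] by metis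
  have "\<bar>\<phi>'' v / 2 * t\<^sup>2\<bar> \<le> B2 / 2 * t\<^sup>2" using \<phi>''_le[of v] by (simp add: abs_mult mult_right_mono)
  then show "\<bar>\<phi> (x + t) - \<phi> x - \<phi>' x * t\<bar> \<le> B2 / 2 * t\<^sup>2" using v(2) by simp
  have "\<bar>\<phi>'' v - \<phi>'' x\<bar> \<le> L * \<bar>t\<bar>" using \<phi>''_lip[of v x] v(1) nonneg(3) by (meson mult_left_mono order_trans)
  then have "\<bar>\<phi>'' v - \<phi>'' x\<bar> / 2 * t\<^sup>2 \<le> (L * \<bar>t\<bar>) * t\<^sup>2"
    using nonneg(3) by (intro mult_right_mono) auto
  moreover have "(L * \<bar>t\<bar>) * t\<^sup>2 = L * \<bar>t\<bar> ^ 3"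
    by (simp add: power3_eq_cube power2_eq_square abs_mult_self_eq flip: power2_abs)
  moreover have "\<phi> (x + t) - \<phi> x - \<phi>' x * t - \<phi>'' x / 2 * t\<^sup>2 = (\<phi>'' v - \<phi>'' x) / 2 * t\<^sup>2"
    using v(2) by (simp add: field_simps)
  moreover have "\<bar>(\<phi>'' v - \<phi>'' x) / 2 * t\<^sup>2\<bar> = \<bar>\<phi>'' v - \<phi>'' x\<bar> / 2 * t\<^sup>2" by (simp add: abs_mult)
  ultimately show "\<bar>\<phi> (x + t) - \<phi> x - \<phi>' x * t - \<phi>'' x / 2 * t\<^sup>2\<bar> \<le> L * \<bar>t\<bar> ^ 3" by simp
qed

text \<open>Freezing the acceptance at \<open>\<beta> 1\<close> gives the diffusion terms. Its
  first-order change \<open>b * u' x * s\<close>, multiplied by the first-order increment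
  \<open>\<phi>' x * s\<close>, gives the drift. The bound collects terms of third and higher order
  in \<open>s\<close>, and one second-order term that carries \<open>slope_error\<close>.\<close>

lemma increment_expansion:
  fixes \<beta> :: "real \<Rightarrow> real"
  assumes conc: "concave_on {0<..} \<beta>" and lip: "\<And>x. \<bar>\<beta> (exp x) - \<beta> 1\<bar> \<le> \<bar>x\<bar>" and \<beta>1: "0 \<le> \<beta> 1" "\<beta> 1 \<le> 1"
    and \<eta>: "0 < \<eta>" "\<eta> \<le> 1/2" and b: "0 \<le> b" "b \<le> 1"
  shows "\<bar>(\<phi> (x + s) - \<phi> x) * \<beta> (exp (u (x + s) - u x)) - (\<beta> 1 * (\<phi>' x * s + \<phi>'' x / 2 * s\<^sup>2) + b * \<phi>' x * u' x * s\<^sup>2)\<bar> \<le>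
    L * \<bar>s\<bar> ^ 3 + B2 / 2 * (\<bar>u' x\<bar> * \<bar>s\<bar> ^ 3 + C / 2 * \<bar>s\<bar> ^ 4)
    + B1 * (2 * slope_error \<beta> b \<eta> * (U * \<bar>s\<bar>\<^sup>2 + C / 2 * \<bar>s\<bar> ^ 3) + 5 / \<eta> * (2 * U\<^sup>2 * \<bar>s\<bar> ^ 3 + C\<^sup>2 / 2 * \<bar>s\<bar> ^ 5))
    + B1 * (C / 2 * \<bar>s\<bar> ^ 3)"
proof -
  define a where "a = \<bar>s\<bar>"
  define \<delta> where "\<delta> = u (x + s) - u x"
  define \<Delta> where "\<Delta> = \<phi> (x + s) - \<phi> x"
  define S where "S = slope_error \<beta> b \<eta>"
  have S: "0 \<le> S" unfolding S_def by (rule slope_error_nonneg)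
  have a: "0 \<le> a" "s\<^sup>2 = a\<^sup>2" by (auto simp: a_def)
  have \<delta>1: "\<bar>\<delta> - u' x * s\<bar> \<le> C / 2 * a\<^sup>2" using u_increment[of x s] by (simp add: \<delta>_def a)
  have \<delta>2: "\<bar>\<delta>\<bar> \<le> \<bar>u' x\<bar> * a + C / 2 * a\<^sup>2"
  proof -
    have "\<bar>u' x * s\<bar> = \<bar>u' x\<bar> * a" by (simp add: abs_mult a_def)
    then show ?thesis using \<delta>1 by linarith
  qed
  have t1: "\<bar>\<beta> 1 * (\<Delta> - \<phi>' x * s - \<phi>'' x / 2 * s\<^sup>2)\<bar> \<le> L * a ^ 3"
  proof -
    have "\<bar>\<beta> 1 * (\<Delta> - \<phi>' x * s - \<phi>'' x / 2 * s\<^sup>2)\<bar> \<le> 1 * (L * a ^ 3)"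
      unfolding abs_mult using \<beta>1 \<phi>_increment(2)[of x s] by (intro mult_mono) (auto simp: \<Delta>_def a_def)
    then show ?thesis by simp
  qed
  have t2: "\<bar>(\<Delta> - \<phi>' x * s) * (\<beta> (exp \<delta>) - \<beta> 1)\<bar> \<le> B2 / 2 * (\<bar>u' x\<bar> * a ^ 3 + C / 2 * a ^ 4)"
  proof -
    have "\<bar>(\<Delta> - \<phi>' x * s) * (\<beta> (exp \<delta>) - \<beta> 1)\<bar> \<le> (B2 / 2 * a\<^sup>2) * (\<bar>u' x\<bar> * a + C / 2 * a\<^sup>2)"
      unfolding abs_mult using \<phi>_increment(1)[of x s] order_trans[OF lip \<delta>2] nonneg
      by (intro mult_mono) (auto simp: \<Delta>_def a)
    also have "\<dots> = B2 / 2 * (\<bar>u' x\<bar> * a ^ 3 + C / 2 * a ^ 4)"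
      by (simp add: algebra_simps power2_eq_square power3_eq_cube power4_eq_xxxx)
    finally show ?thesis .
  qed
  have t34: "\<bar>\<phi>' x * s * (\<beta> (exp \<delta>) - \<beta> 1 - b * \<delta>)\<bar> + \<bar>b * \<phi>' x * s * (\<delta> - u' x * s)\<bar> \<le>
     B1 * (2 * S * (U * a\<^sup>2 + C / 2 * a ^ 3) + 5 / \<eta> * (2 * U\<^sup>2 * a ^ 3 + C\<^sup>2 / 2 * a ^ 5)) + B1 * (C / 2 * a ^ 3)"
  \<comment> \<open>\<open>U\<close> bounds the score only where \<open>\<phi>' x\<close> is
    nonzero; elsewhere both terms vanish.\<close>
  proof (cases "\<phi>' x = 0")
    case True
    have "0 \<le> B1 * (2 * S * (U * a\<^sup>2 + C / 2 * a ^ 3) + 5 / \<eta> * (2 * U\<^sup>2 * a ^ 3 + C\<^sup>2 / 2 * a ^ 5)) + B1 * (C / 2 * a ^ 3)"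
      using nonneg S U_nonneg a(1) C_nonneg \<eta> by (intro add_nonneg_nonneg mult_nonneg_nonneg) auto
    then show ?thesis using True by simp
  next
    case False
    have \<delta>3: "\<bar>\<delta>\<bar> \<le> U * a + C / 2 * a\<^sup>2" using \<delta>2 mult_right_mono[OF U[OF False] a(1)] by linarith
    have \<delta>4: "\<delta>\<^sup>2 \<le> 2 * U\<^sup>2 * a\<^sup>2 + C\<^sup>2 / 2 * a ^ 4"
    proof -
      have "\<delta>\<^sup>2 \<le> (U * a + C / 2 * a\<^sup>2)\<^sup>2" using \<delta>3 by (metis abs_ge_zero power2_abs power_mono)
      also have "\<dots> \<le> 2 * (U * a)\<^sup>2 + 2 * (C / 2 * a\<^sup>2)\<^sup>2"
        using zero_le_power2[of "U * a - C / 2 * a\<^sup>2"] by (simp add: power2_sum power2_diff)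
      also have "\<dots> = 2 * U\<^sup>2 * a\<^sup>2 + C\<^sup>2 / 2 * a ^ 4"
        by (simp add: power_mult_distrib power_divide flip: power_mult)
      finally show ?thesis .
    qed
    have "\<bar>\<beta> (exp \<delta>) - \<beta> 1 - b * \<delta>\<bar> \<le> 2 * \<bar>\<delta>\<bar> * S + 5 / \<eta> * \<delta>\<^sup>2"
      unfolding S_def by (rule concave_linearisation_exp[OF conc lip \<eta> b])
    also have "\<dots> \<le> 2 * (U * a + C / 2 * a\<^sup>2) * S + 5 / \<eta> * (2 * U\<^sup>2 * a\<^sup>2 + C\<^sup>2 / 2 * a ^ 4)"
      using \<delta>3 \<delta>4 S \<eta> by (intro add_mono mult_right_mono mult_left_mono) auto
    finally have lin: "\<bar>\<beta> (exp \<delta>) - \<beta> 1 - b * \<delta>\<bar> \<le> \<dots>" .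
    have pa: "\<bar>\<phi>' x * s\<bar> \<le> B1 * a" unfolding abs_mult a_def using \<phi>'_le[of x] by (intro mult_right_mono) auto
    have "\<bar>\<phi>' x * s * (\<beta> (exp \<delta>) - \<beta> 1 - b * \<delta>)\<bar> \<le> (B1 * a) * (2 * (U * a + C / 2 * a\<^sup>2) * S + 5 / \<eta> * (2 * U\<^sup>2 * a\<^sup>2 + C\<^sup>2 / 2 * a ^ 4))"
      unfolding abs_mult[of "\<phi>' x * s"] using pa lin nonneg a by (intro mult_mono) auto
    also have "\<dots> = B1 * (2 * S * (U * a\<^sup>2 + C / 2 * a ^ 3) + 5 / \<eta> * (2 * U\<^sup>2 * a ^ 3 + C\<^sup>2 / 2 * a ^ 5))"
    proof -
      have p: "a\<^sup>2 = a * a" "a ^ 3 = a * a * a" "a ^ 4 = a * a * a * a" "a ^ 5 = a * a * a * a * a"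
        by (simp_all add: numeral_eq_Suc)
      show ?thesis unfolding p by (simp add: algebra_simps)
    qed
    finally have 3: "\<bar>\<phi>' x * s * (\<beta> (exp \<delta>) - \<beta> 1 - b * \<delta>)\<bar> \<le> \<dots>" .
    have "\<bar>b * \<phi>' x * s * (\<delta> - u' x * s)\<bar> = \<bar>b\<bar> * (\<bar>\<phi>' x * s\<bar> * \<bar>\<delta> - u' x * s\<bar>)"
      by (simp add: abs_mult)
    also have "\<dots> \<le> 1 * ((B1 * a) * (C / 2 * a\<^sup>2))"
      using b pa \<delta>1 nonneg a by (intro mult_mono) auto
    also have "\<dots> = B1 * (C / 2 * a ^ 3)" by (simp add: power2_eq_square power3_eq_cube)
    finally have 4: "\<bar>b * \<phi>' x * s * (\<delta> - u' x * s)\<bar> \<le> B1 * (C / 2 * a ^ 3)" .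
    show ?thesis using 3 4 by (rule add_mono)
  qed
  have decomp: "\<Delta> * \<beta> (exp \<delta>) - (\<beta> 1 * (\<phi>' x * s + \<phi>'' x / 2 * s\<^sup>2) + b * \<phi>' x * u' x * s\<^sup>2) =
     \<beta> 1 * (\<Delta> - \<phi>' x * s - \<phi>'' x / 2 * s\<^sup>2) + (\<Delta> - \<phi>' x * s) * (\<beta> (exp \<delta>) - \<beta> 1)
     + \<phi>' x * s * (\<beta> (exp \<delta>) - \<beta> 1 - b * \<delta>) + b * \<phi>' x * s * (\<delta> - u' x * s)"
    by (simp add: algebra_simps power2_eq_square)
  show ?thesis
    unfolding \<Delta>_def[symmetric] \<delta>_def[symmetric] a_def[symmetric] S_def[symmetric] decomp
    using t1 t2 t34 by linarith
qed

text \<open>\<open>16\<close> is the integral of the weight \<open>1 + y^6\<close> under the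
  standard normal, and \<open>(1 + l)^2\<close> absorbs surplus powers of
  \<open>\<sigma> \<le> l\<close>. What matters is that nothing here depends on the dimension, on
  \<open>\<eta>\<close> or on the state.\<close>

definition generator_const :: "real \<Rightarrow> real" where
  "generator_const l = 16 * l\<^sup>2 * (1 + l)\<^sup>2 * (L + B2 / 2 * (1 + C / 2) + B1 * 5 * (2 * U\<^sup>2 + C\<^sup>2 / 2) + B1 * (C / 2) + 2 * B1 * (U + C / 2)) + l\<^sup>2 / 2 * B2"

text \<open>Integration kills the odd term, and \<open>k * \<sigma>^2 = l^2\<close> normalises the
  quadratic ones. With slope \<open>g / 2\<close> the drift receives the same factor
  \<open>l^2 / 2 * g\<close> as the second derivative, which makes the limit the reversible
  generator for \<open>h\<close>.\<close>

lemma generator_expansion: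
  fixes \<beta> :: "real \<Rightarrow> real"
  assumes conc: "concave_on {0<..} \<beta>" and lip: "\<And>x. \<bar>\<beta> (exp x) - \<beta> 1\<bar> \<le> \<bar>x\<bar>"
    and \<beta>01: "\<And>r. 0 < r \<Longrightarrow> 0 \<le> \<beta> r" "\<And>r. 0 < r \<Longrightarrow> \<beta> r \<le> 1"
    and \<beta>m[measurable]: "(\<lambda>x. \<beta> (exp x)) \<in> borel_measurable borel"
    and \<eta>: "0 < \<eta>" "\<eta> \<le> 1/2" and g: "0 \<le> g" "g \<le> 1"
    and \<sigma>: "0 < \<sigma>" "\<sigma> \<le> l" and k: "k * \<sigma>\<^sup>2 = l\<^sup>2" and l: "0 < l"
  shows "\<bar>k * (\<integral>y. (\<phi> (x + \<sigma> * y) - \<phi> x) * \<beta> (exp (u (x + \<sigma> * y) - u x)) \<partial>std_normal) - l\<^sup>2 / 2 * g * (\<phi>'' x + u' x * \<phi>' x)\<bar>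
    \<le> generator_const l * ((1 + \<bar>u' x\<bar>) * \<sigma> / \<eta> + slope_error \<beta> (g / 2) \<eta> + \<bar>\<beta> 1 - g\<bar>)"
proof -
  interpret N: prob_space std_normal by simp
  define S where "S = slope_error \<beta> (g / 2) \<eta>"
  have S: "0 \<le> S" unfolding S_def by (rule slope_error_nonneg)
  \<comment> \<open>One weight dominates all powers up to the sixth; its Gaussian mean is
    \<open>1 + 15\<close>.\<close>
  define m where "m y = 1 + y ^ 6" for y :: real
  have m_int: "integrable std_normal m" unfolding m_def by simp
  have m16: "(\<integral>y. m y \<partial>std_normal) = 16"
    unfolding m_def using N.prob_space integral_std_normal_moment_even[of 3]
    by (simp add: integral_std_normal_eq fact_numeral)
  have m1: "1 \<le> m y" for y by (simp add: m_def)
  define A where "A = L + B2 / 2 * (\<bar>u' x\<bar> + C / 2) + B1 * (5 / \<eta> * (2 * U\<^sup>2 + C\<^sup>2 / 2)) + B1 * (C / 2)"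
  define A' where "A' = B1 * (2 * S * (U + C / 2))"
  have A0: "0 \<le> A" unfolding A_def using nonneg C_nonneg \<eta> by (intro add_nonneg_nonneg mult_nonneg_nonneg) auto
  have A'0: "0 \<le> A'" unfolding A'_def using nonneg C_nonneg S U_nonneg by (intro mult_nonneg_nonneg add_nonneg_nonneg) auto
  \<comment> \<open>After multiplication by \<open>k\<close>, \<open>X\<close> becomes
    \<open>l^2 * \<sigma> * (1 + l)^2\<close> and is small with \<open>\<sigma>\<close>;
    \<open>Y\<close> keeps order \<open>1\<close>, but it occurs only together with the slope error
    \<open>S\<close>, through \<open>A'\<close>.\<close>
  define X where "X = \<sigma> ^ 3 * (1 + l)\<^sup>2"
  define Y where "Y = \<sigma>\<^sup>2 * (1 + l)"
  have l1: "1 \<le> (1 + l)\<^sup>2" "1 + l \<le> (1 + l)\<^sup>2" using l by (auto simp: power2_eq_square algebra_simps)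
  have Xm: "\<bar>\<sigma> * y\<bar> ^ j \<le> X * m y" if "3 \<le> j" "j \<le> 5" for j y
  proof -
    have "\<sigma> ^ (j - 3) \<le> (1 + l) ^ (j - 3)" using \<sigma> by (intro power_mono) auto
    also have "\<dots> \<le> (1 + l)\<^sup>2" using l that by (intro power_increasing) auto
    finally have "\<sigma> ^ 3 * \<sigma> ^ (j - 3) \<le> X" unfolding X_def using \<sigma> by (intro mult_left_mono) auto
    moreover have "\<sigma> ^ j = \<sigma> ^ 3 * \<sigma> ^ (j - 3)" using that by (simp only: power_add[symmetric] le_add_diff_inverse)
    ultimately have "\<sigma> ^ j \<le> X" by simp
    moreover have "\<bar>y\<bar> ^ j \<le> m y" unfolding m_def using that by (intro power_le_one_plus_power6) auto
    ultimately have "\<sigma> ^ j * \<bar>y\<bar> ^ j \<le> X * m y" using \<sigma> by (intro mult_mono) (auto simp: X_def)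
    then show ?thesis using \<sigma> by (simp add: abs_mult power_mult_distrib)
  qed
  have Ym: "\<bar>\<sigma> * y\<bar> ^ j \<le> Y * m y" if "2 \<le> j" "j \<le> 3" for j y
  proof -
    have "\<sigma> ^ (j - 2) \<le> (1 + l) ^ (j - 2)" using \<sigma> by (intro power_mono) auto
    also have "\<dots> \<le> (1 + l) ^ 1" using l that by (intro power_increasing) auto
    finally have "\<sigma>\<^sup>2 * \<sigma> ^ (j - 2) \<le> Y" unfolding Y_def using \<sigma> by (intro mult_left_mono) auto
    moreover have "\<sigma> ^ j = \<sigma>\<^sup>2 * \<sigma> ^ (j - 2)" using that by (simp only: power_add[symmetric] le_add_diff_inverse)
    ultimately have "\<sigma> ^ j \<le> Y" by simp
    moreover have "\<bar>y\<bar> ^ j \<le> m y" unfolding m_def using that by (intro power_le_one_plus_power6) auto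
    ultimately have "\<sigma> ^ j * \<bar>y\<bar> ^ j \<le> Y * m y" using \<sigma> l by (intro mult_mono) (auto simp: Y_def)
    then show ?thesis using \<sigma> by (simp add: abs_mult power_mult_distrib)
  qed
  define G where "G y = (\<phi> (x + \<sigma> * y) - \<phi> x) * \<beta> (exp (u (x + \<sigma> * y) - u x))" for y
  define H where "H y = \<beta> 1 * (\<phi>' x * (\<sigma> * y) + \<phi>'' x / 2 * (\<sigma> * y)\<^sup>2) + g / 2 * \<phi>' x * u' x * (\<sigma> * y)\<^sup>2" for y
  have GH: "\<bar>G y - H y\<bar> \<le> (A * X + A' * Y) * m y" for y
  proof -
    have "\<bar>G y - H y\<bar> \<le> L * \<bar>\<sigma> * y\<bar> ^ 3 + B2 / 2 * (\<bar>u' x\<bar> * \<bar>\<sigma> * y\<bar> ^ 3 + C / 2 * \<bar>\<sigma> * y\<bar> ^ 4)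
      + B1 * (2 * S * (U * \<bar>\<sigma> * y\<bar>\<^sup>2 + C / 2 * \<bar>\<sigma> * y\<bar> ^ 3) + 5 / \<eta> * (2 * U\<^sup>2 * \<bar>\<sigma> * y\<bar> ^ 3 + C\<^sup>2 / 2 * \<bar>\<sigma> * y\<bar> ^ 5))
      + B1 * (C / 2 * \<bar>\<sigma> * y\<bar> ^ 3)"
      unfolding G_def H_def S_def using \<beta>01[of 1] g by (intro increment_expansion conc lip \<eta>) auto
    also have "\<dots> \<le> L * (X * m y) + B2 / 2 * (\<bar>u' x\<bar> * (X * m y) + C / 2 * (X * m y))
      + B1 * (2 * S * (U * (Y * m y) + C / 2 * (Y * m y)) + 5 / \<eta> * (2 * U\<^sup>2 * (X * m y) + C\<^sup>2 / 2 * (X * m y)))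
      + B1 * (C / 2 * (X * m y))"
      using nonneg C_nonneg \<eta> S U_nonneg by (intro add_mono mult_left_mono Xm Ym) auto
    also have "\<dots> = (A * X + A' * Y) * m y" by (simp add: A_def A'_def algebra_simps)
    finally show ?thesis .
  qed
  have H_int: "integrable std_normal H" "(\<integral>y. H y \<partial>std_normal) = \<sigma>\<^sup>2 * (\<beta> 1 * \<phi>'' x / 2 + g / 2 * \<phi>' x * u' x)"
  proof -
    have eq: "H = (\<lambda>y. (\<beta> 1 * \<phi>' x * \<sigma>) * y + (\<sigma>\<^sup>2 * (\<beta> 1 * \<phi>'' x / 2 + g / 2 * \<phi>' x * u' x)) * y\<^sup>2)"
      by (rule ext) (simp add: H_def power_mult_distrib algebra_simps)
    have i: "integrable std_normal (\<lambda>y. y)" using integrable_std_normal_power(1)[of 1] by simp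
    show "integrable std_normal H" unfolding eq using i by simp
    show "(\<integral>y. H y \<partial>std_normal) = \<sigma>\<^sup>2 * (\<beta> 1 * \<phi>'' x / 2 + g / 2 * \<phi>' x * u' x)"
      unfolding eq using i by (simp add: integral_std_normal_moments)
  qed
  have G_int: "integrable std_normal G"
  proof (rule N.integrable_const_bound[where B="(2 * B) * 1"])
    show "AE y in std_normal. norm (G y) \<le> (2 * B) * 1"
    proof (rule AE_I2)
      fix y
      have "\<bar>\<phi> (x + \<sigma> * y) - \<phi> x\<bar> \<le> 2 * B" using \<phi>_le[of "x + \<sigma> * y"] \<phi>_le[of x] by linarith
      then show "norm (G y) \<le> (2 * B) * 1"
        unfolding G_def real_norm_def abs_mult using \<beta>01[of "exp (u (x + \<sigma> * y) - u x)"] by (intro mult_mono) auto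
    qed
    show "G \<in> borel_measurable std_normal" unfolding G_def[abs_def]
      using measurable_compose[OF _ \<beta>m, of "\<lambda>y. u (x + \<sigma> * y) - u x" std_normal] by measurable
  qed
  have kpos: "k > 0" using k \<sigma> l by (smt (verit) mult_nonneg_nonneg mult_nonpos_nonneg zero_less_power zero_le_power2)
  have "\<bar>(\<integral>y. G y \<partial>std_normal) - (\<integral>y. H y \<partial>std_normal)\<bar> = \<bar>\<integral>y. G y - H y \<partial>std_normal\<bar>"
    using G_int H_int by simp
  also have "\<dots> \<le> (\<integral>y. \<bar>G y - H y\<bar> \<partial>std_normal)" by (rule integral_abs_bound)
  also have "\<dots> \<le> (\<integral>y. (A * X + A' * Y) * m y \<partial>std_normal)"
    using G_int H_int m_int GH by (intro integral_mono) auto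
  also have "\<dots> = (A * X + A' * Y) * 16" using m16 by simp
  finally have "k * \<bar>(\<integral>y. G y \<partial>std_normal) - (\<integral>y. H y \<partial>std_normal)\<bar> \<le> k * ((A * X + A' * Y) * 16)"
    using kpos by (intro mult_left_mono) auto
  also have "k * ((A * X + A' * Y) * 16) = 16 * l\<^sup>2 * (A * (\<sigma> * (1 + l)\<^sup>2) + A' * (1 + l))"
    unfolding X_def Y_def k[symmetric] by (simp add: algebra_simps power2_eq_square power3_eq_cube)
  finally have 1: "\<bar>k * (\<integral>y. G y \<partial>std_normal) - k * (\<integral>y. H y \<partial>std_normal)\<bar> \<le> 16 * l\<^sup>2 * (A * (\<sigma> * (1 + l)\<^sup>2) + A' * (1 + l))"
    using kpos by (simp add: abs_mult flip: right_diff_distrib)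
  have "k * (\<integral>y. H y \<partial>std_normal) - l\<^sup>2 / 2 * g * (\<phi>'' x + u' x * \<phi>' x) = l\<^sup>2 / 2 * \<phi>'' x * (\<beta> 1 - g)"
  proof -
    have "k * (\<integral>y. H y \<partial>std_normal) = l\<^sup>2 * (\<beta> 1 * \<phi>'' x / 2 + g / 2 * \<phi>' x * u' x)"
      unfolding H_int(2) k[symmetric] by simp
    then show ?thesis by (simp add: algebra_simps)
  qed
  moreover have "\<bar>l\<^sup>2 / 2 * \<phi>'' x * (\<beta> 1 - g)\<bar> \<le> l\<^sup>2 / 2 * B2 * \<bar>\<beta> 1 - g\<bar>"
    unfolding abs_mult using \<phi>''_le[of x] by (intro mult_right_mono mult_mono) auto
  ultimately have 2: "\<bar>k * (\<integral>y. H y \<partial>std_normal) - l\<^sup>2 / 2 * g * (\<phi>'' x + u' x * \<phi>' x)\<bar> \<le> l\<^sup>2 / 2 * B2 * \<bar>\<beta> 1 - g\<bar>" by (simp only:)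
  define W where "W = (1 + \<bar>u' x\<bar>) * \<sigma> / \<eta>"
  define E where "E = L + B2 / 2 * (1 + C / 2) + B1 * 5 * (2 * U\<^sup>2 + C\<^sup>2 / 2) + B1 * (C / 2)"
  have E0: "0 \<le> E" unfolding E_def using nonneg C_nonneg by (intro add_nonneg_nonneg mult_nonneg_nonneg) auto
  \<comment> \<open>\<open>w\<close> is a common majorant of \<open>1\<close>, \<open>|u' x|\<close>
    and \<open>1 / \<eta>\<close>, so each summand of \<open>A\<close> is at most its coefficient
    times \<open>w\<close>.\<close>
  define w where "w = (1 + \<bar>u' x\<bar>) / \<eta>"
  have u1: "1 \<le> 1 + \<bar>u' x\<bar>" "\<bar>u' x\<bar> \<le> 1 + \<bar>u' x\<bar>" by auto
  have "1 + \<bar>u' x\<bar> \<le> w" using mult_left_mono[of 1 "1 / \<eta>" "1 + \<bar>u' x\<bar>"] \<eta> by (simp add: w_def)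
  moreover have "1 / \<eta> \<le> w" unfolding w_def using u1(1) \<eta> by (intro divide_right_mono) auto
  ultimately have w1: "1 \<le> w" "\<bar>u' x\<bar> \<le> w" "1 / \<eta> \<le> w" using u1 by linarith+
  have "A \<le> L * w + B2 / 2 * (w + C / 2 * w) + B1 * (5 * (2 * U\<^sup>2 + C\<^sup>2 / 2) * w) + B1 * (C / 2) * w"
  proof -
    have i: "c \<le> c * w" if "0 \<le> c" for c using mult_left_mono[OF w1(1) that] by simp
    have ii: "5 / \<eta> * c \<le> 5 * c * w" if "0 \<le> c" for c
      using mult_left_mono[OF w1(3), of "5 * c"] that by (simp add: field_simps)
    show ?thesis
      unfolding A_def using nonneg C_nonneg w1(2)
      by (intro add_mono mult_left_mono i ii mult_nonneg_nonneg) auto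
  qed
  also have "\<dots> = E * w" by (simp add: E_def algebra_simps)
  finally have "A * \<sigma> \<le> E * w * \<sigma>" using \<sigma> by (intro mult_right_mono) auto
  also have "E * w * \<sigma> = E * W" by (simp add: W_def w_def)
  finally have AW: "A * \<sigma> \<le> E * W" .
  define F where "F = 2 * B1 * (U + C / 2)"
  have F0: "0 \<le> F" unfolding F_def using nonneg C_nonneg U_nonneg by (intro mult_nonneg_nonneg) auto
  have A'F: "A' = F * S" by (simp add: A'_def F_def)
  have W0: "0 \<le> W" using \<sigma> \<eta> by (simp add: W_def)
  have "A * (\<sigma> * (1 + l)\<^sup>2) + A' * (1 + l) \<le> (E * W) * (1 + l)\<^sup>2 + (F * S) * (1 + l)\<^sup>2"
    unfolding A'F mult.assoc[symmetric, of A] using AW l1 F0 S by (intro add_mono mult_right_mono mult_left_mono) auto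
  also have "\<dots> \<le> (1 + l)\<^sup>2 * ((E + F) * (W + S))"
  proof -
    have "0 \<le> E * S + F * W" using E0 F0 S W0 by simp
    then have "(1 + l)\<^sup>2 * (E * W + F * S) \<le> (1 + l)\<^sup>2 * ((E + F) * (W + S))"
      by (intro mult_left_mono) (auto simp: algebra_simps)
    then show ?thesis by (simp add: algebra_simps)
  qed
  finally have "16 * l\<^sup>2 * (A * (\<sigma> * (1 + l)\<^sup>2) + A' * (1 + l)) \<le> 16 * l\<^sup>2 * ((1 + l)\<^sup>2 * ((E + F) * (W + S)))"
    by (intro mult_left_mono) auto
  with 1 2 have 3: "\<bar>k * (\<integral>y. G y \<partial>std_normal) - l\<^sup>2 / 2 * g * (\<phi>'' x + u' x * \<phi>' x)\<bar> \<le>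
     16 * l\<^sup>2 * ((1 + l)\<^sup>2 * ((E + F) * (W + S))) + l\<^sup>2 / 2 * B2 * \<bar>\<beta> 1 - g\<bar>" by linarith
  have generator_const: "generator_const l = 16 * l\<^sup>2 * (1 + l)\<^sup>2 * (E + F) + l\<^sup>2 / 2 * B2" by (simp add: generator_const_def E_def F_def)
  have "16 * l\<^sup>2 * ((1 + l)\<^sup>2 * ((E + F) * (W + S))) + l\<^sup>2 / 2 * B2 * \<bar>\<beta> 1 - g\<bar> \<le> generator_const l * (W + S + \<bar>\<beta> 1 - g\<bar>)"
  proof -
    define P where "P = 16 * l\<^sup>2 * (1 + l)\<^sup>2 * (E + F)"
    define Q where "Q = l\<^sup>2 / 2 * B2"
    have "0 \<le> P" "0 \<le> Q" unfolding P_def Q_def using E0 F0 nonneg by auto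
    then have "P * (W + S) + Q * \<bar>\<beta> 1 - g\<bar> \<le> (P + Q) * (W + S + \<bar>\<beta> 1 - g\<bar>)"
      using W0 S by (simp add: algebra_simps)
    then show ?thesis unfolding generator_const P_def Q_def by (simp add: mult.assoc)
  qed
  with 3 show ?thesis unfolding G_def W_def S_def by linarith
qed

end

text \<open>Both one-sided slopes of \<open>gauss_acc \<tau>\<close> at \<open>1\<close> converge to
  half its value there. The \<open>\<eta>\<close> comes from the limit function alone, so one choice
  serves all dimensions.\<close>

lemma gauss_acc_slope_error:
  assumes \<tau>: "\<tau> > 0" and \<epsilon>: "\<epsilon> > 0"
  obtains \<eta> where "0 < \<eta>" "\<eta> \<le> 1/2" "slope_error (gauss_acc \<tau>) (gauss_acc \<tau> 1 / 2) \<eta> < \<epsilon>"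
proof -
  define \<eta> where "\<eta> n = 1 / (real n + 2)" for n
  have \<eta>: "\<eta> \<longlonglongrightarrow> 0" "\<And>n. 0 < \<eta> n" "\<And>n. \<eta> n \<le> 1/2"
    unfolding \<eta>_def by (real_asymp, auto simp: field_simps)
  then have \<eta>': "(\<lambda>n. - \<eta> n) \<longlonglongrightarrow> 0" using tendsto_minus[OF \<eta>(1)] by simp
  let ?b = "gauss_acc \<tau> 1 / 2"
  have 1: "(\<lambda>n. (gauss_acc \<tau> (1 + \<eta> n) - gauss_acc \<tau> 1) / \<eta> n) \<longlonglongrightarrow> ?b"
    using \<eta>(2,3) by (intro gauss_acc_slope \<tau> \<eta>(1)) (auto simp: less_imp_neq[THEN not_sym] abs_of_pos)
  have 2: "(\<lambda>n. (gauss_acc \<tau> (1 + - \<eta> n) - gauss_acc \<tau> 1) / - \<eta> n) \<longlonglongrightarrow> ?b"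
    using \<eta>(2,3) by (intro gauss_acc_slope \<tau> \<eta>') (auto simp: less_imp_neq[THEN not_sym] abs_of_pos)
  have "(\<lambda>n. \<bar>(gauss_acc \<tau> (1 + \<eta> n) - gauss_acc \<tau> 1) / \<eta> n - ?b\<bar> + \<bar>(gauss_acc \<tau> (1 + - \<eta> n) - gauss_acc \<tau> 1) / - \<eta> n - ?b\<bar>)
     \<longlonglongrightarrow> \<bar>?b - ?b\<bar> + \<bar>?b - ?b\<bar>"
    by (intro tendsto_intros 1 2)
  then have "(\<lambda>n. slope_error (gauss_acc \<tau>) ?b (\<eta> n)) \<longlonglongrightarrow> 0"
    unfolding slope_error_def by (simp add: minus_divide_right[symmetric] minus_divide_left)
  from order_tendstoD(2)[OF this \<epsilon>] obtain n where "slope_error (gauss_acc \<tau>) ?b (\<eta> n) < \<epsilon>"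
    by (auto simp: eventually_sequentially)
  then show ?thesis using that \<eta>(2,3) by blast
qed

text \<open>Each of the two chord slopes involves two values, each off by at most \<open>E\<close>.
  The division by \<open>\<eta>\<close> does no harm because \<open>\<eta>\<close> stays fixed while
  \<open>E\<close> tends to \<open>0\<close>.\<close>

lemma slope_error_approx:
  assumes \<eta>: "0 < \<eta>" and E: "\<bar>\<beta> (1 + \<eta>) - \<gamma> (1 + \<eta>)\<bar> \<le> E" "\<bar>\<beta> 1 - \<gamma> 1\<bar> \<le> E" "\<bar>\<beta> (1 - \<eta>) - \<gamma> (1 - \<eta>)\<bar> \<le> E"
  shows "slope_error \<beta> b \<eta> \<le> slope_error \<gamma> b \<eta> + 4 * E / \<eta>"
proof -
  have *: "\<bar>p / \<eta> - b\<bar> \<le> \<bar>q / \<eta> - b\<bar> + 2 * E / \<eta>" if "\<bar>p - q\<bar> \<le> 2 * E" for p q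
  proof -
    have "\<bar>p / \<eta> - q / \<eta>\<bar> \<le> 2 * E / \<eta>" using that \<eta> by (simp add: divide_right_mono flip: diff_divide_distrib)
    then show ?thesis by linarith
  qed
  have "\<bar>(\<beta> (1 + \<eta>) - \<beta> 1) / \<eta> - b\<bar> \<le> \<bar>(\<gamma> (1 + \<eta>) - \<gamma> 1) / \<eta> - b\<bar> + 2 * E / \<eta>"
    using E by (intro *) linarith
  moreover have "\<bar>(\<beta> 1 - \<beta> (1 - \<eta>)) / \<eta> - b\<bar> \<le> \<bar>(\<gamma> 1 - \<gamma> (1 - \<eta>)) / \<eta> - b\<bar> + 2 * E / \<eta>"
    using E by (intro *) linarith
  ultimately show ?thesis unfolding slope_error_def by simp
qed

context test_function begin

lemma generator_const_nonneg: "0 < l \<Longrightarrow> 0 \<le> generator_const l"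
  unfolding generator_const_def using nonneg C_nonneg U_nonneg by (intro add_nonneg_nonneg mult_nonneg_nonneg) auto

text \<open>The order of choices matters: first \<open>\<eta>\<close>, from the Gaussian limit, so
  that the slope error costs less than \<open>\<epsilon> / 2\<close>; then \<open>d\<close>, so
  large that the terms with \<open>1 / \<eta>\<close> cost less than the other half.\<close>

lemma generator_tendsto:
  assumes l: "l > 0" and \<epsilon>: "\<epsilon> > 0"
  shows "\<forall>\<^sub>F d in sequentially. \<forall>i\<in>{1..d}.
    (\<integral>z. \<bar>real (d - 1) * (rwm_op d (l / sqrt (real (d - 1))) (\<lambda>z. \<phi> (z i)) z - \<phi> (z i))
       - l\<^sup>2 / 2 * gauss_acc (l * sqrt Fisher) 1 * (\<phi>'' (z i) + u' (z i) * \<phi>' (z i))\<bar> \<partial>\<pi> d) < \<epsilon>"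
proof -
  define \<tau> where "\<tau> = l * sqrt Fisher"
  have \<tau>: "\<tau> > 0" using l Fisher_pos by (simp add: \<tau>_def)
  define g where "g = gauss_acc \<tau> 1"
  have g: "0 \<le> g" "g \<le> 1" unfolding g_def gauss_acc_def by (intro integral_min_exp_bounds; simp)+
  \<comment> \<open>The added \<open>1\<close> makes \<open>K\<close> positive, so that it can be
    divided by.\<close>
  define K where "K = generator_const l + 1"
  have K: "generator_const l \<le> K" "0 < K" using generator_const_nonneg[OF l] by (auto simp: K_def)
  obtain \<eta> where \<eta>: "0 < \<eta>" "\<eta> \<le> 1/2" and sl: "slope_error (gauss_acc \<tau>) (g / 2) \<eta> < \<epsilon> / (2 * K)"
    using gauss_acc_slope_error[OF \<tau>, of "\<epsilon> / (2 * K)"] \<epsilon> K by (auto simp: g_def)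
  define sl where "sl = slope_error (gauss_acc \<tau>) (g / 2) \<eta>"
  obtain e where e: "e \<longlonglongrightarrow> 0"
    "\<And>J. finite J \<Longrightarrow> J \<noteq> {} \<Longrightarrow> (\<integral>z. acc_error J (l / sqrt (real (card J))) z \<partial>PiM J (\<lambda>_. \<mu>)) \<le> e (card J)"
    using acc_error_tendsto[OF l] by blast
  define M1 where "M1 = (\<integral>x. \<bar>u' x\<bar> \<partial>\<mu>)"
  define s where "s d = l / sqrt (real (d - 1))" for d :: nat
  define a where "a d = K * ((1 + M1) * s d / \<eta> + (4 / \<eta> + 1) * e (d - 1))" for d
  have d1: "filterlim (\<lambda>d::nat. d - 1) at_top sequentially" by (rule filterlim_minus_const_nat_at_top)
  have "s \<longlonglongrightarrow> 0" unfolding s_def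
    by (intro tendsto_divide_0[OF tendsto_const] filterlim_at_top_imp_at_infinity
        filterlim_compose[OF sqrt_at_top] filterlim_compose[OF filterlim_real_sequentially d1])
  moreover have "(\<lambda>d. e (d - 1)) \<longlonglongrightarrow> 0" by (rule filterlim_compose[OF e(1) d1])
  ultimately have "a \<longlonglongrightarrow> K * ((1 + M1) * 0 / \<eta> + (4 / \<eta> + 1) * 0)"
    unfolding a_def using \<eta> by (intro tendsto_intros) auto
  then have "a \<longlonglongrightarrow> 0" by simp
  then have ev: "\<forall>\<^sub>F d in sequentially. a d < \<epsilon> / 2" using \<epsilon> by (intro order_tendstoD(2)) auto
  show ?thesis
    using ev eventually_ge_at_top[of 2]
  proof (eventually_elim, intro ballI)
    fix d i assume ad: "a d < \<epsilon> / 2" and d: "2 \<le> d" and i: "i \<in> {1..d}"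
    define J where "J = {1..d} - {i}"
    have J: "finite J" "card J = d - 1" "J \<noteq> {}" "J \<subseteq> {1..d}"
    proof -
      show "finite J" "J \<subseteq> {1..d}" "card J = d - 1" using i by (auto simp: J_def)
      then show "J \<noteq> {}" using d by auto
    qed
    define \<sigma> where "\<sigma> = s d"
    have k: "1 \<le> real (d - 1)" using d by simp
    then have k1: "1 \<le> sqrt (real (d - 1))" by simp
    have \<sigma>: "0 < \<sigma>" "\<sigma> \<le> l" "real (d - 1) * \<sigma>\<^sup>2 = l\<^sup>2"
    proof -
      show "0 < \<sigma>" using l k by (simp add: \<sigma>_def s_def)
      show "\<sigma> \<le> l" using l k1 by (simp add: \<sigma>_def s_def divide_le_eq mult_le_cancel_left1)
      show "real (d - 1) * \<sigma>\<^sup>2 = l\<^sup>2" using k by (simp add: \<sigma>_def s_def power_divide)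
    qed
    \<comment> \<open>The scaling of \<open>\<sigma>\<close> makes the limiting
      \<open>\<tau>\<close> the same in all dimensions.\<close>
    have \<tau>2: "\<tau>\<^sup>2 = \<sigma>\<^sup>2 * real (card J) * Fisher"
      using \<sigma>(3) Fisher_pos by (simp add: \<tau>_def J power_mult_distrib mult.commute)
    interpret prob_space "\<pi> d" by (rule prob_\<pi>)
    interpret m: prob_space \<mu> by (rule prob_\<mu>)
    have E_int: "integrable (\<pi> d) (acc_error J \<sigma>)" and E_le: "(\<integral>z. acc_error J \<sigma> z \<partial>\<pi> d) \<le> e (d - 1)"
    proof -
      have r: "acc_error J \<sigma> (restrict z J) = acc_error J \<sigma> z" for z
        unfolding acc_error_def by simp
      note int = integral_acc_error(1)[OF J(1) \<sigma>(1)]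
      show "integrable (\<pi> d) (acc_error J \<sigma>)"
        using integrable_PiM_restrict[OF prob_\<mu> J(4) _ int] by (simp add: r \<pi>_def)
      have "(\<integral>z. acc_error J \<sigma> z \<partial>\<pi> d) = (\<integral>z. acc_error J \<sigma> z \<partial>PiM J (\<lambda>_. \<mu>))"
        using integral_PiM_restrict[OF prob_\<mu> J(4) _ borel_measurable_integrable[OF int]] by (simp add: r \<pi>_def)
      also have "\<dots> \<le> e (card J)" using e(2)[OF J(1,3)] by (simp add: J \<sigma>_def s_def)
      finally show "(\<integral>z. acc_error J \<sigma> z \<partial>\<pi> d) \<le> e (d - 1)" by (simp add: J)
    qed
    have u_int: "integrable (\<pi> d) (\<lambda>z. \<bar>u' (z i)\<bar>)" and u_eq: "(\<integral>z. \<bar>u' (z i)\<bar> \<partial>\<pi> d) = M1"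
      using integral_PiM_component[of "{1..d}" "\<lambda>_. \<mu>" i "\<lambda>x. \<bar>u' x\<bar>"] prob_\<mu> i integrable_u' by (auto simp: \<pi>_def M1_def)
    define W where "W z = K * ((1 + \<bar>u' (z i)\<bar>) * \<sigma> / \<eta> + (sl + 4 * acc_error J \<sigma> z / \<eta>) + acc_error J \<sigma> z)" for z
    have W_int: "integrable (\<pi> d) W" unfolding W_def using u_int E_int by simp
    have pw: "\<bar>real (d - 1) * (rwm_op d \<sigma> (\<lambda>z. \<phi> (z i)) z - \<phi> (z i)) - l\<^sup>2 / 2 * g * (\<phi>'' (z i) + u' (z i) * \<phi>' (z i))\<bar> \<le> W z"
      if "z \<in> space (\<pi> d)" for z
    proof -
      have z: "z \<in> space (euclid d)" using that by (simp add: space_\<pi>)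
      define \<beta> where "\<beta> = acc J \<sigma> z"
      have appr: "\<bar>\<beta> r - gauss_acc \<tau> r\<bar> \<le> acc_error J \<sigma> z" if "r > 0" for r
        unfolding \<beta>_def using \<tau> by (intro acc_approx J(1) that \<sigma>(1) \<tau>2) auto
      have meas: "(\<lambda>x. \<beta> (exp x)) \<in> borel_measurable borel"
      proof -
        interpret Q: prob_space "PiM J (\<lambda>_. std_normal)" by (rule prob_PiM_std)
        show ?thesis unfolding \<beta>_def acc_def by measurable
      qed
      have "\<bar>real (d - 1) * (\<integral>y. (\<phi> (z i + \<sigma> * y) - \<phi> (z i)) * \<beta> (exp (u (z i + \<sigma> * y) - u (z i))) \<partial>std_normal) - l\<^sup>2 / 2 * g * (\<phi>'' (z i) + u' (z i) * \<phi>' (z i))\<bar>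
        \<le> generator_const l * ((1 + \<bar>u' (z i)\<bar>) * \<sigma> / \<eta> + slope_error \<beta> (g / 2) \<eta> + \<bar>\<beta> 1 - g\<bar>)"
      proof (rule generator_expansion)
        show "concave_on {0<..} \<beta>" unfolding \<beta>_def by (rule acc_concave)
        show "\<bar>\<beta> (exp x) - \<beta> 1\<bar> \<le> \<bar>x\<bar>" for x unfolding \<beta>_def by (rule acc_exp_lipschitz)
        show "0 \<le> \<beta> r" "\<beta> r \<le> 1" if "0 < r" for r unfolding \<beta>_def using that by (auto intro: acc_bounds)
      qed (use meas \<eta> g \<sigma> l in auto)
      also have "\<dots> \<le> W z"
      proof -
        have "slope_error \<beta> (g / 2) \<eta> \<le> sl + 4 * acc_error J \<sigma> z / \<eta>"
          unfolding sl_def using \<eta> by (intro slope_error_approx appr) auto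
        moreover have "\<bar>\<beta> 1 - g\<bar> \<le> acc_error J \<sigma> z" unfolding g_def by (rule appr) simp
        ultimately have "(1 + \<bar>u' (z i)\<bar>) * \<sigma> / \<eta> + slope_error \<beta> (g / 2) \<eta> + \<bar>\<beta> 1 - g\<bar> \<le>
          (1 + \<bar>u' (z i)\<bar>) * \<sigma> / \<eta> + (sl + 4 * acc_error J \<sigma> z / \<eta>) + acc_error J \<sigma> z" by linarith
        then show ?thesis
          unfolding W_def using K \<sigma> \<eta> slope_error_nonneg[of \<beta> "g/2" \<eta>] by (intro mult_mono) auto
      qed
      finally show ?thesis
        unfolding rwm_op_coordinate[OF \<sigma>(1) z i \<phi>_measurable(1) \<phi>_le] \<beta>_def J_def .
    qed
    have "(\<integral>z. \<bar>real (d - 1) * (rwm_op d \<sigma> (\<lambda>z. \<phi> (z i)) z - \<phi> (z i)) - l\<^sup>2 / 2 * g * (\<phi>'' (z i) + u' (z i) * \<phi>' (z i))\<bar> \<partial>\<pi> d) \<le> (\<integral>z. W z \<partial>\<pi> d)"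
      using W_int pw order_trans[OF abs_ge_zero pw] by (intro integral_mono') auto
    also have "\<dots> = K * ((1 + M1) * \<sigma> / \<eta> + (4 / \<eta> + 1) * (\<integral>z. acc_error J \<sigma> z \<partial>\<pi> d) + sl)"
      unfolding W_def using u_int E_int prob_space by (simp add: u_eq algebra_simps add_divide_distrib)
    also have "\<dots> \<le> K * ((1 + M1) * \<sigma> / \<eta> + (4 / \<eta> + 1) * e (d - 1) + sl)"
      using K E_le \<eta> by (intro mult_left_mono add_mono) auto
    also have "\<dots> = a d + K * sl" by (simp add: a_def \<sigma>_def algebra_simps)
    also have "\<dots> < \<epsilon>"
    proof -
      have "K * sl < K * (\<epsilon> / (2 * K))" using sl K by (intro mult_strict_left_mono) (auto simp: sl_def)
      then have "K * sl < \<epsilon> / 2" using K by simp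
      then show ?thesis using ad by linarith
    qed
    finally show "(\<integral>z. \<bar>real (d - 1) * (rwm_op d (l / sqrt (real (d - 1))) (\<lambda>z. \<phi> (z i)) z - \<phi> (z i))
       - l\<^sup>2 / 2 * gauss_acc (l * sqrt Fisher) 1 * (\<phi>'' (z i) + u' (z i) * \<phi>' (z i))\<bar> \<partial>\<pi> d) < \<epsilon>"
      unfolding \<sigma>_def s_def g_def \<tau>_def .
  qed
qed

end

subsection \<open>The Poisson equation\<close>

lemma continuous_eventually_const_bounded:
  fixes g :: "real \<Rightarrow> real"
  assumes "continuous_on {-R..R} g" "\<And>x. x \<le> -R \<Longrightarrow> g x = g (-R)" "\<And>x. R \<le> x \<Longrightarrow> g x = g R" "0 \<le> R"
  obtains B where "\<And>x. \<bar>g x\<bar> \<le> B"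
proof -
  have "bounded (g ` {-R..R})" using assms(1) by (intro compact_imp_bounded compact_continuous_image) auto
  then obtain B where "\<forall>y\<in>g ` {-R..R}. norm y \<le> B" unfolding bounded_iff by blast
  then have B: "\<And>x. x \<in> {-R..R} \<Longrightarrow> \<bar>g x\<bar> \<le> B" by auto
  have "\<bar>g x\<bar> \<le> B" for x
  proof -
    consider "x \<le> -R" | "R \<le> x" | "x \<in> {-R..R}" by force
    then show ?thesis
    proof cases
      case 1
      show ?thesis unfolding assms(2)[OF 1] using assms(4) by (intro B) simp
    next
      case 2
      show ?thesis unfolding assms(3)[OF 2] using assms(4) by (intro B) simp
    qed (rule B)
  qed
  then show ?thesis using that by blast
qed

lemma derivative_bound_imp_lipschitz:
  fixes g :: "real \<Rightarrow> real"
  assumes "\<And>x. (g has_real_derivative g' x) (at x)" "\<And>x. \<bar>g' x\<bar> \<le> B"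
  shows "\<bar>g x - g y\<bar> \<le> B * \<bar>x - y\<bar>"
proof -
  have *: "\<bar>g y - g x\<bar> \<le> B * \<bar>y - x\<bar>" if lt: "x < y" for x y
  proof -
    obtain z where "g y - g x = (y - x) * g' z" using MVT2[OF lt, of g g'] assms(1) by blast
    then show ?thesis using assms(2)[of z] by (simp add: abs_mult mult.commute mult_right_mono)
  qed
  show ?thesis using *[of x y] *[of y x] by (cases x y rule: linorder_cases) (auto simp: abs_minus_commute)
qed

lemma derivative_zero_const:
  fixes g :: "real \<Rightarrow> real"
  assumes "\<And>x. (g has_real_derivative g' x) (at x)" "\<And>z. a < z \<Longrightarrow> z < b \<Longrightarrow> g' z = 0" "a \<le> b"
  shows "g a = g b"
proof (cases "a = b")
  case False
  then have "a < b" using assms(3) by simp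
  obtain z where "a < z" "z < b" "g b - g a = (b - a) * g' z" using MVT2[OF \<open>a < b\<close>, of g g'] assms(1) by blast
  then show ?thesis using assms(2)[of z] by simp
qed simp

context target begin

text \<open>\<open>h\<close> is an integrating factor:
  \<open>(h * \<phi>')' = h * (\<phi>'' + u' * \<phi>')\<close>, so \<open>h * \<phi>'\<close> is
  taken as the antiderivative \<open>F\<close> of \<open>f * h\<close> that starts at
  \<open>- R\<close>. Mean zero makes \<open>F\<close> vanish again from \<open>R\<close> on; hence
  \<open>\<phi>'\<close> has compact support, however fast \<open>h\<close> decays.\<close>

lemma poisson_equation:
  assumes f_lip: "\<And>x y. \<bar>f x - f y\<bar> \<le> K * \<bar>x - y\<bar>" and R: "0 \<le> R" and f_supp: "\<And>x. R < \<bar>x\<bar> \<Longrightarrow> f x = 0"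
    and mean: "(\<integral>x. f x \<partial>\<mu>) = 0"
  obtains \<phi> \<phi>' \<phi>'' B B1 B2 L U where "test_function h h' h'' C \<phi> \<phi>' \<phi>'' B B1 B2 L U"
    "\<And>x. \<phi>'' x + u' x * \<phi>' x = f x"
proof -
  have K: "0 \<le> K" using order_trans[OF abs_ge_zero f_lip[of 0 1]] by simp
  have "K-lipschitz_on UNIV f" using f_lip K by (intro lipschitz_onI) (auto simp: dist_real_def)
  then have f_cont: "continuous_on S f" for S
    using lipschitz_on_continuous_on continuous_on_subset by blast
  have [measurable]: "f \<in> borel_measurable borel" by (rule borel_measurable_continuous_onI[OF f_cont])
  have fR: "f x = 0" if "R \<le> \<bar>x\<bar>" for x
  proof (rule ccontr)
    assume "f x \<noteq> 0"
    \<comment> \<open>\<open>f\<close> vanishes just beyond \<open>x\<close>, and over the distance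
      \<open>e / 2\<close> the Lipschitz bound is too small to reach the value \<open>f x\<close>.
      The \<open>+ 1\<close> keeps the denominator positive.\<close>
    define e where "e = \<bar>f x\<bar> / (K + 1)"
    have e: "e > 0" using \<open>f x \<noteq> 0\<close> K by (simp add: e_def)
    define y where "y = (if 0 \<le> x then x + e / 2 else x - e / 2)"
    have "f y = 0" using that e by (intro f_supp) (auto simp: y_def)
    then have "\<bar>f x\<bar> \<le> K * (e / 2)" using f_lip[of x y] e by (simp add: y_def split: if_splits)
    also have "\<dots> < (K + 1) * e" using e mult_nonneg_nonneg[OF K less_imp_le[OF e]] by (simp add: algebra_simps)
    also have "\<dots> = \<bar>f x\<bar>" using K by (simp add: e_def)
    finally show False by simp
  qed
  obtain F0 where F0: "\<And>x. (F0 has_real_derivative f x * h x) (at x)"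
    using antiderivative_exists[of "\<lambda>x. f x * h x"] by (auto intro: continuous_intros f_cont cont_h)
  define F where "F x = F0 x - F0 (-R)" for x
  have F: "(F has_real_derivative f x * h x) (at x)" for x
    unfolding F_def using F0[of x] by (auto intro!: derivative_eq_intros)
  have F_left: "F x = 0" if "x \<le> -R" for x
    using derivative_zero_const[of F0 "\<lambda>x. f x * h x" x "-R"] F0 that R fR by (auto simp: F_def)
  have F_R: "F R = 0"
  proof -
    have "(\<integral>x. indicator {-R..R} x *\<^sub>R (f x * h x) \<partial>lborel) = F R - F (-R)"
    proof (rule integral_FTC_atLeastAtMost)
      show "(F has_vector_derivative f x * h x) (at x within {-R..R})" for x
        using F[of x] has_vector_derivative_at_within by (auto simp: has_real_derivative_iff_has_vector_derivative)
    qed (use R in \<open>auto intro!: continuous_intros f_cont cont_h\<close>)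
    moreover have "(\<integral>x. indicator {-R..R} x *\<^sub>R (f x * h x) \<partial>lborel) = (\<integral>x. h x * f x \<partial>lborel)"
    proof (rule Bochner_Integration.integral_cong[OF refl])
      fix x
      show "indicator {-R..R} x *\<^sub>R (f x * h x) = h x * f x"
        using fR[of x] by (cases "R \<le> \<bar>x\<bar>") (auto simp: indicator_def)
    qed
    ultimately show ?thesis using mean integral_\<mu>[of f] F_left[of "-R"] by simp
  qed
  have F_right: "F x = 0" if "R \<le> x" for x
    using derivative_zero_const[of F "\<lambda>x. f x * h x" R x] F that R fR F_R by auto
  define \<phi>' where "\<phi>' x = F x / h x" for x
  define \<phi>'' where "\<phi>'' x = f x - u' x * \<phi>' x" for x
  have \<phi>'_out: "\<phi>' x = 0" if "R \<le> \<bar>x\<bar>" for x using F_left[of x] F_right[of x] that by (auto simp: \<phi>'_def abs_if split: if_splits)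
  have \<phi>''_out: "\<phi>'' x = 0" if "R \<le> \<bar>x\<bar>" for x using \<phi>'_out[OF that] fR[OF that] by (simp add: \<phi>''_def)
  have d': "(\<phi>' has_real_derivative \<phi>'' x) (at x)" for x
    unfolding \<phi>'_def[abs_def] \<phi>''_def u'_def using h_neq_0[of x]
    by (auto intro!: derivative_eq_intros F h_deriv simp: \<phi>'_def field_simps power2_eq_square)
  have \<phi>'_cont: "continuous_on S \<phi>'" for S
    using d' by (intro DERIV_continuous_on[of S \<phi>' \<phi>'']) (auto intro: has_field_derivative_at_within)
  obtain \<phi> where d: "\<And>x. (\<phi> has_real_derivative \<phi>' x) (at x)" using antiderivative_exists[OF \<phi>'_cont] by blast
  have \<phi>_cont: "continuous_on S \<phi>" for S
    using d by (intro DERIV_continuous_on[of S \<phi> \<phi>']) (auto intro: has_field_derivative_at_within)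
  have \<phi>''_cont: "continuous_on S \<phi>''" for S unfolding \<phi>''_def[abs_def] by (intro continuous_intros f_cont cont_u' \<phi>'_cont)
  have \<phi>_left: "\<phi> x = \<phi> (-R)" if "x \<le> -R" for x
    using that R \<phi>'_out by (intro derivative_zero_const[OF d]) auto
  have \<phi>_right: "\<phi> x = \<phi> R" if "R \<le> x" for x
    using that R \<phi>'_out by (intro derivative_zero_const[OF d, symmetric]) auto
  obtain B where B: "\<And>x. \<bar>\<phi> x\<bar> \<le> B"
    by (rule continuous_eventually_const_bounded[OF \<phi>_cont \<phi>_left \<phi>_right R]) auto
  obtain B1 where B1: "\<And>x. \<bar>\<phi>' x\<bar> \<le> B1"
    by (rule continuous_eventually_const_bounded[OF \<phi>'_cont _ _ R]) (use \<phi>'_out R in auto)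
  obtain B2 where B2: "\<And>x. \<bar>\<phi>'' x\<bar> \<le> B2"
    by (rule continuous_eventually_const_bounded[OF \<phi>''_cont _ _ R]) (use \<phi>''_out R in auto)
  have "bounded (u' ` {-R..R})" by (intro compact_imp_bounded compact_continuous_image cont_u') auto
  then obtain U0 where "\<forall>y\<in>u' ` {-R..R}. norm y \<le> U0" unfolding bounded_iff by blast
  then have U0: "\<And>x. x \<in> {-R..R} \<Longrightarrow> \<bar>u' x\<bar> \<le> U0" by auto
  define U where "U = \<bar>U0\<bar>"
  have U: "\<bar>u' x\<bar> \<le> U" if "\<phi>' x \<noteq> 0" for x
  proof -
    have "x \<in> {-R..R}" using \<phi>'_out[of x] that by (cases "R \<le> \<bar>x\<bar>") auto
    then show ?thesis using U0[of x] by (simp add: U_def)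
  qed
  have nn: "0 \<le> B1" "0 \<le> B2" using order_trans[OF abs_ge_zero B1] order_trans[OF abs_ge_zero B2] by auto
  \<comment> \<open>\<open>U\<close> bounds \<open>u'\<close> only where \<open>\<phi>'\<close> is
    nonzero, and the splitting evaluates the factor \<open>u'\<close> at such a point. By symmetry
    it may be \<open>x\<close> or \<open>y\<close>; if there is none, the left-hand side is
    \<open>0\<close>.\<close>
  have prod: "\<bar>u' x * \<phi>' x - u' y * \<phi>' y\<bar> \<le> (U * B2 + B1 * C) * \<bar>x - y\<bar>" for x y
  proof -
    have *: "\<bar>u' x * \<phi>' x - u' y * \<phi>' y\<bar> \<le> (U * B2 + B1 * C) * \<bar>x - y\<bar>" if "\<phi>' x \<noteq> 0" for x y
    proof -
      have "u' x * \<phi>' x - u' y * \<phi>' y = u' x * (\<phi>' x - \<phi>' y) + \<phi>' y * (u' x - u' y)" by (simp add: algebra_simps)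
      then have "\<bar>u' x * \<phi>' x - u' y * \<phi>' y\<bar> \<le> \<bar>u' x\<bar> * \<bar>\<phi>' x - \<phi>' y\<bar> + \<bar>\<phi>' y\<bar> * \<bar>u' x - u' y\<bar>"
        by (metis abs_mult abs_triangle_ineq)
      also have "\<dots> \<le> U * (B2 * \<bar>x - y\<bar>) + B1 * (C * \<bar>x - y\<bar>)"
        using U[OF that] B1 u'_lipschitz derivative_bound_imp_lipschitz[OF d' B2] nn by (intro add_mono mult_mono) (auto simp: U_def)
      finally show ?thesis by (simp add: algebra_simps)
    qed
    have "0 \<le> (U * B2 + B1 * C) * \<bar>x - y\<bar>" using nn C_nonneg by (simp add: U_def)
    then show ?thesis using *[of x y] *[of y x]
      by (cases "\<phi>' x = 0"; cases "\<phi>' y = 0") (auto simp: abs_minus_commute)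
  qed
  have "test_function h h' h'' C \<phi> \<phi>' \<phi>'' B B1 B2 (K + (U * B2 + B1 * C)) U"
  proof (unfold_locales)
    show "\<bar>\<phi>'' x - \<phi>'' y\<bar> \<le> (K + (U * B2 + B1 * C)) * \<bar>x - y\<bar>" for x y
      using f_lip[of x y] prod[of x y] unfolding \<phi>''_def by (simp add: distrib_right)
    show "0 \<le> U" by (simp add: U_def)
  qed (auto intro: d d' B B1 B2 U)
  then show ?thesis by (rule that) (simp add: \<phi>''_def)
qed

lemma integral_coordinate_\<pi>:
  fixes g :: "real \<Rightarrow> real"
  assumes "i \<in> {1..d}" "g \<in> borel_measurable borel"
  shows "(\<integral>z. g (z i) \<partial>\<pi> d) = (\<integral>x. g x \<partial>\<mu>)"
  unfolding \<pi>_def using integral_PiM_component(1)[of "{1..d}" "\<lambda>_. \<mu>" i g] assms prob_\<mu> by simp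

text \<open>L^1 convergence, uniform in the coordinate and over all \<open>n \<ge> d T\<close> at
  once. \<open>D\<close> and \<open>T\<close> depend on the test function, so only finitely many
  test functions can be combined.\<close>

definition converges :: "real \<Rightarrow> (real \<Rightarrow> real) \<Rightarrow> bool" where
  "converges l \<psi> \<longleftrightarrow> (\<forall>\<epsilon>>0. \<exists>D T. \<forall>d\<ge>D. \<forall>n. \<forall>i\<in>{1..d}. 2 \<le> d \<longrightarrow> real d * T \<le> real n \<longrightarrow>
     (\<integral>z. \<bar>(rwm_op d (l / sqrt (real (d - 1))) ^^ n) (\<lambda>z. \<psi> (z i)) z - (\<integral>x. \<psi> x \<partial>\<mu>)\<bar> \<partial>\<pi> d) < \<epsilon>)"

text \<open>The Poisson equation is solved for \<open>f / c\<close>, since the scaled generators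
  converge to \<open>c\<close> times the operator in it. Of the three errors the smoothing term is
  at most \<open>B / T\<close>; the other two vanish as \<open>d\<close> grows.\<close>

lemma converges_mean_zero:
  assumes l: "l > 0" and f_lip: "\<And>x y. \<bar>f x - f y\<bar> \<le> K * \<bar>x - y\<bar>" and R: "0 \<le> R" and f_supp: "\<And>x. R < \<bar>x\<bar> \<Longrightarrow> f x = 0"
    and f_le: "\<And>x. \<bar>f x\<bar> \<le> A" and mean: "(\<integral>x. f x \<partial>\<mu>) = 0"
  shows "converges l f"
  unfolding converges_def
proof (intro allI impI)
  fix \<epsilon> :: real assume \<epsilon>: "\<epsilon> > 0"
  have K: "0 \<le> K" using order_trans[OF abs_ge_zero f_lip[of 0 1]] by simp
  have "K-lipschitz_on UNIV f" using f_lip K by (intro lipschitz_onI) (auto simp: dist_real_def)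
  then have fm[measurable]: "f \<in> borel_measurable borel"
    by (intro borel_measurable_continuous_onI lipschitz_on_continuous_on)
  define c where "c = l\<^sup>2 / 2 * gauss_acc (l * sqrt Fisher) 1"
  have c: "c > 0" unfolding c_def using l Fisher_pos by (intro mult_pos_pos gauss_acc_half(2)) auto
  obtain \<phi> \<phi>' \<phi>'' B B1 B2 L U where tf: "test_function h h' h'' C \<phi> \<phi>' \<phi>'' B B1 B2 L U"
    and eq: "\<And>x. \<phi>'' x + u' x * \<phi>' x = f x / c"
  proof (rule poisson_equation[of "\<lambda>x. f x / c" "K / c" R])
    show "\<bar>f x / c - f y / c\<bar> \<le> K / c * \<bar>x - y\<bar>" for x y
      using f_lip[of x y] c by (simp add: divide_right_mono flip: diff_divide_distrib)
  qed (use R f_supp mean in auto)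
  interpret test_function h h' h'' C \<phi> \<phi>' \<phi>'' B B1 B2 L U by (rule tf)
  have B: "0 \<le> B" using order_trans[OF abs_ge_zero \<phi>_le] by auto
  define s where "s d = l / sqrt (real (d - 1))" for d :: nat
  have d1: "filterlim (\<lambda>d::nat. d - 1) at_top sequentially" by (rule filterlim_minus_const_nat_at_top)
  have "s \<longlonglongrightarrow> 0" unfolding s_def
    by (intro tendsto_divide_0[OF tendsto_const] filterlim_at_top_imp_at_infinity
        filterlim_compose[OF sqrt_at_top] filterlim_compose[OF filterlim_real_sequentially d1])
  then have "(\<lambda>d. K * s d) \<longlonglongrightarrow> 0" by (rule tendsto_mult_right_zero)
  then have "\<forall>\<^sub>F d in sequentially. K * s d < \<epsilon> / 3" using \<epsilon> by (intro order_tendstoD(2)) auto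
  with generator_tendsto[OF l, of "\<epsilon> / 3"] \<epsilon>
  have "\<forall>\<^sub>F d in sequentially. K * s d < \<epsilon> / 3 \<and> (\<forall>i\<in>{1..d}.
    (\<integral>z. \<bar>real (d - 1) * (rwm_op d (s d) (\<lambda>z. \<phi> (z i)) z - \<phi> (z i)) - f (z i)\<bar> \<partial>\<pi> d) < \<epsilon> / 3)"
    unfolding c_def[symmetric] eq s_def using c by (auto intro: eventually_conj)
  then obtain D where D: "\<And>d. d \<ge> D \<Longrightarrow> K * s d < \<epsilon> / 3" "\<And>d i. d \<ge> D \<Longrightarrow> i \<in> {1..d} \<Longrightarrow>
    (\<integral>z. \<bar>real (d - 1) * (rwm_op d (s d) (\<lambda>z. \<phi> (z i)) z - \<phi> (z i)) - f (z i)\<bar> \<partial>\<pi> d) < \<epsilon> / 3"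
    unfolding eventually_sequentially by blast
  \<comment> \<open>This gives \<open>B / T < \<epsilon> / 3\<close>; the added \<open>1\<close>
    makes the inequality strict and keeps \<open>T\<close> positive when
    \<open>B = 0\<close>.\<close>
  define T where "T = 3 * B / \<epsilon> + 1"
  have T: "T > 0" "B / T < \<epsilon> / 3" using B \<epsilon> by (auto simp: T_def field_simps add_nonneg_pos)
  have "(\<integral>z. \<bar>(rwm_op d (s d) ^^ n) (\<lambda>z. f (z i)) z - (\<integral>x. f x \<partial>\<mu>)\<bar> \<partial>\<pi> d) < \<epsilon>"
    if d: "D \<le> d" "2 \<le> d" and n: "real d * T \<le> real n" and i: "i \<in> {1..d}" for d n i
  proof -
    have \<sigma>: "s d > 0" using l d by (simp add: s_def)
    interpret reversible_kernel "\<pi> d" "rwm d (s d)" by (rule reversible_kernel_rwm[OF \<sigma>])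
    have npos: "n > 0" using n T d by (cases n) (auto simp: mult_le_0_iff)
    have f_bm: "bm (\<lambda>z. f (z i))" unfolding bounded_measurable_\<pi> by (rule bounded_measurable_coordinate[OF fm f_le i])
    have \<phi>_bm: "bm (\<lambda>z. \<phi> (z i))" unfolding bounded_measurable_\<pi> by (rule bounded_measurable_coordinate[OF \<phi>_measurable(1) \<phi>_le i])
    have "(\<integral>z. \<bar>(op ^^ n) (\<lambda>z. f (z i)) z\<bar> \<partial>\<pi> d) \<le> real (d - 1) * B / real n
       + (\<integral>z. \<bar>real (d - 1) * (op (\<lambda>z. \<phi> (z i)) z - \<phi> (z i)) - f (z i)\<bar> \<partial>\<pi> d) + (\<integral>z. \<bar>op (\<lambda>z. f (z i)) z - f (z i)\<bar> \<partial>\<pi> d)"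
      by (rule integral_abs_op_power_le_generator[OF f_bm \<phi>_bm \<phi>_le _ npos]) simp
    moreover have "real (d - 1) * B / real n \<le> B / T"
    proof -
      have "real (d - 1) * B / real n \<le> real d * B / real n" using B by (intro divide_right_mono mult_right_mono) auto
      also have "\<dots> \<le> real d * B / (real d * T)" using n d T B npos by (intro divide_left_mono mult_nonneg_nonneg mult_pos_pos) auto
      also have "\<dots> = B / T" using d by simp
      finally show ?thesis .
    qed
    moreover have "(\<integral>z. \<bar>op (\<lambda>z. f (z i)) z - f (z i)\<bar> \<partial>\<pi> d) \<le> (\<integral>z. K * s d \<partial>\<pi> d)"
      using K \<sigma> by (intro integral_mono') (auto simp: space_\<pi> intro!: rwm_op_lipschitz[OF \<sigma> _ i fm f_le f_lip])
    moreover have "(\<integral>z. K * s d \<partial>\<pi> d) = K * s d" using prob_space by simp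
    ultimately have "(\<integral>z. \<bar>(op ^^ n) (\<lambda>z. f (z i)) z\<bar> \<partial>\<pi> d) < \<epsilon>"
      using D(1)[OF d(1)] D(2)[OF d(1) i] T(2) by linarith
    then show ?thesis by (simp add: mean)
  qed
  then show "\<exists>D T. \<forall>d\<ge>D. \<forall>n. \<forall>i\<in>{1..d}. 2 \<le> d \<longrightarrow> real d * T \<le> real n \<longrightarrow>
     (\<integral>z. \<bar>(rwm_op d (l / sqrt (real (d - 1))) ^^ n) (\<lambda>z. f (z i)) z - (\<integral>x. f x \<partial>\<mu>)\<bar> \<partial>\<pi> d) < \<epsilon>"
    unfolding s_def by blast
qed

end

subsection \<open>Hat functions and the Kantorovich--Rubinstein distance\<close>

definition ramp :: "real \<Rightarrow> real \<Rightarrow> real \<Rightarrow> real" where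
  "ramp m s x = min 1 (max 0 (m * x - s))"

lemma ramp_bounds: "0 \<le> ramp m s x" "ramp m s x \<le> 1"
  by (auto simp: ramp_def)

lemma ramp_antimono: "s \<le> t \<Longrightarrow> ramp m t x \<le> ramp m s x"
  by (auto simp: ramp_def)

lemma ramp_lipschitz: "\<bar>ramp m s x - ramp m s y\<bar> \<le> \<bar>m\<bar> * \<bar>x - y\<bar>"
proof -
  have "\<bar>ramp m s x - ramp m s y\<bar> \<le> \<bar>(m * x - s) - (m * y - s)\<bar>" unfolding ramp_def by linarith
  also have "(m * x - s) - (m * y - s) = m * (x - y)" by (simp add: algebra_simps)
  finally show ?thesis by (simp add: abs_mult)
qed

lemma ramp_measurable[measurable]: "ramp m s \<in> borel_measurable borel"
  unfolding ramp_def[abs_def] by measurable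

text \<open>In the variable \<open>m * x\<close> a trapezoid: \<open>1\<close> from
  \<open>s + 1\<close> to \<open>t\<close>, and \<open>0\<close> outside \<open>s\<close> to
  \<open>t + 1\<close>. For \<open>t = s + 1\<close> it is a triangle of the grid, for distant
  \<open>s\<close> and \<open>t\<close> a cut-off; being differences of ramps, consecutive triangles
  telescope to the cut-off.\<close>

definition hat :: "real \<Rightarrow> real \<Rightarrow> real \<Rightarrow> real \<Rightarrow> real" where
  "hat m s t x = ramp m s x - ramp m t x"

lemma hat_bounds: "s \<le> t \<Longrightarrow> 0 \<le> hat m s t x" "s \<le> t \<Longrightarrow> hat m s t x \<le> 1"
  using ramp_antimono[of s t m x] ramp_bounds[of m s x] ramp_bounds[of m t x] by (auto simp: hat_def)

lemma hat_lipschitz: "\<bar>hat m s t x - hat m s t y\<bar> \<le> 2 * \<bar>m\<bar> * \<bar>x - y\<bar>"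
  using ramp_lipschitz[of m s x y] ramp_lipschitz[of m t x y] unfolding hat_def by linarith

lemma hat_measurable[measurable]: "hat m s t \<in> borel_measurable borel"
  unfolding hat_def[abs_def] by measurable

lemma hat_eq_0: "s \<le> t \<Longrightarrow> m * x \<le> s \<Longrightarrow> hat m s t x = 0" "s \<le> t \<Longrightarrow> t + 1 \<le> m * x \<Longrightarrow> hat m s t x = 0"
  by (auto simp: hat_def ramp_def)

lemma hat_eq_1: "s + 1 \<le> m * x \<Longrightarrow> m * x \<le> t \<Longrightarrow> hat m s t x = 1"
  by (auto simp: hat_def ramp_def)

context target begin

lemma integrable_\<mu>_bounded:
  fixes f :: "real \<Rightarrow> real"
  assumes "f \<in> borel_measurable borel" "\<And>x. \<bar>f x\<bar> \<le> A"
  shows "integrable \<mu> f"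
proof -
  interpret prob_space \<mu> by (rule prob_\<mu>)
  show ?thesis using assms by (intro integrable_const_bound[where B=A] AE_I2) auto
qed

lemma integral_hat_tendsto:
  assumes m: "m > 0"
  shows "(\<lambda>n. \<integral>x. hat m (- real n) (real n) x \<partial>\<mu>) \<longlonglongrightarrow> 1"
proof -
  interpret prob_space \<mu> by (rule prob_\<mu>)
  have "(\<lambda>n. \<integral>x. hat m (- real n) (real n) x \<partial>\<mu>) \<longlonglongrightarrow> (\<integral>x. 1 \<partial>\<mu>)"
  proof (rule integral_dominated_convergence[where w="\<lambda>_. 1"])
    show "AE x in \<mu>. (\<lambda>n. hat m (- real n) (real n) x) \<longlonglongrightarrow> 1"
    proof (rule AE_I2)
      fix x
      obtain N :: nat where N: "\<bar>m * x\<bar> + 1 \<le> real N" using real_arch_simple by blast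
      have "\<forall>\<^sub>F n in sequentially. hat m (- real n) (real n) x = 1"
        using eventually_ge_at_top[of N]
      proof eventually_elim
        case (elim n)
        then have "\<bar>m * x\<bar> + 1 \<le> real n" using N by linarith
        then show ?case by (intro hat_eq_1) linarith+
      qed
      then show "(\<lambda>n. hat m (- real n) (real n) x) \<longlonglongrightarrow> 1" by (rule tendsto_eventually)
    qed
    show "AE x in \<mu>. norm (hat m (- real n) (real n) x) \<le> 1" for n
      using hat_bounds[of "- real n" "real n" m] by (intro AE_I2) auto
  qed auto
  then show ?thesis using prob_space by simp
qed

text \<open>Subtracting the mean would destroy compact support, so a multiple of a wide cut-off
  \<open>\<kappa>\<close> with the same mean is subtracted instead. What is then missing from a
  constant is small in L^1 of \<open>\<mu>\<close>, and the contraction keeps it small after any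
  number of steps.\<close>

lemma converges_lipschitz:
  assumes l: "l > 0" and \<psi>_lip: "\<And>x y. \<bar>\<psi> x - \<psi> y\<bar> \<le> K * \<bar>x - y\<bar>" and R: "0 \<le> R" and \<psi>_supp: "\<And>x. R < \<bar>x\<bar> \<Longrightarrow> \<psi> x = 0"
    and \<psi>_le: "\<And>x. \<bar>\<psi> x\<bar> \<le> A"
  shows "converges l \<psi>"
  unfolding converges_def
proof (intro allI impI)
  fix \<epsilon> :: real assume \<epsilon>: "\<epsilon> > 0"
  interpret prob_space \<mu> by (rule prob_\<mu>)
  have K: "0 \<le> K" using order_trans[OF abs_ge_zero \<psi>_lip[of 0 1]] by simp
  have A: "0 \<le> A" using order_trans[OF abs_ge_zero \<psi>_le[of 0]] by simp
  have "K-lipschitz_on UNIV \<psi>" using \<psi>_lip K by (intro lipschitz_onI) (auto simp: dist_real_def)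
  then have \<psi>m[measurable]: "\<psi> \<in> borel_measurable borel"
    by (intro borel_measurable_continuous_onI lipschitz_on_continuous_on)
  define q where "q = (\<integral>x. \<psi> x \<partial>\<mu>)"
  have qA: "\<bar>q\<bar> \<le> A"
  proof -
    have "\<bar>q\<bar> \<le> (\<integral>x. A \<partial>\<mu>)"
      unfolding q_def using \<psi>_le by (intro order_trans[OF integral_abs_bound] integral_mono integrable_abs integrable_\<mu>_bounded[OF \<psi>m \<psi>_le]) auto
    then show ?thesis using prob_space by simp
  qed
  \<comment> \<open>The cap \<open>1/2\<close> keeps \<open>c\<close> away from \<open>0\<close>;
    the other entry makes \<open>4 * A * \<epsilon>'\<close> at most
    \<open>\<epsilon> / 2\<close>.\<close>
  define \<epsilon>' where "\<epsilon>' = min (1/2) (\<epsilon> / (8 * (A + 1)))"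
  have \<epsilon>': "0 < \<epsilon>'" "\<epsilon>' \<le> 1/2" "4 * A * \<epsilon>' \<le> \<epsilon> / 2"
  proof -
    show "0 < \<epsilon>'" using \<epsilon> A by (simp add: \<epsilon>'_def)
    show "\<epsilon>' \<le> 1/2" unfolding \<epsilon>'_def by (rule min.cobounded1)
    have "4 * A * \<epsilon>' \<le> 4 * (A + 1) * (\<epsilon> / (8 * (A + 1)))" using A \<epsilon> by (intro mult_mono) (auto simp: \<epsilon>'_def)
    also have "\<dots> = \<epsilon> / 2" using A by (simp add: field_simps)
    finally show "4 * A * \<epsilon>' \<le> \<epsilon> / 2" .
  qed
  have "\<forall>\<^sub>F n in sequentially. 1 - \<epsilon>' < (\<integral>x. hat 1 (- real n) (real n) x \<partial>\<mu>)"
    using \<epsilon>' by (intro order_tendstoD(1)[OF integral_hat_tendsto]) auto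
  then obtain N :: nat where N: "1 - \<epsilon>' < (\<integral>x. hat 1 (- real N) (real N) x \<partial>\<mu>)"
    by (auto simp: eventually_sequentially)
  define \<kappa> where "\<kappa> = hat 1 (- real N) (real N)"
  define c where "c = (\<integral>x. \<kappa> x \<partial>\<mu>)"
  have [measurable]: "\<kappa> \<in> borel_measurable borel" unfolding \<kappa>_def by measurable
  have \<kappa>: "0 \<le> \<kappa> x" "\<kappa> x \<le> 1" for x using hat_bounds[of "- real N" "real N" 1 x] by (auto simp: \<kappa>_def)
  have \<kappa>_int: "integrable \<mu> \<kappa>" using \<kappa> by (intro integrable_\<mu>_bounded[where A=1]) auto
  have c: "1 - \<epsilon>' < c" "1/2 \<le> c" "c \<le> 1"
  proof -
    show "1 - \<epsilon>' < c" using N by (simp add: c_def \<kappa>_def)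
    then show "1/2 \<le> c" using \<epsilon>' by simp
    have "c \<le> (\<integral>x. 1 \<partial>\<mu>)" unfolding c_def using \<kappa>_int \<kappa> by (intro integral_mono) auto
    then show "c \<le> 1" using prob_space by simp
  qed
  \<comment> \<open>\<open>\<psi> = f + g + q\<close>. Both \<open>f\<close> and \<open>g\<close>
    have mean zero; \<open>f\<close> has compact support, and \<open>g\<close> is not compactly
    supported in general but small in L^1.\<close>
  define f where "f x = \<psi> x - q / c * \<kappa> x" for x
  define g where "g x = q / c * (\<kappa> x - c)" for x
  have fm[measurable]: "f \<in> borel_measurable borel" and gm[measurable]: "g \<in> borel_measurable borel"
    unfolding f_def[abs_def] g_def[abs_def] by measurable
  have qc: "\<bar>q / c\<bar> \<le> 2 * A"
  proof -
    have "\<bar>q / c\<bar> = \<bar>q\<bar> / c" using c by simp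
    also have "\<dots> \<le> A / (1/2)" using qA c A by (intro frac_le) auto
    finally show ?thesis by simp
  qed
  have f_le: "\<bar>f x\<bar> \<le> A + 2 * A" for x
  proof -
    have "\<bar>q / c * \<kappa> x\<bar> \<le> 2 * A * 1" unfolding abs_mult using qc \<kappa>[of x] A by (intro mult_mono) auto
    then have "\<bar>q / c * \<kappa> x\<bar> \<le> 2 * A" by simp
    then show ?thesis unfolding f_def by (rule order_trans[OF abs_triangle_ineq4 add_mono[OF \<psi>_le]])
  qed
  have g_le: "\<bar>g x\<bar> \<le> 2 * A * 1" for x
    unfolding g_def abs_mult using qc \<kappa>[of x] c A by (intro mult_mono) auto
  have conv_f: "converges l f"
  proof (rule converges_mean_zero[OF l])
    show "\<bar>f x - f y\<bar> \<le> (K + 2 * A * 2) * \<bar>x - y\<bar>" for x y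
    proof -
      have hat: "\<bar>q / c * (\<kappa> x - \<kappa> y)\<bar> \<le> 2 * A * (2 * \<bar>x - y\<bar>)"
        unfolding abs_mult using qc hat_lipschitz[of 1 "- real N" "real N" x y] A by (intro mult_mono) (auto simp: \<kappa>_def)
      have "f x - f y = (\<psi> x - \<psi> y) - q / c * (\<kappa> x - \<kappa> y)" by (simp add: f_def algebra_simps)
      also have "\<bar>\<dots>\<bar> \<le> \<bar>\<psi> x - \<psi> y\<bar> + \<bar>q / c * (\<kappa> x - \<kappa> y)\<bar>" by (rule abs_triangle_ineq4)
      also have "\<dots> \<le> K * \<bar>x - y\<bar> + 2 * A * (2 * \<bar>x - y\<bar>)" by (rule add_mono[OF \<psi>_lip hat])
      finally show ?thesis by (simp add: algebra_simps)
    qed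
    show "f x = 0" if "R + real N + 1 < \<bar>x\<bar>" for x
    proof -
      have "\<kappa> x = 0"
      proof (cases "0 \<le> x")
        case True
        then show ?thesis unfolding \<kappa>_def using that R by (intro hat_eq_0(2)) auto
      next
        case False
        then show ?thesis unfolding \<kappa>_def using that R by (intro hat_eq_0(1)) auto
      qed
      then show ?thesis using that \<psi>_supp[of x] by (simp add: f_def)
    qed
    show "(\<integral>x. f x \<partial>\<mu>) = 0"
      unfolding f_def using \<kappa>_int integrable_\<mu>_bounded[OF \<psi>m \<psi>_le] c by (simp add: q_def[symmetric] c_def[symmetric])
  qed (use R f_le in auto)
  have g_int: "integrable \<mu> g" by (rule integrable_\<mu>_bounded[OF gm g_le])
  have g_small: "(\<integral>x. \<bar>g x\<bar> \<partial>\<mu>) \<le> \<epsilon> / 2"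
  proof -
    have "(\<integral>x. \<bar>g x\<bar> \<partial>\<mu>) \<le> (\<integral>x. 2 * A * ((1 - \<kappa> x) + (1 - c)) \<partial>\<mu>)"
    proof (rule integral_mono)
      show "\<bar>g x\<bar> \<le> 2 * A * ((1 - \<kappa> x) + (1 - c))" for x
        unfolding g_def abs_mult using qc \<kappa>[of x] c A by (intro mult_mono) auto
    qed (use g_int \<kappa>_int in auto)
    also have "\<dots> = 4 * A * (1 - c)" using \<kappa>_int prob_space by (simp add: c_def[symmetric] algebra_simps)
    also have "\<dots> \<le> 4 * A * \<epsilon>'" using A c by (intro mult_left_mono) auto
    finally show ?thesis using \<epsilon>' by simp
  qed
  from conv_f[unfolded converges_def, rule_format, of "\<epsilon> / 2"] \<epsilon>
  obtain D T where DT: "\<And>d n i. D \<le> d \<Longrightarrow> i \<in> {1..d} \<Longrightarrow> 2 \<le> d \<Longrightarrow> real d * T \<le> real n \<Longrightarrow>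
     (\<integral>z. \<bar>(rwm_op d (l / sqrt (real (d - 1))) ^^ n) (\<lambda>z. f (z i)) z - (\<integral>x. f x \<partial>\<mu>)\<bar> \<partial>\<pi> d) < \<epsilon> / 2"
    by (metis half_gt_zero)
  have f0: "(\<integral>x. f x \<partial>\<mu>) = 0"
    unfolding f_def using \<kappa>_int integrable_\<mu>_bounded[OF \<psi>m \<psi>_le] c by (simp add: q_def[symmetric] c_def[symmetric])
  have "(\<integral>z. \<bar>(rwm_op d (l / sqrt (real (d - 1))) ^^ n) (\<lambda>z. \<psi> (z i)) z - q\<bar> \<partial>\<pi> d) < \<epsilon>"
    if d: "D \<le> d" "2 \<le> d" and n: "real d * T \<le> real n" and i: "i \<in> {1..d}" for d n i
  proof -
    define \<sigma> where "\<sigma> = l / sqrt (real (d - 1))"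
    have \<sigma>: "\<sigma> > 0" using l d by (simp add: \<sigma>_def)
    interpret P: reversible_kernel "\<pi> d" "rwm d \<sigma>" by (rule reversible_kernel_rwm[OF \<sigma>])
    let ?f = "\<lambda>z. f (z i)" and ?g = "\<lambda>z. g (z i)" and ?\<psi> = "\<lambda>z. \<psi> (z i)"
    have f_bm: "P.bm ?f" unfolding bounded_measurable_\<pi> by (rule bounded_measurable_coordinate[OF fm f_le i])
    have g_bm: "P.bm ?g" unfolding bounded_measurable_\<pi> by (rule bounded_measurable_coordinate[OF gm g_le i])
    have \<psi>_bm: "P.bm ?\<psi>" unfolding bounded_measurable_\<pi> by (rule bounded_measurable_coordinate[OF \<psi>m \<psi>_le i])
    have split: "\<bar>(P.op ^^ n) ?\<psi> z - q\<bar> \<le> \<bar>(P.op ^^ n) ?f z\<bar> + \<bar>(P.op ^^ n) ?g z\<bar>" if z: "z \<in> space (\<pi> d)" for z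
    proof -
      have \<psi>_eq: "?\<psi> = (\<lambda>z. (f (z i) + g (z i)) + q)" using c by (auto simp: f_def g_def algebra_simps)
      have "(P.op ^^ n) (\<lambda>z. (f (z i) + g (z i)) + q) z = ((P.op ^^ n) ?f z + (P.op ^^ n) ?g z) + q"
        using P.op_power_add[OF z bounded_measurable_add[OF f_bm g_bm] bounded_measurable_const[of _ q], of n]
          P.op_power_add[OF z f_bm g_bm, of n] P.op_power_const[OF z, of n q] by simp
      then have "(P.op ^^ n) ?\<psi> z - q = (P.op ^^ n) ?f z + (P.op ^^ n) ?g z" unfolding \<psi>_eq by simp
      then show ?thesis by (simp only: abs_triangle_ineq)
    qed
    have "(\<integral>z. \<bar>(P.op ^^ n) ?\<psi> z - q\<bar> \<partial>\<pi> d) \<le> (\<integral>z. \<bar>(P.op ^^ n) ?f z\<bar> + \<bar>(P.op ^^ n) ?g z\<bar> \<partial>\<pi> d)"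
      using split by (intro integral_mono P.integrable_bounded_measurable bounded_measurable_intros P.op_power_bm f_bm g_bm \<psi>_bm) auto
    also have "\<dots> = (\<integral>z. \<bar>(P.op ^^ n) ?f z\<bar> \<partial>\<pi> d) + (\<integral>z. \<bar>(P.op ^^ n) ?g z\<bar> \<partial>\<pi> d)"
      by (intro Bochner_Integration.integral_add P.integrable_bounded_measurable bounded_measurable_intros P.op_power_bm f_bm g_bm)
    also have "(\<integral>z. \<bar>(P.op ^^ n) ?g z\<bar> \<partial>\<pi> d) \<le> (\<integral>z. \<bar>?g z\<bar> \<partial>\<pi> d)"
      by (rule P.integral_abs_op_power_le[OF g_bm])
    also have "(\<integral>z. \<bar>?g z\<bar> \<partial>\<pi> d) = (\<integral>x. \<bar>g x\<bar> \<partial>\<mu>)"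
      by (rule integral_coordinate_\<pi>[OF i]) measurable
    finally show ?thesis
      using DT[OF d(1) i d(2) n] g_small by (simp add: f0 \<sigma>_def)
  qed
  then show "\<exists>D T. \<forall>d\<ge>D. \<forall>n. \<forall>i\<in>{1..d}. 2 \<le> d \<longrightarrow> real d * T \<le> real n \<longrightarrow>
     (\<integral>z. \<bar>(rwm_op d (l / sqrt (real (d - 1))) ^^ n) (\<lambda>z. \<psi> (z i)) z - (\<integral>x. \<psi> x \<partial>\<mu>)\<bar> \<partial>\<pi> d) < \<epsilon>"
    unfolding q_def by blast
qed

end

lemma sum_hat: "(\<Sum>j<k. hat m (s + real j) (s + real (Suc j)) x) = hat m s (s + real k) x"
  by (induction k) (auto simp: hat_def)

text \<open>
  Testing a measure against the hats \<open>\<psi>\<^sub>j\<close> of a grid controls all admissible functions at once. Their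
  sum \<open>\<kappa>\<close> is itself a combination of them, so the tail of \<open>\<mu>\<close> costs only the tail of \<open>\<nu>\<close>.
\<close>

lemma KR_dist_le_hats:
  fixes n m :: nat
  assumes \<mu>: "prob_space \<mu>" "sets \<mu> = sets borel" and \<nu>: "prob_space \<nu>" "sets \<nu> = sets borel" and m: "m > 0"
  defines "\<psi> \<equiv> \<lambda>j. hat (real m) (- real n + real j) (- real n + real (Suc j))"
  shows "KR_dist \<mu> \<nu> \<le> 2 / real m + 2 * (1 - (\<integral>x. hat (real m) (- real n) (real n) x \<partial>\<nu>))
    + 2 * (\<Sum>j<2*n. \<bar>(\<integral>x. \<psi> j x \<partial>\<mu>) - (\<integral>x. \<psi> j x \<partial>\<nu>)\<bar>)"
  unfolding KR_dist_def
proof (rule cSUP_least)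
  show "{f :: real \<Rightarrow> real. (\<forall>x y. \<bar>f x - f y\<bar> \<le> \<bar>x - y\<bar>) \<and> (\<forall>x. \<bar>f x\<bar> \<le> 1)} \<noteq> {}"
    by (auto intro!: exI[of _ "\<lambda>_. 0"])
  fix f :: "real \<Rightarrow> real" assume "f \<in> {f. (\<forall>x y. \<bar>f x - f y\<bar> \<le> \<bar>x - y\<bar>) \<and> (\<forall>x. \<bar>f x\<bar> \<le> 1)}"
  then have f_lip: "\<bar>f x - f y\<bar> \<le> \<bar>x - y\<bar>" and f_le: "\<bar>f x\<bar> \<le> 1" for x y by auto
  have "1-lipschitz_on UNIV f" using f_lip by (intro lipschitz_onI) (auto simp: dist_real_def)
  then have fm[measurable]: "f \<in> borel_measurable borel"
    by (intro borel_measurable_continuous_onI lipschitz_on_continuous_on)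
  define \<kappa> where "\<kappa> = hat (real m) (- real n) (real n)"
  \<comment> \<open>\<open>c j\<close> is the midpoint of the support of \<open>\<psi> j\<close>,
    all of which lies within \<open>1 / m\<close> of it.\<close>
  define c where "c j = (real j - real n + 1) / real m" for j
  define G where "G x = (\<Sum>j<2*n. f (c j) * \<psi> j x)" for x
  have [measurable]: "\<psi> j \<in> borel_measurable borel" "\<kappa> \<in> borel_measurable borel" for j
    unfolding \<psi>_def \<kappa>_def by measurable
  have \<kappa>_sum: "\<kappa> x = (\<Sum>j<2*n. \<psi> j x)" for x
    unfolding \<psi>_def \<kappa>_def sum_hat by simp
  have \<psi>: "0 \<le> \<psi> j x" "\<psi> j x \<le> 1" for j x unfolding \<psi>_def by (auto intro!: hat_bounds)
  have \<kappa>: "0 \<le> \<kappa> x" "\<kappa> x \<le> 1" for x unfolding \<kappa>_def by (auto intro!: hat_bounds)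
  have near: "\<bar>f x - f (c j)\<bar> * \<psi> j x \<le> 1 / real m * \<psi> j x" for j x
  proof (cases "\<psi> j x = 0")
    case False
    have "\<not> real m * x \<le> - real n + real j" "\<not> - real n + real (Suc j) + 1 \<le> real m * x"
      using False hat_eq_0[of "- real n + real j" "- real n + real (Suc j)" "real m" x] unfolding \<psi>_def by auto
    then have "\<bar>real m * x - real m * c j\<bar> \<le> 1" using m by (simp add: c_def)
    then have "real m * \<bar>x - c j\<bar> \<le> 1" using m by (simp add: abs_mult flip: right_diff_distrib)
    then have "\<bar>x - c j\<bar> \<le> 1 / real m" using m by (simp add: field_simps)
    then show ?thesis using f_lip[of x "c j"] \<psi>[of j x] by (intro mult_right_mono) auto
  qed simp
  have fG: "\<bar>f x - G x\<bar> \<le> 1 / real m + (1 - \<kappa> x)" for x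
  proof -
    \<comment> \<open>The hats add up to \<open>\<kappa>\<close>, so \<open>f\<close> times
      \<open>\<kappa>\<close> can be distributed over them and compared with the node values one hat
      at a time.\<close>
    have "f x - G x = f x * (1 - \<kappa> x) + (\<Sum>j<2*n. (f x - f (c j)) * \<psi> j x)"
      unfolding G_def \<kappa>_sum by (simp add: algebra_simps sum_subtractf sum_distrib_left)
    also have "\<bar>\<dots>\<bar> \<le> \<bar>f x * (1 - \<kappa> x)\<bar> + (\<Sum>j<2*n. \<bar>(f x - f (c j)) * \<psi> j x\<bar>)"
      by (intro order_trans[OF abs_triangle_ineq] add_mono sum_abs) simp
    also have "\<dots> \<le> 1 * (1 - \<kappa> x) + (\<Sum>j<2*n. 1 / real m * \<psi> j x)"
    proof (intro add_mono sum_mono)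
      show "\<bar>f x * (1 - \<kappa> x)\<bar> \<le> 1 * (1 - \<kappa> x)"
        unfolding abs_mult using f_le[of x] \<kappa>[of x] by (intro mult_mono) auto
      show "\<bar>(f x - f (c j)) * \<psi> j x\<bar> \<le> 1 / real m * \<psi> j x" for j
        using near[of x j] \<psi>(1)[of j x] by (simp add: abs_mult)
    qed
    also have "(\<Sum>j<2*n. 1 / real m * \<psi> j x) = 1 / real m * \<kappa> x" unfolding \<kappa>_sum sum_distrib_left ..
    also have "1 * (1 - \<kappa> x) + 1 / real m * \<kappa> x \<le> 1 / real m + (1 - \<kappa> x)"
      using \<kappa>[of x] m by (simp add: divide_right_mono)
    finally show ?thesis .
  qed
  have Gm[measurable]: "G \<in> borel_measurable borel" unfolding G_def[abs_def] by measurable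
  have ints: "integrable M f" "integrable M G" "integrable M \<kappa>" "integrable M (\<psi> j)"
    "\<bar>(\<integral>x. f x \<partial>M) - (\<integral>x. G x \<partial>M)\<bar> \<le> 1 / real m + (1 - (\<integral>x. \<kappa> x \<partial>M))"
    "(\<integral>x. G x \<partial>M) = (\<Sum>j<2*n. f (c j) * (\<integral>x. \<psi> j x \<partial>M))" "(\<integral>x. \<kappa> x \<partial>M) = (\<Sum>j<2*n. \<integral>x. \<psi> j x \<partial>M)"
    if M: "prob_space M" "sets M = sets borel" for M j
  proof -
    interpret prob_space M by fact
    have [measurable_cong]: "sets M = sets borel" by fact
    show i: "integrable M f" "integrable M \<kappa>"
      using f_le \<kappa> by (intro integrable_const_bound[where B=1] AE_I2; simp; measurable)+
    have j: "integrable M (\<psi> j)" for j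
      using \<psi> by (intro integrable_const_bound[where B=1] AE_I2) auto
    then show "integrable M (\<psi> j)" .
    show G: "integrable M G" unfolding G_def[abs_def] using j by (intro Bochner_Integration.integrable_sum integrable_mult_right)
    have "\<bar>(\<integral>x. f x \<partial>M) - (\<integral>x. G x \<partial>M)\<bar> = \<bar>\<integral>x. f x - G x \<partial>M\<bar>" using i G by simp
    also have "\<dots> \<le> (\<integral>x. \<bar>f x - G x\<bar> \<partial>M)" by (rule integral_abs_bound)
    also have "\<dots> \<le> (\<integral>x. 1 / real m + (1 - \<kappa> x) \<partial>M)" using i G fG by (intro integral_mono) auto
    also have "\<dots> = 1 / real m + (1 - (\<integral>x. \<kappa> x \<partial>M))" using i prob_space by simp
    finally show "\<bar>(\<integral>x. f x \<partial>M) - (\<integral>x. G x \<partial>M)\<bar> \<le> 1 / real m + (1 - (\<integral>x. \<kappa> x \<partial>M))" .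
    show "(\<integral>x. G x \<partial>M) = (\<Sum>j<2*n. f (c j) * (\<integral>x. \<psi> j x \<partial>M))" unfolding G_def using j by simp
    show "(\<integral>x. \<kappa> x \<partial>M) = (\<Sum>j<2*n. \<integral>x. \<psi> j x \<partial>M)" unfolding \<kappa>_sum using j by simp
  qed
  define S where "S = (\<Sum>j<2*n. \<bar>(\<integral>x. \<psi> j x \<partial>\<mu>) - (\<integral>x. \<psi> j x \<partial>\<nu>)\<bar>)"
  have \<kappa>S: "\<bar>(\<integral>x. \<kappa> x \<partial>\<mu>) - (\<integral>x. \<kappa> x \<partial>\<nu>)\<bar> \<le> S"
    unfolding ints(7)[OF \<mu>] ints(7)[OF \<nu>] sum_subtractf[symmetric] S_def by (rule sum_abs)
  have GS: "\<bar>(\<integral>x. G x \<partial>\<mu>) - (\<integral>x. G x \<partial>\<nu>)\<bar> \<le> S"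
  proof -
    have "(\<integral>x. G x \<partial>\<mu>) - (\<integral>x. G x \<partial>\<nu>) = (\<Sum>j<2*n. f (c j) * ((\<integral>x. \<psi> j x \<partial>\<mu>) - (\<integral>x. \<psi> j x \<partial>\<nu>)))"
      unfolding ints(6)[OF \<mu>] ints(6)[OF \<nu>] by (simp add: sum_subtractf right_diff_distrib)
    also have "\<bar>\<dots>\<bar> \<le> (\<Sum>j<2*n. \<bar>f (c j) * ((\<integral>x. \<psi> j x \<partial>\<mu>) - (\<integral>x. \<psi> j x \<partial>\<nu>))\<bar>)" by (rule sum_abs)
    also have "\<dots> \<le> (\<Sum>j<2*n. 1 * \<bar>(\<integral>x. \<psi> j x \<partial>\<mu>) - (\<integral>x. \<psi> j x \<partial>\<nu>)\<bar>)"
      unfolding abs_mult using f_le by (intro sum_mono mult_right_mono) auto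
    finally show ?thesis by (simp add: S_def)
  qed
  have "(\<integral>x. f x \<partial>\<mu>) - (\<integral>x. f x \<partial>\<nu>) \<le> 2 * (1 / real m) + 2 * (1 - (\<integral>x. \<kappa> x \<partial>\<nu>)) + 2 * S"
  proof -
    \<comment> \<open>One \<open>S\<close> pays for the difference of the node sums, the other for
      trading the tail of the first measure for that of the second.\<close>
    have arith: "a - b \<le> 2 * r + 2 * (1 - q) + 2 * S"
      if "\<bar>a - v\<bar> \<le> r + (1 - p)" "\<bar>b - w\<bar> \<le> r + (1 - q)" "\<bar>p - q\<bar> \<le> S" "\<bar>v - w\<bar> \<le> S" for a b p q r v w :: real
      using that(1)[THEN abs_le_D1] that(2)[THEN abs_le_D2] that(3)[THEN abs_le_D2] that(4)[THEN abs_le_D1]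
      by (simp add: algebra_simps)
    show ?thesis by (rule arith[OF ints(5)[OF \<mu>] ints(5)[OF \<nu>] \<kappa>S GS])
  qed
  then show "(\<integral>x. f x \<partial>\<mu>) - (\<integral>x. f x \<partial>\<nu>) \<le> 2 / real m + 2 * (1 - (\<integral>x. hat (real m) (- real n) (real n) x \<partial>\<nu>))
    + 2 * (\<Sum>j<2*n. \<bar>(\<integral>x. \<psi> j x \<partial>\<mu>) - (\<integral>x. \<psi> j x \<partial>\<nu>)\<bar>)"
    by (simp add: \<kappa>_def S_def)
qed

section \<open>Averaging over the starting point and choosing the constants\<close>

context target begin

text \<open>The hats do not depend on the starting point, so the supremum gives way to a finite sum
  under the average. Monotonicity of the nonnegative integral asks for measurability of the majorant
  \<open>W\<close> alone.\<close>

lemma rwm_mean_KR_le: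
  fixes n m N :: nat
  assumes \<sigma>: "\<sigma> > 0" and i: "i \<in> {1..d}" and m: "m > 0"
  defines "\<psi> \<equiv> \<lambda>j. hat (real m) (- real N + real j) (- real N + real (Suc j))"
  shows "rwm_mean_KR h (\<sigma>\<^sup>2) d n i \<le> ennreal (2 / real m + 2 * (1 - (\<integral>x. hat (real m) (- real N) (real N) x \<partial>\<mu>))
    + 2 * (\<Sum>j<2*N. \<integral>z. \<bar>(rwm_op d \<sigma> ^^ n) (\<lambda>z. \<psi> j (z i)) z - (\<integral>x. \<psi> j x \<partial>\<mu>)\<bar> \<partial>\<pi> d))"
proof -
  interpret prob_space \<mu> by (rule prob_\<mu>)
  interpret P: reversible_kernel "\<pi> d" "rwm d \<sigma>" by (rule reversible_kernel_rwm[OF \<sigma>])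
  have [measurable]: "\<psi> j \<in> borel_measurable borel" for j unfolding \<psi>_def by measurable
  have \<psi>_le: "\<bar>\<psi> j x\<bar> \<le> 1" for j x using hat_bounds[of "- real N + real j" "- real N + real (Suc j)" "real m" x] by (simp add: \<psi>_def)
  have \<psi>_bm: "bounded_measurable (euclid d) (\<lambda>z. \<psi> j (z i))" for j
    using \<psi>_le i by (intro bounded_measurable_coordinate) auto
  define c where "c = 2 / real m + 2 * (1 - (\<integral>x. hat (real m) (- real N) (real N) x \<partial>\<mu>))"
  define W where "W z = c + 2 * (\<Sum>j<2*N. \<bar>(P.op ^^ n) (\<lambda>z. \<psi> j (z i)) z - (\<integral>x. \<psi> j x \<partial>\<mu>)\<bar>)" for z
  have c0: "0 \<le> c"
  proof -
    have "(\<integral>x. hat (real m) (- real N) (real N) x \<partial>\<mu>) \<le> (\<integral>x. 1 \<partial>\<mu>)"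
      using hat_bounds[of "- real N" "real N" "real m"] by (intro integral_mono integrable_\<mu>_bounded[where A=1]) auto
    then show ?thesis using prob_space by (simp add: c_def)
  qed
  have W0: "0 \<le> W z" for z unfolding W_def using c0 by (intro add_nonneg_nonneg mult_nonneg_nonneg sum_nonneg) auto
  have bm: "P.bm (\<lambda>z. \<bar>(P.op ^^ n) (\<lambda>z. \<psi> j (z i)) z - (\<integral>x. \<psi> j x \<partial>\<mu>)\<bar>)" for j
    using \<psi>_bm by (intro bounded_measurable_intros P.op_power_bm) (simp add: bounded_measurable_\<pi>)
  have W_int: "integrable (\<pi> d) W"
    unfolding W_def using P.integrable_bounded_measurable[OF bm] by simp
  have KR: "KR_dist (rwm_coord_law d (prod_density h d) (\<sigma>\<^sup>2) n i z) (density lborel h) \<le> W z" if z: "z \<in> space (euclid d)" for z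
  proof -
    let ?law = "rwm_law d (prod_density h d) (\<sigma>\<^sup>2) n z"
    have law: "prob_space ?law" "sets ?law = sets (euclid d)"
      using measurable_space[OF rwm_law_measurable[OF \<sigma>] z] by (auto simp: space_prob_algebra)
    have comp: "(\<lambda>x. x i) \<in> ?law \<rightarrow>\<^sub>M borel"
      unfolding measurable_cong_sets[OF law(2) refl] euclid_def using i by measurable
    have eq: "(\<integral>x. \<psi> j x \<partial>rwm_coord_law d (prod_density h d) (\<sigma>\<^sup>2) n i z) = (P.op ^^ n) (\<lambda>z. \<psi> j (z i)) z" for j
      unfolding rwm_coord_law_def using integral_rwm_law[OF \<sigma> z \<psi>_bm] comp by (subst integral_distr) auto
    have "KR_dist (rwm_coord_law d (prod_density h d) (\<sigma>\<^sup>2) n i z) \<mu> \<le> W z"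
      unfolding W_def c_def eq[symmetric] unfolding \<psi>_def
      by (rule KR_dist_le_hats) (use prob_\<mu> m law(1) comp in \<open>auto simp: rwm_coord_law_def intro: prob_space.prob_space_distr\<close>)
    then show ?thesis by (simp add: \<mu>_def)
  qed
  have s: "sets (lborel_PiM d) = sets (euclid d)" unfolding euclid_def by (intro sets_PiM_cong) auto
  have Wm: "W \<in> borel_measurable (lborel_PiM d)"
    unfolding measurable_cong_sets[OF s refl] using borel_measurable_integrable[OF W_int] by (simp add: measurable_cong_sets[OF sets_\<pi> refl])
  have pm: "prod_density h d \<in> borel_measurable (lborel_PiM d)"
    unfolding measurable_cong_sets[OF s refl] by measurable
  have "rwm_mean_KR h (\<sigma>\<^sup>2) d n i \<le> (\<integral>\<^sup>+z. ennreal (prod_density h d z) * ennreal (W z) \<partial>lborel_PiM d)"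
    unfolding rwm_mean_KR_def
  proof (rule nn_integral_mono)
    fix z assume "z \<in> space (lborel_PiM d)"
    then have "z \<in> space (euclid d)" using sets_eq_imp_space_eq[OF s] by simp
    then have "prod_density h d z * KR_dist (rwm_coord_law d (prod_density h d) (\<sigma>\<^sup>2) n i z) (density lborel h) \<le> prod_density h d z * W z"
      using KR prod_density_pos[of d z] by (intro mult_left_mono) auto
    then show "ennreal (prod_density h d z * KR_dist (rwm_coord_law d (prod_density h d) (\<sigma>\<^sup>2) n i z) (density lborel h)) \<le> ennreal (prod_density h d z) * ennreal (W z)"
      using W0 prod_density_pos[of d z] by (subst ennreal_mult[symmetric]) (auto intro: ennreal_leI)
  qed
  also have "\<dots> = (\<integral>\<^sup>+z. ennreal (W z) \<partial>\<pi> d)"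
    unfolding \<pi>_eq_density using pm Wm by (intro nn_integral_density[symmetric] measurable_compose[OF _ measurable_ennreal])
  also have "\<dots> = ennreal (\<integral>z. W z \<partial>\<pi> d)"
    using W_int W0 by (intro nn_integral_eq_integral) auto
  also have "(\<integral>z. W z \<partial>\<pi> d) = c + 2 * (\<Sum>j<2*N. \<integral>z. \<bar>(P.op ^^ n) (\<lambda>z. \<psi> j (z i)) z - (\<integral>x. \<psi> j x \<partial>\<mu>)\<bar> \<partial>\<pi> d)"
    unfolding W_def using P.integrable_bounded_measurable[OF bm] P.prob_space by simp
  finally show ?thesis unfolding c_def .
qed

text \<open>The budget: less than \<open>\<epsilon> / 4\<close> for the mesh, less than
  \<open>\<epsilon> / 4\<close> for the tail of \<open>\<mu>\<close>, and
  \<open>\<epsilon> / 2\<close> for the sum over the hats, which enters with factor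
  \<open>2\<close>. Mesh and cut-off are fixed before \<open>D\<close> and \<open>T\<close>.\<close>

lemma rwm_mean_KR_converges:
  assumes l: "l > 0" and \<epsilon>: "\<epsilon> > 0"
  shows "\<exists>(D::nat) (T::real). \<forall>(d::nat) (n::nat). d \<ge> D \<and> d \<ge> 2 \<and> real n \<ge> real d * T \<longrightarrow>
            (\<forall>i\<in>{1..d}. rwm_mean_KR h (l\<^sup>2 / (real d - 1)) d n i < ennreal \<epsilon>)"
proof -
  obtain m0 :: nat where m0: "8 / \<epsilon> < real m0" using reals_Archimedean2 by blast
  define m where "m = Suc m0"
  have m: "m > 0" "2 / real m < \<epsilon> / 4"
  proof -
    show "m > 0" by (simp add: m_def)
    have "8 / \<epsilon> < real m" using m0 by (simp add: m_def)
    then show "2 / real m < \<epsilon> / 4" using \<epsilon> by (simp add: field_simps m_def)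
  qed
  have "\<forall>\<^sub>F N in sequentially. 1 - \<epsilon> / 8 < (\<integral>x. hat (real m) (- real N) (real N) x \<partial>\<mu>)"
    using \<epsilon> m by (intro order_tendstoD(1)[OF integral_hat_tendsto]) auto
  then obtain N :: nat where N: "1 - \<epsilon> / 8 < (\<integral>x. hat (real m) (- real N) (real N) x \<partial>\<mu>)"
    by (auto simp: eventually_sequentially)
  define \<psi> where "\<psi> j = hat (real m) (- real N + real j) (- real N + real (Suc j))" for j
  have conv: "converges l (\<psi> j)" for j
  proof (rule converges_lipschitz[OF l])
    show "\<bar>\<psi> j x - \<psi> j y\<bar> \<le> (2 * \<bar>real m\<bar>) * \<bar>x - y\<bar>" for x y unfolding \<psi>_def by (rule hat_lipschitz)
    show "\<bar>\<psi> j x\<bar> \<le> 1" for x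
      using hat_bounds[of "- real N + real j" "- real N + real (Suc j)" "real m" x] by (simp add: \<psi>_def)
    show "\<psi> j x = 0" if "real N + real j + 2 < \<bar>x\<bar>" for x
    proof -
      have "\<bar>x\<bar> \<le> \<bar>real m * x\<bar>" using m by (simp add: abs_mult mult_le_cancel_right1)
      then have "real N + real j + 2 < \<bar>real m * x\<bar>" using that by linarith
      then have "real m * x \<le> - real N + real j \<or> - real N + real (Suc j) + 1 \<le> real m * x" by (auto simp: abs_if split: if_splits)
      then show ?thesis unfolding \<psi>_def using hat_eq_0[of "- real N + real j" "- real N + real (Suc j)" "real m" x] by auto
    qed
  qed auto
  \<comment> \<open>There are \<open>2 * N\<close> hats; the added \<open>1\<close> avoids a
    division by zero when \<open>N = 0\<close>.\<close>
  define \<delta> where "\<delta> = \<epsilon> / (4 * (2 * real N + 1))"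
  have \<delta>: "\<delta> > 0" using \<epsilon> by (simp add: \<delta>_def)
  define Q where "Q j D T \<longleftrightarrow> (\<forall>d\<ge>D. \<forall>n. \<forall>i\<in>{1..d}. 2 \<le> d \<longrightarrow> real d * T \<le> real n \<longrightarrow>
     (\<integral>z. \<bar>(rwm_op d (l / sqrt (real (d - 1))) ^^ n) (\<lambda>z. \<psi> j (z i)) z - (\<integral>x. \<psi> j x \<partial>\<mu>)\<bar> \<partial>\<pi> d) < \<delta>)" for j D T
  have "\<exists>D T. Q j D T" for j using conv[of j] \<delta> unfolding converges_def Q_def by blast
  then obtain D T where DT: "\<And>j. Q j (D j) (T j)" by metis
  \<comment> \<open>Sums of nonnegative numbers serve as common upper bounds of the thresholds; the
    absolute values are there because a \<open>T j\<close> may be negative.\<close>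
  define D' where "D' = (\<Sum>j<2*N. D j)"
  define T' where "T' = (\<Sum>j<2*N. \<bar>T j\<bar>)"
  have D': "D j \<le> D'" if "j < 2*N" for j unfolding D'_def using that by (intro member_le_sum) auto
  have T': "T j \<le> T'" if "j < 2*N" for j
    using member_le_sum[of j "{..<2*N}" "\<lambda>j. \<bar>T j\<bar>"] that unfolding T'_def by auto
  have "rwm_mean_KR h (l\<^sup>2 / (real d - 1)) d n i < ennreal \<epsilon>"
    if d: "D' \<le> d" "2 \<le> d" and n: "real d * T' \<le> real n" and i: "i \<in> {1..d}" for d n i
  proof -
    define \<sigma> where "\<sigma> = l / sqrt (real (d - 1))"
    have \<sigma>: "\<sigma> > 0" "\<sigma>\<^sup>2 = l\<^sup>2 / (real d - 1)"
      using l d by (auto simp: \<sigma>_def power_divide of_nat_diff)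
    have each: "(\<integral>z. \<bar>(rwm_op d \<sigma> ^^ n) (\<lambda>z. \<psi> j (z i)) z - (\<integral>x. \<psi> j x \<partial>\<mu>)\<bar> \<partial>\<pi> d) \<le> \<delta>" if "j < 2*N" for j
    proof -
      have "real d * T j \<le> real n" using n mult_left_mono[OF T'[OF that], of "real d"] by simp
      then show ?thesis unfolding \<sigma>_def using DT[of j] D'[OF that] d i unfolding Q_def by (intro less_imp_le) auto
    qed
    have "(\<Sum>j<2*N. \<integral>z. \<bar>(rwm_op d \<sigma> ^^ n) (\<lambda>z. \<psi> j (z i)) z - (\<integral>x. \<psi> j x \<partial>\<mu>)\<bar> \<partial>\<pi> d) \<le> real (2 * N) * \<delta>"
      using each by (intro order_trans[OF sum_bounded_above[where K=\<delta>]]) auto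
    also have "\<dots> \<le> \<epsilon> / 4" using \<epsilon> by (simp add: \<delta>_def field_simps)
    finally have sum: "(\<Sum>j<2*N. \<integral>z. \<bar>(rwm_op d \<sigma> ^^ n) (\<lambda>z. \<psi> j (z i)) z - (\<integral>x. \<psi> j x \<partial>\<mu>)\<bar> \<partial>\<pi> d) \<le> \<epsilon> / 4" .
    have "rwm_mean_KR h (\<sigma>\<^sup>2) d n i \<le> ennreal (2 / real m + 2 * (1 - (\<integral>x. hat (real m) (- real N) (real N) x \<partial>\<mu>))
      + 2 * (\<Sum>j<2*N. \<integral>z. \<bar>(rwm_op d \<sigma> ^^ n) (\<lambda>z. \<psi> j (z i)) z - (\<integral>x. \<psi> j x \<partial>\<mu>)\<bar> \<partial>\<pi> d))"
      unfolding \<psi>_def by (rule rwm_mean_KR_le[OF \<sigma>(1) i m(1)])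
    also have "\<dots> < ennreal \<epsilon>"
    proof (rule ennreal_lessI[OF \<epsilon>])
      have arith: "a + 2 * (1 - b) + 2 * s < \<epsilon>" if "a < \<epsilon> / 4" "1 - \<epsilon> / 8 < b" "s \<le> \<epsilon> / 4" for a b s
        using that by simp
      show "2 / real m + 2 * (1 - (\<integral>x. hat (real m) (- real N) (real N) x \<partial>\<mu>))
        + 2 * (\<Sum>j<2*N. \<integral>z. \<bar>(rwm_op d \<sigma> ^^ n) (\<lambda>z. \<psi> j (z i)) z - (\<integral>x. \<psi> j x \<partial>\<mu>)\<bar> \<partial>\<pi> d) < \<epsilon>"
        by (rule arith[OF m(2) N sum])
    qed
    finally show ?thesis unfolding \<sigma>(2) .
  qed
  then show ?thesis by blast
qed

end

theorem theorem2:
  fixes h h' h'' :: "real \<Rightarrow> real" and l :: real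
  assumes h_pos: "\<And>x. h x > 0"
    and h_density: "prob_space (density lborel h)"
    and h_deriv: "\<And>x. (h has_real_derivative h' x) (at x)"
    and h'_deriv: "\<And>x. (h' has_real_derivative h'' x) (at x)"
    and h''_cont: "continuous_on UNIV h''"
    and lipschitz: "\<exists>C. C-lipschitz_on UNIV (\<lambda>x. h' x / h x)"
    and moment8: "integrable lborel (\<lambda>x. (h' x / h x) ^ 8 * h x)"
    and moment4: "integrable lborel (\<lambda>x. (h'' x / h x) ^ 4 * h x)"
    and l_pos: "l > 0"
  shows "(\<forall>\<epsilon>>0. \<exists>(D::nat) (T::real). \<forall>(t::real) (d::nat). t \<ge> T \<and> d \<ge> D \<and> d \<ge> 2 \<longrightarrow>
            rwm_mean_KR h (l\<^sup>2 / (real d - 1)) d (nat \<lfloor>real d * t\<rfloor>) 1 < ennreal \<epsilon>) \<and>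
         (\<forall>\<epsilon>>0. \<exists>(D::nat) (T::real). \<forall>(d::nat) (n::nat). d \<ge> D \<and> d \<ge> 2 \<and> real n \<ge> real d * T \<longrightarrow>
            (\<forall>i\<in>{1..d}. rwm_mean_KR h (l\<^sup>2 / (real d - 1)) d n i < ennreal \<epsilon>))"
proof -
  obtain C where C: "C-lipschitz_on UNIV (\<lambda>x. h' x / h x)" using lipschitz by blast
  interpret target h h' h'' C
    by (rule target.intro) (fact h_pos h_density h_deriv h'_deriv h''_cont C moment8 moment4)+
  show ?thesis
  proof (intro conjI allI impI)
    fix \<epsilon> :: real assume \<epsilon>: "\<epsilon> > 0"
    show "\<exists>(D::nat) (T::real). \<forall>(d::nat) (n::nat). d \<ge> D \<and> d \<ge> 2 \<and> real n \<ge> real d * T \<longrightarrow>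
            (\<forall>i\<in>{1..d}. rwm_mean_KR h (l\<^sup>2 / (real d - 1)) d n i < ennreal \<epsilon>)"
      by (rule rwm_mean_KR_converges[OF l_pos \<epsilon>])
  next
    fix \<epsilon> :: real assume \<epsilon>: "\<epsilon> > 0"
    obtain D T where DT: "\<And>d n i. D \<le> d \<Longrightarrow> 2 \<le> d \<Longrightarrow> real d * T \<le> real n \<Longrightarrow> i \<in> {1..d} \<Longrightarrow>
        rwm_mean_KR h (l\<^sup>2 / (real d - 1)) d n i < ennreal \<epsilon>"
      using rwm_mean_KR_converges[OF l_pos \<epsilon>] by metis
    have "rwm_mean_KR h (l\<^sup>2 / (real d - 1)) d (nat \<lfloor>real d * t\<rfloor>) 1 < ennreal \<epsilon>"
      if "T + 1 \<le> t" "D \<le> d" "2 \<le> d" for t :: real and d :: nat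
    proof (rule DT)
      \<comment> \<open>The floor loses less than one step, which the extra \<open>1\<close> in
        \<open>T + 1\<close> covers because \<open>d\<close> is at least \<open>1\<close>.\<close>
      have "real d * (T + 1) \<le> real d * t" using that by (intro mult_left_mono) auto
      moreover have "real d * t - 1 \<le> real (nat \<lfloor>real d * t\<rfloor>)" by linarith
      ultimately show "real d * T \<le> real (nat \<lfloor>real d * t\<rfloor>)"
        using that by (simp add: distrib_left)
    qed (use that in auto)
    then show "\<exists>(D::nat) (T::real). \<forall>(t::real) (d::nat). t \<ge> T \<and> d \<ge> D \<and> d \<ge> 2 \<longrightarrow>
            rwm_mean_KR h (l\<^sup>2 / (real d - 1)) d (nat \<lfloor>real d * t\<rfloor>) 1 < ennreal \<epsilon>"
      by blast
  qed
qed

end
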